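(* Let $\omega\ne0$ and consider the planar system $$\dot v=\mu v-\omega w+f(v,w;\alpha),\qquad \dot w=\omega v+\mu w+g(v,w;\beta),$$ $$f=a_{11}v[v]_{\alpha_{1_-}}^{\alpha_{1_+}}+a_{12}v[w]_{\alpha_{2_-}}^{\alpha_{2_+}}+a_{21}w[v]_{\alpha_{3_-}}^{\alpha_{3_+}}+a_{22}w[w]_{\alpha_{4_-}}^{\alpha_{4_+}},$$ $$g=b_{11}v[v]_{\beta_{1_-}}^{\beta_{1_+}}+b_{12}v[w]_{\beta_{2_-}}^{\beta_{2_+}}+b_{21}w[v]_{\beta_{3_-}}^{\beta_{3_+}}+b_{22}w[w]_{\beta_{4_-}}^{\beta_{4_+}},$$ with real coefficients $a_{ij},b_{ij}$, real slopes $\alpha_{i_\pm},\beta_{i_\pm}$, and $\mu\in\mathbb{R}$. Let $$\widetilde\sigma_{\#}=a_{11}(\alpha_{1_+}-\alpha_{1_-})+\tfrac12a_{12}(\alpha_{2_+}-\alpha_{2_-})+\tfrac12b_{21}(\beta_{3_+}-\beta_{3_-})+b_{22}(\beta_{4_+}-\beta_{4_-}).$$ If $\widetilde\sigma_{\#}\ne0$, then there exists an interval $I$ around $\mu=0$ such that at $\mu=0$ the system undergoes a degenerate Hopf bifurcation in $\mu$, where the leading order amplitude of the locally unique periodic orbits is given by $$r_0(\mu)=-\frac{3\pi}{2\widetilde\sigma_{\#}}\mu+\mathcal{O}(\mu^2).$$ In particular, the unique bifurcating branch of periodic solutions emerges subcritically if $\widetilde\sigma_{\#}>0$ and supercritically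 if $\widetilde\sigma_{\#}<0$. Moreover, the bifurcating periodic orbits have exchanged stability with the equilibrium at $r=0$, i.e., they are stable if they exist for $\mu>0$ and unstable if they exist for $\mu<0$.
   Context: For $p_+,p_-\in\mathbb{R}$, $[u]_{p_-}^{p_+}=p_+u$ if $u\ge0$ and $[u]_{p_-}^{p_+}=p_-u$ if $u<0$. Polar coordinates are $(v,w)=(r\cos\varphi,r\sin\varphi)$; $r_0=r(0)\ge0$ is the radius at $\varphi=0$ of the periodic orbit. "Degenerate Hopf bifurcation" means that a branch of periodic orbits emerges from the origin at $\mu=0$ with the stated amplitude law, linear in $\mu$. The bifurcation is supercritical if the bifurcating periodic orbits coexist with the more unstable equilibrium (here $\mu>0$), and subcritical if they coexist with the more stable equilibrium (here $\mu<0$). Local uniqueness is for periodic orbits in a neighborhood of the origin, $\mu\in I$. *)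

theory Defs
  imports "HOL-Analysis.Analysis" "HOL-Library.Landau_Symbols"
begin

type_synonym plane = "real \<times> real"

section \<open>Solutions, periodic orbits, stability\<close>

definition solves_on :: "(plane \<Rightarrow> plane) \<Rightarrow> (real \<Rightarrow> plane) \<Rightarrow> real set \<Rightarrow> bool" where
  "solves_on F x J \<longleftrightarrow> (\<forall>t\<in>J. (x has_vector_derivative F (x t)) (at t within J))"

text \<open>Orbits are subsets of the plane, so that uniqueness of a periodic orbit is not spoiled by
  time shifts. Equilibria are excluded.\<close>

definition periodic_orbit :: "(plane \<Rightarrow> plane) \<Rightarrow> plane set \<Rightarrow> bool" where
  "periodic_orbit F \<Gamma> \<longleftrightarrow>
     (\<exists>x T. solves_on F x UNIV \<and> T > 0 \<and> (\<forall>t. x (t + T) = x t) \<and>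
            (\<exists>t. x t \<noteq> x 0) \<and> \<Gamma> = range x)"

text \<open>Stability of an invariant set: Lyapunov stability of an equilibrium \<open>p\<close> for
  \<open>\<Gamma> = {p}\<close>, orbital stability for a periodic orbit \<open>\<Gamma>\<close>. All solutions on
  bounded forward time intervals are considered, so that failure of stability means that
  solutions starting arbitrarily close to \<open>\<Gamma>\<close> really leave a fixed neighborhood.\<close>

definition stable :: "(plane \<Rightarrow> plane) \<Rightarrow> plane set \<Rightarrow> bool" where
  "stable F \<Gamma> \<longleftrightarrow>
     (\<forall>\<epsilon>>0. \<exists>\<delta>>0. \<forall>x. \<forall>T\<ge>0. solves_on F x {0..T} \<longrightarrow> infdist (x 0) \<Gamma> < \<delta> \<longrightarrow>
        (\<forall>t\<in>{0..T}. infdist (x t) \<Gamma> < \<epsilon>))"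

definition asymptotically_stable :: "(plane \<Rightarrow> plane) \<Rightarrow> plane set \<Rightarrow> bool" where
  "asymptotically_stable F \<Gamma> \<longleftrightarrow> stable F \<Gamma> \<and>
     (\<exists>\<delta>>0. \<forall>p. infdist p \<Gamma> < \<delta> \<longrightarrow>
        (\<exists>x. solves_on F x {0..} \<and> x 0 = p) \<and>
        (\<forall>x. solves_on F x {0..} \<longrightarrow> x 0 = p \<longrightarrow> ((\<lambda>t. infdist (x t) \<Gamma>) \<longlongrightarrow> 0) at_top))"

abbreviation unstable :: "(plane \<Rightarrow> plane) \<Rightarrow> plane set \<Rightarrow> bool" where
  "unstable F \<Gamma> \<equiv> \<not> stable F \<Gamma>"


section \<open>Bifurcation from the origin\<close>

text \<open>\<open>\<Gamma>\<close> meets the ray with polar angle \<open>\<phi>\<close> in exactly one point, at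
  radius \<open>r\<close>.\<close>

definition polar_radius :: "plane set \<Rightarrow> real \<Rightarrow> real \<Rightarrow> bool" where
  "polar_radius \<Gamma> \<phi> r \<longleftrightarrow> {s. s \<ge> 0 \<and> (s * cos \<phi>, s * sin \<phi>) \<in> \<Gamma>} = {r}"

definition local_periodic_orbit ::
    "(real \<Rightarrow> plane \<Rightarrow> plane) \<Rightarrow> plane set \<Rightarrow> real \<Rightarrow> plane set \<Rightarrow> bool" where
  "local_periodic_orbit F U \<mu> \<Gamma> \<longleftrightarrow> periodic_orbit (F \<mu>) \<Gamma> \<and> \<Gamma> \<subseteq> U"

text \<open>A branch of locally unique periodic orbits of \<open>F \<mu>\<close>, \<open>\<mu> \<in> I\<close>, emerges from
  the equilibrium \<open>0\<close> at \<open>\<mu> = 0\<close>, and its radius \<open>r0 \<mu>\<close> at polar angle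
  \<open>0\<close> is \<open>c * \<mu> + O(\<mu>\<^sup>2)\<close>. Since a radius is nonnegative, the orbits exist only on
  the side \<open>c * \<mu> > 0\<close>; the values of \<open>r0\<close> elsewhere are irrelevant. The
  neighborhood \<open>U\<close> does not depend on \<open>\<mu>\<close>.\<close>

definition degenerate_Hopf ::
    "(real \<Rightarrow> plane \<Rightarrow> plane) \<Rightarrow> real set \<Rightarrow> plane set \<Rightarrow> (real \<Rightarrow> real) \<Rightarrow> real \<Rightarrow> bool" where
  "degenerate_Hopf F I U r0 c \<longleftrightarrow> c \<noteq> 0 \<and>
     (\<forall>\<mu>\<in>I. F \<mu> 0 = 0) \<and>
     (\<forall>\<mu>\<in>I. c * \<mu> > 0 \<longrightarrow> (\<exists>!\<Gamma>. local_periodic_orbit F U \<mu> \<Gamma>)) \<and>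
     (\<forall>\<mu>\<in>I. c * \<mu> \<le> 0 \<longrightarrow> \<not> (\<exists>\<Gamma>. local_periodic_orbit F U \<mu> \<Gamma>)) \<and>
     (\<forall>\<mu>\<in>I. \<forall>\<Gamma>. local_periodic_orbit F U \<mu> \<Gamma> \<longrightarrow> r0 \<mu> > 0 \<and> polar_radius \<Gamma> 0 (r0 \<mu>)) \<and>
     (\<forall>\<epsilon>>0. \<exists>\<delta>>0. \<forall>\<mu>\<in>I. \<bar>\<mu>\<bar> < \<delta> \<longrightarrow>
        (\<forall>\<Gamma>. local_periodic_orbit F U \<mu> \<Gamma> \<longrightarrow> \<Gamma> \<subseteq> ball 0 \<epsilon>)) \<and>
     (\<lambda>\<mu>. r0 \<mu> - c * \<mu>) \<in> O[at 0 within {\<mu>\<in>I. c * \<mu> > 0}](\<lambda>\<mu>. \<mu>\<^sup>2)"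

definition supercritical :: "(real \<Rightarrow> plane \<Rightarrow> plane) \<Rightarrow> real set \<Rightarrow> plane set \<Rightarrow> bool" where
  "supercritical F I U \<longleftrightarrow>
     {\<mu>\<in>I. \<exists>\<Gamma>. local_periodic_orbit F U \<mu> \<Gamma>} = {\<mu>\<in>I. \<mu> > 0} \<and>
     (\<forall>\<mu>\<in>I. \<mu> > 0 \<longrightarrow> unstable (F \<mu>) {0})"

definition subcritical :: "(real \<Rightarrow> plane \<Rightarrow> plane) \<Rightarrow> real set \<Rightarrow> plane set \<Rightarrow> bool" where
  "subcritical F I U \<longleftrightarrow>
     {\<mu>\<in>I. \<exists>\<Gamma>. local_periodic_orbit F U \<mu> \<Gamma>} = {\<mu>\<in>I. \<mu> < 0} \<and>
     (\<forall>\<mu>\<in>I. \<mu> < 0 \<longrightarrow> asymptotically_stable (F \<mu>) {0})"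


section \<open>The planar system\<close>

text \<open>\<open>pl p q u\<close> has slope \<open>p\<close> for \<open>u \<ge> 0\<close> and slope \<open>q\<close> for
  \<open>u < 0\<close>.\<close>

definition pl :: "real \<Rightarrow> real \<Rightarrow> real \<Rightarrow> real" where
  "pl p q u = (if u \<ge> 0 then p * u else q * u)"

text \<open>The common form of \<open>f\<close> and \<open>g\<close>: \<open>k i j\<close> (\<open>i, j \<in> {1, 2}\<close>) are the
  coefficients and \<open>p i\<close>, \<open>q i\<close> (\<open>i \<in> {1, \<dots>, 4}\<close>) the slopes for nonnegative
  and negative arguments.\<close>

definition quad :: "(nat \<Rightarrow> nat \<Rightarrow> real) \<Rightarrow> (nat \<Rightarrow> real) \<Rightarrow> (nat \<Rightarrow> real) \<Rightarrow> real \<Rightarrow> real \<Rightarrow> real" where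
  "quad k p q v w =
     k 1 1 * v * pl (p 1) (q 1) v + k 1 2 * v * pl (p 2) (q 2) w +
     k 2 1 * w * pl (p 3) (q 3) v + k 2 2 * w * pl (p 4) (q 4) w"

definition planar_field ::
    "real \<Rightarrow> (nat \<Rightarrow> nat \<Rightarrow> real) \<Rightarrow> (nat \<Rightarrow> real) \<Rightarrow> (nat \<Rightarrow> real) \<Rightarrow>
     (nat \<Rightarrow> nat \<Rightarrow> real) \<Rightarrow> (nat \<Rightarrow> real) \<Rightarrow> (nat \<Rightarrow> real) \<Rightarrow> real \<Rightarrow> plane \<Rightarrow> plane" where
  "planar_field \<omega> a \<alpha>p \<alpha>m b \<beta>p \<beta>m \<mu> = (\<lambda>(v, w).
     (\<mu> * v - \<omega> * w + quad a \<alpha>p \<alpha>m v w,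
      \<omega> * v + \<mu> * w + quad b \<beta>p \<beta>m v w))"

definition sigma_sharp ::
    "(nat \<Rightarrow> nat \<Rightarrow> real) \<Rightarrow> (nat \<Rightarrow> real) \<Rightarrow> (nat \<Rightarrow> real) \<Rightarrow>
     (nat \<Rightarrow> nat \<Rightarrow> real) \<Rightarrow> (nat \<Rightarrow> real) \<Rightarrow> (nat \<Rightarrow> real) \<Rightarrow> real" where
  "sigma_sharp a \<alpha>p \<alpha>m b \<beta>p \<beta>m =
     a 1 1 * (\<alpha>p 1 - \<alpha>m 1) + 1/2 * a 1 2 * (\<alpha>p 2 - \<alpha>m 2) +
     1/2 * b 2 1 * (\<beta>p 3 - \<beta>m 3) + b 2 2 * (\<beta>p 4 - \<beta>m 4)"

end

theory Submission
  imports Defs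
begin

text \<open>In polar coordinates a planar field with rotation \<open>\<omega>\<close> and a positively homogeneous quadratic part
  \<open>Q\<close> reads \<open>r' = \<mu> r + \<kappa>(\<theta>) r\<^sup>2\<close>, \<open>\<theta>' = \<omega> + \<Omega>(\<theta>) r\<close>. Let \<open>s\<close> be the mean of \<open>\<kappa>\<close> and
  let \<open>h\<close> be the periodic function with \<open>\<omega> h' = \<kappa> - s\<close>. Then \<open>u = 1/r + h(\<theta>)\<close> satisfies
  \<open>u' = - \<mu>/r - s + h'(\<theta>) \<Omega>(\<theta>) r\<close>, which for \<open>\<mu> s \<ge> 0\<close> has the sign of \<open>- s\<close> near the origin,
  so that there are no periodic orbits. By time reversal let \<open>s < 0 < \<mu>\<close>. The deviation of \<open>u\<close> from
  \<open>- s/\<mu>\<close> obeys a weakly damped scalar equation in the angle, whose return map sends a fixed interval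
  to itself; its fixed point is a periodic orbit \<open>r = \<rho>(\<theta>) = - \<mu>/s + O(\<mu>\<^sup>2)\<close>. Along every other solution
  the ratio \<open>Z + 1\<close> of the values of \<open>u\<close> at \<open>\<rho>(\<theta>)\<close> and at \<open>r\<close> satisfies \<open>Z' = - g Z\<close> with
  \<open>g \<ge> - s r/4\<close> in a neighborhood of the origin independent of \<open>\<mu>\<close>. This yields uniqueness and
  asymptotic stability; instability is asymptotic stability for the reversed field.\<close>

text \<open>The quadratic part is in general only Lipschitz: \<open>v * \<bar>w\<bar>\<close> has no
  derivative across the line \<open>w = 0\<close>. Smooth normal forms and the implicit function
  theorem for a return map therefore do not apply directly, and the steps rest on explicit scalar
  estimates. The reciprocal \<open>1/r\<close> turns the Bernoulli-type radial equation into an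
  affine one; adding \<open>h\<close> removes the oscillating part of its forcing at the price of an
  error of order \<open>r\<close>. The second obstacle is uniformity: the orbits have radius of
  order \<mu>, yet uniqueness is claimed in a disc that does not shrink with \<mu>. A fixed point
  argument on the scale \<mu> gives existence only. For uniqueness, solutions are compared with the
  orbit at equal angles. In the averaged case \<open>h = \<Omega> = 0\<close>,
  \<open>\<rho> = - \<mu>/s\<close> one has \<open>Z = r/\<rho> - 1\<close> and exactly
  \<open>Z' = s r Z\<close>: the rate depends on \<open>r\<close> and not on \<mu>, and all
  corrections are small relative to it once the disc is small. Decay estimates are first shown for
  solutions that stay in a neighborhood; a trapping argument removes this proviso.\<close>

section \<open>Ordinary differential equations\<close>

lemma nonincreasing_within:
  fixes f :: "real \<Rightarrow> real"
  assumes "0 \<le> T"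
    and d: "\<And>t. t \<in> {0..T} \<Longrightarrow> (f has_vector_derivative f' t) (at t within {0..T})"
    and le: "\<And>t. t \<in> {0..T} \<Longrightarrow> f' t \<le> 0"
  shows "f T \<le> f 0"
proof (cases "T = 0")
  case False
  with assms have T: "0 < T" by simp
  show ?thesis
  proof (rule DERIV_nonpos_imp_decreasing_open[OF T[THEN less_imp_le]])
    fix x assume x: "0 < x" "x < T"
    then have "(f has_vector_derivative f' x) (at x)"
      using d[of x] by (simp add: at_within_Icc_at)
    then show "\<exists>y. DERIV f x :> y \<and> y \<le> 0"
      using le[of x] x by (auto simp: has_real_derivative_iff_has_vector_derivative)
  next
    show "continuous_on {0..T} f"
      using d by (meson continuous_on_eq_continuous_within has_vector_derivative_continuous)
  qed
qed simp

text \<open>If \<open>Z' = - g Z\<close> with \<open>g \<ge> \<gamma>\<close>, then \<open>Z\<^sup>2 exp (2 \<gamma> t)\<close> does not increase.\<close>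

lemma decay_within:
  fixes Z :: "real \<Rightarrow> real"
  assumes T: "0 \<le> T"
    and d: "\<And>t. t \<in> {0..T} \<Longrightarrow> (Z has_vector_derivative - g t * Z t) (at t within {0..T})"
    and g: "\<And>t. t \<in> {0..T} \<Longrightarrow> \<gamma> \<le> g t"
  shows "\<bar>Z T\<bar> \<le> exp (- \<gamma> * T) * \<bar>Z 0\<bar>"
proof -
  \<comment> \<open>The square avoids both a case distinction on the sign of \<open>Z\<close> and
    the kink of the absolute value.\<close>
  let ?f = "\<lambda>t. (Z t)\<^sup>2 * exp (2 * \<gamma> * t)"
  let ?f' = "\<lambda>t. 2 * (\<gamma> - g t) * ((Z t)\<^sup>2 * exp (2 * \<gamma> * t))"
  have "?f T \<le> ?f 0"
  proof (rule nonincreasing_within[OF T])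
    fix t assume t: "t \<in> {0..T}"
    have "(Z has_real_derivative - g t * Z t) (at t within {0..T})"
      using d[OF t] by (simp add: has_real_derivative_iff_has_vector_derivative)
    then have "((\<lambda>t. (Z t)\<^sup>2) has_real_derivative 2 * (- g t * Z t * Z t)) (at t within {0..T})"
      by (rule DERIV_power[THEN DERIV_cong]) simp
    moreover have "((\<lambda>t. exp (2 * \<gamma> * t)) has_real_derivative 2 * \<gamma> * exp (2 * \<gamma> * t)) (at t within {0..T})"
      by (auto intro!: derivative_eq_intros)
    ultimately have "(?f has_real_derivative ?f' t) (at t within {0..T})"
      by (rule DERIV_mult[THEN DERIV_cong]) (simp add: algebra_simps power2_eq_square)
    then show "(?f has_vector_derivative ?f' t) (at t within {0..T})"
      by (simp add: has_real_derivative_iff_has_vector_derivative)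
    show "?f' t \<le> 0" using g[OF t]
      by (simp add: mult_nonpos_nonneg)
  qed
  moreover have "exp (2 * \<gamma> * T) = exp (\<gamma> * T) ^ 2"
    using exp_double[of "\<gamma> * T"] by (simp add: mult.assoc)
  ultimately have "(Z T)\<^sup>2 * exp (\<gamma> * T) ^ 2 \<le> (Z 0)\<^sup>2" by simp
  then have "(\<bar>Z T\<bar> * exp (\<gamma> * T))\<^sup>2 \<le> \<bar>Z 0\<bar>\<^sup>2" by (simp add: power_mult_distrib)
  then have "\<bar>Z T\<bar> * exp (\<gamma> * T) \<le> \<bar>Z 0\<bar>" by (rule power2_le_imp_le) simp
  then show ?thesis by (simp add: exp_minus field_simps)
qed

section \<open>Global solutions of Lipschitz initial value problems\<close>

lemma antiderivative_exists:
  fixes g :: "real \<Rightarrow> 'a::euclidean_space"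
  assumes "continuous_on UNIV g"
  shows "\<exists>X. X 0 = 0 \<and> (\<forall>t. (X has_vector_derivative g t) (at t))"
proof -
  have "\<exists>F. \<forall>x::real. (-\<infinity>::ereal) < ereal x \<longrightarrow> ereal x < \<infinity> \<longrightarrow> (F has_vector_derivative g x) (at x)"
    by (rule einterval_antiderivative) (use assms in \<open>auto simp: continuous_on_eq_continuous_at\<close>)
  then obtain F where F: "\<And>x. (F has_vector_derivative g x) (at x)" by auto
  show ?thesis
    by (rule exI[of _ "\<lambda>t. F t - F 0"]) (auto intro!: derivative_eq_intros F)
qed

text \<open>Integration gains a factor \<open>1 / K\<close> in the norm weighted by
  \<open>exp (K * t)\<close>. This gain is what makes the Picard operator contract.\<close>

lemma exp_bound_antiderivative_nonneg:
  fixes X :: "real \<Rightarrow> 'a::euclidean_space"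
  assumes K: "K > 0" and X0: "X 0 = 0"
    and X: "\<And>t. (X has_vector_derivative g t) (at t)"
    and g: "\<And>t. t \<ge> 0 \<Longrightarrow> norm (g t) \<le> C * exp (K * t)"
    and t: "t \<ge> 0"
  shows "norm (X t) \<le> C / K * (exp (K * t) - 1)"
proof (cases "t = 0")
  case False
  then have t: "0 < t" using t by simp
  have "norm (X t - X 0) \<le> C / K * exp (K * t) - C / K * exp (K * 0)"
  proof (rule differentiable_bound_general[OF t, where f' = g and \<phi>' = "\<lambda>t. C * exp (K * t)"])
    show "continuous_on {0..t} X"
      using X by (meson continuous_at_imp_continuous_on has_vector_derivative_continuous)
    show "continuous_on {0..t} (\<lambda>t. C / K * exp (K * t))" by (intro continuous_intros)
    fix x :: real assume "0 < x" "x < t"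
    then show "norm (g x) \<le> C * exp (K * x)" using g by simp
    have "((\<lambda>t. C / K * exp (K * t)) has_real_derivative C * exp (K * x)) (at x)"
      using K by (auto intro!: derivative_eq_intros)
    then show "((\<lambda>t. C / K * exp (K * t)) has_vector_derivative C * exp (K * x)) (at x)"
      by (simp add: has_real_derivative_iff_has_vector_derivative)
  qed (use X in auto)
  then show ?thesis using X0 by (simp add: algebra_simps)
qed (use X0 in simp)

lemma exp_bound_antiderivative:
  fixes X :: "real \<Rightarrow> 'a::euclidean_space"
  assumes K: "K > 0" and X0: "X 0 = 0"
    and X: "\<And>t. (X has_vector_derivative g t) (at t)"
    and g: "\<And>t. norm (g t) \<le> C * exp (K * \<bar>t\<bar>)"
  shows "norm (X t) \<le> C / K * exp (K * \<bar>t\<bar>)"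
proof -
  have C: "0 \<le> C" using g[of 0] norm_ge_zero[of "g 0"] by (simp del: norm_ge_zero)
  have "norm (X t) \<le> C / K * (exp (K * \<bar>t\<bar>) - 1)"
  proof (cases "t \<ge> 0")
    case True
    have "norm (g s) \<le> C * exp (K * s)" if "s \<ge> 0" for s
      using g[of s] that by simp
    from exp_bound_antiderivative_nonneg[OF K X0 X this] True show ?thesis by simp
  next
    case False
    have "((\<lambda>s. X (- s)) has_vector_derivative - g (- s)) (at s)" for s
    proof -
      have "(uminus has_vector_derivative (- 1 :: real)) (at s)"
        by (auto intro!: derivative_eq_intros)
      from vector_diff_chain_at[OF this X] show ?thesis by (simp add: o_def)
    qed
    note D = this
    have "norm (- g (- s)) \<le> C * exp (K * s)" if "s \<ge> 0" for s
      using g[of "-s"] that by simp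
    then have "norm (X (- (- t))) \<le> C / K * (exp (K * (- t)) - 1)"
      by (intro exp_bound_antiderivative_nonneg[OF K _ D]) (use X0 False in auto)
    with False show ?thesis by simp
  qed
  also have "\<dots> \<le> C / K * exp (K * \<bar>t\<bar>)" using C K by (intro mult_left_mono) auto
  finally show ?thesis .
qed

text \<open>Picard iteration in the exponentially weighted sup norm, where the integral operator is a
  contraction on the whole line.\<close>

theorem ivp_global:
  fixes f :: "real \<Rightarrow> 'a::euclidean_space \<Rightarrow> 'a"
  assumes cont: "continuous_on UNIV (\<lambda>(t, y). f t y)"
    and lip: "\<And>t. L-lipschitz_on UNIV (f t)"
    and bd: "\<And>t. norm (f t p) \<le> B"
  shows "\<exists>x. x 0 = p \<and> (\<forall>t. (x has_vector_derivative f t (x t)) (at t))"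
proof -
  have L: "0 \<le> L" using lip[of 0] by (rule lipschitz_on_nonneg)
  have B: "0 \<le> B" using bd[of 0] norm_ge_zero[of "f 0 p"] by linarith
  \<comment> \<open>The integral gains \<open>1 / K\<close> and the Lipschitz bound costs
    \<open>L\<close>. This choice makes the product at most 1/2 and stays positive for
    \<open>L = 0\<close>.\<close>
  define K where "K = 2 * L + 1"
  have K: "K > 0" "L / K \<le> 1 / 2" using L by (auto simp: K_def field_simps)
  \<comment> \<open>The unknown \<open>y\<close> is a bounded function; the solution itself is
    \<open>p + exp (K * \<bar>s\<bar>) *\<^sub>R y s\<close>, which may grow exponentially.\<close>
  define g where "g y s = f s (p + exp (K * \<bar>s\<bar>) *\<^sub>R apply_bcontfun y s)" for y s
  define A where "A y = (SOME X. X 0 = 0 \<and> (\<forall>t. (X has_vector_derivative g y t) (at t)))" for y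
  have g_cont: "continuous_on UNIV (g y)" for y
    unfolding g_def
    by (rule continuous_on_compose2[OF cont, of _ "\<lambda>s. (s, p + exp (K * \<bar>s\<bar>) *\<^sub>R apply_bcontfun y s)", simplified])
      (intro continuous_intros continuous_on_apply_bcontfun)
  have "\<exists>X. X 0 = 0 \<and> (\<forall>t. (X has_vector_derivative g y t) (at t))" for y
    by (rule antiderivative_exists[OF g_cont])
  from someI_ex[OF this] have A0: "A y 0 = 0"
    and A': "\<And>t. (A y has_vector_derivative g y t) (at t)" for y
    unfolding A_def by blast+
  have g_dist: "norm (g y s - g z s) \<le> L * dist y z * exp (K * \<bar>s\<bar>)" for y z s
  proof -
    have "norm (g y s - g z s) \<le> L * norm (exp (K * \<bar>s\<bar>) *\<^sub>R (apply_bcontfun y s - apply_bcontfun z s))"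
      using lipschitz_on_normD[OF lip[of s], of "p + exp (K * \<bar>s\<bar>) *\<^sub>R apply_bcontfun y s"
          "p + exp (K * \<bar>s\<bar>) *\<^sub>R apply_bcontfun z s"]
      by (simp add: g_def scaleR_diff_right)
    also have "\<dots> \<le> L * (exp (K * \<bar>s\<bar>) * dist y z)"
      using L dist_bounded[of y s z] by (intro mult_left_mono) (auto simp: dist_norm)
    finally show ?thesis by (simp add: mult_ac)
  qed
  have g_0: "norm (g 0 s) \<le> B * exp (K * \<bar>s\<bar>)" for s
  proof -
    have "norm (g 0 s) \<le> B * 1" using bd[of s] by (simp add: g_def)
    also have "\<dots> \<le> B * exp (K * \<bar>s\<bar>)" using B K by (intro mult_left_mono) auto
    finally show ?thesis .
  qed
  define \<Phi> where "\<Phi> y = Bcontfun (\<lambda>t. exp (- K * \<bar>t\<bar>) *\<^sub>R A y t)" for y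
  have Phi: "apply_bcontfun (\<Phi> y) t = exp (- K * \<bar>t\<bar>) *\<^sub>R A y t" for y t
  proof -
    have "(\<lambda>t. exp (- K * \<bar>t\<bar>) *\<^sub>R A y t) \<in> bcontfun"
    proof (rule bcontfun_normI)
      have "continuous_on UNIV (A y)"
        using A' by (meson continuous_at_imp_continuous_on has_vector_derivative_continuous)
      then show "continuous_on UNIV (\<lambda>t. exp (- K * \<bar>t\<bar>) *\<^sub>R A y t)"
        by (intro continuous_intros)
      fix t
      have "norm (g y s) \<le> (B + L * dist y 0) * exp (K * \<bar>s\<bar>)" for s
        using g_dist[of y s 0] g_0[of s] norm_triangle_sub[of "g y s" "g 0 s"]
        by (simp add: algebra_simps)
      then have "norm (A y t) \<le> (B + L * dist y 0) / K * exp (K * \<bar>t\<bar>)"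
        by (rule exp_bound_antiderivative[OF K(1) A0 A'])
      then show "norm (exp (- K * \<bar>t\<bar>) *\<^sub>R A y t) \<le> (B + L * dist y 0) / K"
        by (simp add: exp_minus field_simps)
    qed
    then show ?thesis by (simp add: \<Phi>_def Bcontfun_inverse)
  qed
  have "\<exists>!y. \<Phi> y = y"
  proof (rule banach_fix_type)
    show "0 \<le> (1/2::real)" "(1/2::real) < 1" by auto
    show "\<forall>y z. dist (\<Phi> y) (\<Phi> z) \<le> 1 / 2 * dist y z"
    proof (intro allI dist_bound)
      fix y z t
      have "norm (A y t - A z t) \<le> L * dist y z / K * exp (K * \<bar>t\<bar>)"
        by (rule exp_bound_antiderivative[OF K(1), where g = "\<lambda>t. g y t - g z t"])
          (auto intro!: derivative_eq_intros A' g_dist simp: A0)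
      then have "dist (apply_bcontfun (\<Phi> y) t) (apply_bcontfun (\<Phi> z) t) \<le> L / K * dist y z"
        unfolding Phi dist_norm scaleR_diff_right[symmetric] norm_scaleR
        using K by (simp add: exp_minus divide_simps mult_ac)
      also have "\<dots> \<le> 1 / 2 * dist y z" using K by (intro mult_right_mono) auto
      finally show "dist (apply_bcontfun (\<Phi> y) t) (apply_bcontfun (\<Phi> z) t) \<le> 1 / 2 * dist y z" .
    qed
  qed
  then obtain y where y: "\<Phi> y = y" by blast
  have "exp (K * \<bar>t\<bar>) *\<^sub>R apply_bcontfun y t = A y t" for t
    by (subst y[symmetric]) (simp add: Phi exp_minus)
  then have "g y t = f t (p + A y t)" for t by (simp add: g_def)
  then have "((\<lambda>t. p + A y t) has_vector_derivative f t (p + A y t)) (at t)" for t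
    using A'[of y t] by (auto intro!: derivative_eq_intros)
  then show ?thesis by (intro exI[of _ "\<lambda>t. p + A y t"]) (simp add: A0)
qed

section \<open>Growth estimates and uniqueness of solutions\<close>

lemma has_vector_derivative_norm_power2:
  fixes x :: "real \<Rightarrow> 'a::real_inner"
  assumes "(x has_vector_derivative x') (at t within S)"
  shows "((\<lambda>t. (norm (x t))\<^sup>2) has_vector_derivative 2 * (x t \<bullet> x')) (at t within S)"
proof -
  have "((\<lambda>t. x t \<bullet> x t) has_vector_derivative x t \<bullet> x' + x' \<bullet> x t) (at t within S)"
    by (rule bounded_bilinear.has_vector_derivative[OF bounded_bilinear_inner assms assms])
  then show ?thesis by (simp add: power2_norm_eq_inner inner_commute)
qed

text \<open>The sign of \<open>c\<close> is free: with a Lipschitz constant this is the Gronwall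
  estimate for differences, with a negative \<open>c\<close> it gives decay towards an
  equilibrium.\<close>

lemma norm_growth_within:
  fixes x :: "real \<Rightarrow> 'a::real_inner"
  assumes T: "0 \<le> T"
    and d: "\<And>t. t \<in> {0..T} \<Longrightarrow> (x has_vector_derivative x' t) (at t within {0..T})"
    and le: "\<And>t. t \<in> {0..T} \<Longrightarrow> x t \<bullet> x' t \<le> c * (norm (x t))\<^sup>2"
  shows "norm (x T) \<le> exp (c * T) * norm (x 0)"
proof -
  let ?f = "\<lambda>t. (norm (x t))\<^sup>2 * exp (- 2 * c * t)"
  let ?f' = "\<lambda>t. 2 * (x t \<bullet> x' t - c * (norm (x t))\<^sup>2) * exp (- 2 * c * t)"
  have "?f T \<le> ?f 0"
  proof (rule nonincreasing_within[OF T])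
    fix t assume t: "t \<in> {0..T}"
    have "((\<lambda>t. (norm (x t))\<^sup>2) has_real_derivative 2 * (x t \<bullet> x' t)) (at t within {0..T})"
      using has_vector_derivative_norm_power2[OF d[OF t]]
      by (simp add: has_real_derivative_iff_has_vector_derivative)
    moreover have "((\<lambda>t. exp (- 2 * c * t)) has_real_derivative - 2 * c * exp (- 2 * c * t)) (at t within {0..T})"
      by (auto intro!: derivative_eq_intros)
    ultimately have "(?f has_real_derivative ?f' t) (at t within {0..T})"
      by (rule DERIV_mult[THEN DERIV_cong]) (simp add: algebra_simps)
    then show "(?f has_vector_derivative ?f' t) (at t within {0..T})"
      by (simp add: has_real_derivative_iff_has_vector_derivative)
    show "?f' t \<le> 0" using le[OF t] by (simp add: mult_nonpos_nonneg)
  qed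
  moreover have "exp (- 2 * c * T) = inverse (exp (c * T) ^ 2)"
    using exp_double[of "c * T"] by (simp add: mult.assoc exp_minus)
  ultimately have "(norm (x T))\<^sup>2 * inverse (exp (c * T) ^ 2) \<le> (norm (x 0))\<^sup>2"
    by (simp del: mult_minus_left)
  then have "(norm (x T))\<^sup>2 \<le> (norm (x 0))\<^sup>2 * exp (c * T) ^ 2"
    by (simp add: field_simps)
  then have "(norm (x T))\<^sup>2 \<le> (exp (c * T) * norm (x 0))\<^sup>2" by (simp add: power_mult_distrib mult_ac)
  then show ?thesis by (rule power2_le_imp_le) simp
qed

text \<open>The Lipschitz bound is asked for only on a set \<open>S\<close> that contains both
  solutions, because a field with quadratic terms has no Lipschitz constant on the whole
  plane.\<close>

lemma gronwall:
  fixes x y :: "real \<Rightarrow> 'a::real_inner"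
  assumes T: "0 \<le> T"
    and x: "\<And>t. t \<in> {0..T} \<Longrightarrow> (x has_vector_derivative f t (x t)) (at t within {0..T})"
    and y: "\<And>t. t \<in> {0..T} \<Longrightarrow> (y has_vector_derivative f t (y t)) (at t within {0..T})"
    and lip: "\<And>t. t \<in> {0..T} \<Longrightarrow> L-lipschitz_on S (f t)"
    and S: "\<And>t. t \<in> {0..T} \<Longrightarrow> x t \<in> S \<and> y t \<in> S"
  shows "norm (x T - y T) \<le> exp (L * T) * norm (x 0 - y 0)"
proof (rule norm_growth_within[OF T, where x = "\<lambda>t. x t - y t" and x' = "\<lambda>t. f t (x t) - f t (y t)"])
  fix t assume t: "t \<in> {0..T}"
  show "((\<lambda>t. x t - y t) has_vector_derivative f t (x t) - f t (y t)) (at t within {0..T})"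
    by (intro derivative_intros x y t)
  have "(x t - y t) \<bullet> (f t (x t) - f t (y t)) \<le> norm (x t - y t) * norm (f t (x t) - f t (y t))"
    by (rule norm_cauchy_schwarz)
  also have "\<dots> \<le> norm (x t - y t) * (L * norm (x t - y t))"
    using lipschitz_on_normD[OF lip[OF t]] S[OF t] by (intro mult_left_mono) auto
  finally show "(x t - y t) \<bullet> (f t (x t) - f t (y t)) \<le> L * (norm (x t - y t))\<^sup>2"
    by (simp add: power2_eq_square mult_ac)
qed

lemma has_vector_derivative_shift:
  assumes "(x has_vector_derivative x') (at (t + c))"
  shows "((\<lambda>t. x (t + c)) has_vector_derivative x') (at t)"
proof -
  have "((\<lambda>t. t + c) has_vector_derivative 1) (at t)" by (auto intro!: derivative_eq_intros)
  from vector_diff_chain_at[OF this assms] show ?thesis by (simp add: o_def)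
qed

lemma has_vector_derivative_reverse:
  assumes "(x has_vector_derivative x') (at (c - t) within (\<lambda>t. c - t) ` S)"
  shows "((\<lambda>t. x (c - t)) has_vector_derivative - x') (at t within S)"
proof -
  have "((\<lambda>t. c - t) has_vector_derivative - 1) (at t within S)"
    by (auto intro!: derivative_eq_intros)
  from vector_diff_chain_within[OF this assms] show ?thesis by (simp add: o_def)
qed

text \<open>The forward estimate covers times after \<open>t0\<close> by a shift; for earlier times
  it is applied to the reflected solutions, which solve the equation for \<open>- f\<close>.\<close>

lemma ode_unique:
  fixes x y :: "real \<Rightarrow> 'a::real_inner"
  assumes x: "\<And>t. (x has_vector_derivative f t (x t)) (at t)"
    and y: "\<And>t. (y has_vector_derivative f t (y t)) (at t)"
    and lip: "\<And>t. L-lipschitz_on S (f t)"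
    and S: "\<And>t. x t \<in> S \<and> y t \<in> S" and eq: "x t0 = y t0"
  shows "x = y"
proof
  fix t
  show "x t = y t"
  proof (cases "t \<ge> t0")
    case True
    have "norm (x ((t - t0) + t0) - y ((t - t0) + t0)) \<le> exp (L * (t - t0)) * norm (x (0 + t0) - y (0 + t0))"
    proof (rule gronwall[where x = "\<lambda>t. x (t + t0)" and y = "\<lambda>t. y (t + t0)" and f = "\<lambda>t. f (t + t0)"])
      fix t
      show "((\<lambda>t. x (t + t0)) has_vector_derivative f (t + t0) (x (t + t0))) (at t within {0..t'})"
        "((\<lambda>t. y (t + t0)) has_vector_derivative f (t + t0) (y (t + t0))) (at t within {0..t'})" for t'
        by (rule has_vector_derivative_at_within, rule has_vector_derivative_shift, rule x y)+
    qed (use True S lip in auto)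
    then show ?thesis using eq by simp
  next
    case False
    have "norm (x (t0 - (t0 - t)) - y (t0 - (t0 - t))) \<le> exp (L * (t0 - t)) * norm (x (t0 - 0) - y (t0 - 0))"
    proof (rule gronwall[where x = "\<lambda>t. x (t0 - t)" and y = "\<lambda>t. y (t0 - t)" and f = "\<lambda>t z. - f (t0 - t) z"])
      fix t
      show "((\<lambda>t. x (t0 - t)) has_vector_derivative - f (t0 - t) (x (t0 - t))) (at t within {0..t'})"
        "((\<lambda>t. y (t0 - t)) has_vector_derivative - f (t0 - t) (y (t0 - t))) (at t within {0..t'})" for t'
        by (rule has_vector_derivative_reverse, rule has_vector_derivative_at_within, rule x y)+
    qed (use False S lip in auto)
    then show ?thesis using eq by simp
  qed
qed

section \<open>Invariant sets and stability\<close>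

lemma solves_on_subset: "solves_on F x J \<Longrightarrow> J' \<subseteq> J \<Longrightarrow> solves_on F x J'"
  unfolding solves_on_def by (meson has_vector_derivative_within_subset subsetD)

lemma solves_on_imp_continuous_on: "solves_on F x J \<Longrightarrow> continuous_on J x"
  unfolding solves_on_def
  by (meson continuous_on_eq_continuous_within has_vector_derivative_continuous)

lemma solves_on_reverse:
  assumes "solves_on F x {0..T}"
  shows "solves_on (\<lambda>p. - F p) (\<lambda>t. x (T - t)) {0..T}"
  unfolding solves_on_def
proof
  fix t assume t: "t \<in> {0..T}"
  have im: "(\<lambda>t. T - t) ` {0..T} = {0..T}" by simp
  show "((\<lambda>t. x (T - t)) has_vector_derivative - F (x (T - t))) (at t within {0..T})"
    by (rule has_vector_derivative_reverse, unfold im)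
      (use assms t in \<open>auto simp: solves_on_def\<close>)
qed

lemma periodic_orbit_reverse:
  assumes "periodic_orbit F \<Gamma>"
  shows "periodic_orbit (\<lambda>p. - F p) \<Gamma>"
proof -
  obtain x T where x: "solves_on F x UNIV" "T > 0" "\<And>t. x (t + T) = x t" "\<exists>t. x t \<noteq> x 0"
    and \<Gamma>: "\<Gamma> = range x"
    using assms unfolding periodic_orbit_def by blast
  have "range (\<lambda>t. x (- t)) = x ` range uminus" by (metis image_image)
  then have "\<Gamma> = range (\<lambda>t. x (- t))" by (simp add: \<Gamma>)
  moreover have "solves_on (\<lambda>p. - F p) (\<lambda>t. x (- t)) UNIV"
    using x(1) has_vector_derivative_reverse[where c = 0 and S = UNIV and x = x]
    by (simp add: solves_on_def)
  moreover have "x (- (t + T)) = x (- t)" for t using x(3)[of "- (t + T)"] by simp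
  moreover obtain t0 where "x t0 \<noteq> x 0" using x(4) by blast
  then have "x (- (- t0)) \<noteq> x (- 0)" by simp
  ultimately show ?thesis unfolding periodic_orbit_def using x(2) by blast
qed

text \<open>A bootstrap: having stayed in \<open>V\<close> forces the present position into the
  smaller closed set \<open>K\<close>. At a first exit from \<open>V\<close> the position would be a
  limit of points of \<open>K\<close>, hence in \<open>K\<close> and thus still in
  \<open>V\<close>.\<close>

lemma trapped_of_continuation:
  fixes x :: "real \<Rightarrow> 'a::t2_space"
  assumes "0 \<le> T" "open V" "closed K" "K \<subseteq> V" "continuous_on {0..T} x" "x 0 \<in> K"
    and step: "\<And>t. t \<in> {0..T} \<Longrightarrow> x ` {0..t} \<subseteq> V \<Longrightarrow> x t \<in> K"
  shows "x ` {0..T} \<subseteq> K"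
proof -
  \<comment> \<open>The times spent outside \<open>V\<close>. This set is compact because
    \<open>V\<close> is open, so a first such time exists if there is any.\<close>
  define C where "C = {0..T} \<inter> x -` (- V)"
  have "closed C" unfolding C_def
    by (rule continuous_closed_preimage) (use assms in auto)
  then have "compact C" unfolding C_def by (metis compact_Icc compact_Int_closed inf.idem inf_assoc)
  have "C = {}"
  proof (rule ccontr)
    assume "C \<noteq> {}"
    with \<open>compact C\<close> obtain s where s: "s \<in> C" "\<And>t. t \<in> C \<Longrightarrow> s \<le> t"
      by (meson compact_attains_inf)
    then have sT: "0 < s" "s \<le> T" using assms(4,6) by (auto simp: C_def less_le)
    have K: "x t \<in> K" if "0 \<le> t" "t < s" for t
    proof (rule step)
      have "u \<notin> C" if "u < s" for u using s(2)[of u] that by force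
      then show "x ` {0..t} \<subseteq> V" using that sT by (force simp: C_def)
    qed (use that sT in auto)
    let ?P = "{0..T} \<inter> x -` K"
    have "closed ?P" by (rule continuous_closed_preimage) (use assms in auto)
    moreover have "{0..<s} \<subseteq> ?P" using K sT by auto
    ultimately have "closure {0..<s} \<subseteq> ?P" by (rule closure_minimal[rotated])
    moreover have "s \<in> closure {0..<s}" using sT by simp
    ultimately have "x s \<in> K" by blast
    then show False using s(1) assms(4) by (auto simp: C_def)
  qed
  then have "x ` {0..T} \<subseteq> V" by (auto simp: C_def)
  then show ?thesis by (auto intro!: step)
qed

text \<open>The projection onto the disc is 1-Lipschitz, so the composed field is Lipschitz on the
  whole plane and agrees with \<open>F\<close> inside the disc.\<close>

lemma ivp_global_clamped:
  fixes F :: "plane \<Rightarrow> plane"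
  assumes lip: "L-lipschitz_on (cball 0 R) F" and R: "0 \<le> R"
  shows "\<exists>x. x 0 = p \<and> (\<forall>t. (x has_vector_derivative F (closest_point (cball 0 R) (x t))) (at t))"
proof -
  let ?c = "closest_point (cball 0 R :: plane set)"
  have ne: "cball 0 R \<noteq> ({} :: plane set)" using R by auto
  have mem: "?c y \<in> cball 0 R" for y
    by (rule closest_point_in_set[OF closed_cball ne])
  have "L-lipschitz_on UNIV (\<lambda>y. F (?c y))"
  proof (rule lipschitz_onI)
    show "0 \<le> L" using lip by (rule lipschitz_on_nonneg)
    fix y z :: plane
    have "dist (F (?c y)) (F (?c z)) \<le> L * dist (?c y) (?c z)"
      using lipschitz_onD[OF lip mem mem] .
    also have "\<dots> \<le> L * dist y z"
      using \<open>0 \<le> L\<close> closest_point_lipschitz[OF convex_cball closed_cball ne]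
      by (intro mult_left_mono) auto
    finally show "dist (F (?c y)) (F (?c z)) \<le> L * dist y z" .
  qed
  moreover from this have "continuous_on UNIV (\<lambda>y. F (?c y))" by (rule lipschitz_on_continuous_on)
  then have "continuous_on UNIV (\<lambda>(t::real, y). F (?c y))"
    by (auto simp: split_beta intro!: continuous_on_compose2[of UNIV "\<lambda>y. F (?c y)" UNIV snd] continuous_intros)
  ultimately show ?thesis
    by (intro ivp_global[where f = "\<lambda>_ y. F (?c y)" and L = L and B = "norm (F (?c p))"]) auto
qed

text \<open>A solution of the clamped field solves the original equation as long as it is in the
  disc, and \<open>trap\<close> shows that it never leaves.\<close>

lemma trapped_solution_exists:
  fixes F :: "plane \<Rightarrow> plane"
  assumes lip: "L-lipschitz_on (cball 0 R) F"
    and V: "open V" "V \<subseteq> cball 0 R" and K: "closed K" "K \<subseteq> V" "p \<in> K"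
    and trap: "\<And>x T. 0 \<le> T \<Longrightarrow> solves_on F x {0..T} \<Longrightarrow> x ` {0..T} \<subseteq> V \<Longrightarrow> x 0 = p \<Longrightarrow> x T \<in> K"
  shows "\<exists>x. solves_on F x {0..} \<and> x 0 = p"
proof -
  have "p \<in> cball 0 R" using V K by auto
  then have R: "0 \<le> R" using norm_ge_zero[of p] by (simp del: norm_ge_zero)
  obtain x where x0: "x 0 = p"
    and x: "\<And>t. (x has_vector_derivative F (closest_point (cball 0 R) (x t))) (at t)"
    using ivp_global_clamped[OF lip R] by blast
  have sol: "solves_on F x {0..t}" if "x ` {0..t} \<subseteq> cball 0 R" for t
    unfolding solves_on_def
  proof
    fix s assume "s \<in> {0..t}"
    then have "x s \<in> cball 0 R" using that by blast
    then show "(x has_vector_derivative F (x s)) (at s within {0..t})"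
      using x[of s] by (simp add: closest_point_self has_vector_derivative_at_within)
  qed
  have cont: "continuous_on A x" for A
    using x by (meson continuous_at_imp_continuous_on has_vector_derivative_continuous)
  have trapped: "x ` {0..T} \<subseteq> K" if "0 \<le> T" for T
  proof (rule trapped_of_continuation[OF that V(1) K(1,2) cont])
    fix t assume "t \<in> {0..T}" "x ` {0..t} \<subseteq> V"
    then show "x t \<in> K" using sol[of t] V(2) x0 by (intro trap) auto
  qed (use x0 K in simp)
  have "solves_on F x {0..}"
    unfolding solves_on_def
  proof
    fix t :: real assume "t \<in> {0..}"
    then have "x t \<in> cball 0 R" using trapped[of t] V K by force
    then show "(x has_vector_derivative F (x t)) (at t within {0..})"
      using x[of t] by (simp add: closest_point_self has_vector_derivative_at_within)
  qed
  with x0 show ?thesis by blast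
qed

text \<open>\<open>N\<close> acts as an exponentially decaying Lyapunov function.
  \<open>decay\<close> may assume that the solution stays in \<open>V\<close>, since its conclusion
  \<open>x T \<in> K\<close> closes the bootstrap; \<open>near\<close> and \<open>small\<close>
  translate between \<open>N\<close> and the distance to \<open>\<Gamma>\<close>. The equilibrium is
  treated with \<open>N = norm\<close> and the periodic orbit with \<open>N = gauge\<close>.\<close>

lemma asymptotically_stableI:
  fixes F :: "plane \<Rightarrow> plane" and N :: "plane \<Rightarrow> real"
  assumes lip: "L-lipschitz_on (cball 0 R) F"
    and V: "open V" "V \<subseteq> cball 0 R" and K: "closed K" "K \<subseteq> V"
    and pos: "0 < \<gamma>" "0 < \<eta>" "0 \<le> C" "\<And>x. 0 \<le> N x"
    and decay: "\<And>x T. 0 \<le> T \<Longrightarrow> solves_on F x {0..T} \<Longrightarrow> x ` {0..T} \<subseteq> V \<Longrightarrow> x 0 \<in> K \<Longrightarrow>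
      N (x 0) \<le> \<eta> \<Longrightarrow> x T \<in> K \<and> N (x T) \<le> exp (- \<gamma> * T) * N (x 0)"
    and near: "\<And>x. x \<in> K \<Longrightarrow> N x \<le> \<eta> \<Longrightarrow> infdist x \<Gamma> \<le> C * N x"
    and small: "\<And>e. 0 < e \<Longrightarrow> \<exists>d>0. \<forall>x. infdist x \<Gamma> < d \<longrightarrow> x \<in> K \<and> N x \<le> e"
  shows "asymptotically_stable F \<Gamma>"
proof -
  have est: "infdist (x T) \<Gamma> \<le> C * (exp (- \<gamma> * T) * N (x 0))"
    if T: "0 \<le> T" and x: "solves_on F x {0..T}" "x 0 \<in> K" "N (x 0) \<le> \<eta>" for x T
  proof -
    have "x ` {0..T} \<subseteq> K"
    proof (rule trapped_of_continuation[where x = x, OF T V(1) K _ x(2)])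
      show "continuous_on {0..T} x" using x(1) by (rule solves_on_imp_continuous_on)
      fix t assume t: "t \<in> {0..T}" "x ` {0..t} \<subseteq> V"
      then have "solves_on F x {0..t}" by (intro solves_on_subset[OF x(1)]) auto
      with decay[of t x] t x show "x t \<in> K" by auto
    qed
    with decay[OF T x(1) _ x(2,3)] K have D: "x T \<in> K" "N (x T) \<le> exp (- \<gamma> * T) * N (x 0)"
      by blast+
    have "exp (- \<gamma> * T) * N (x 0) \<le> 1 * N (x 0)"
      using pos T by (intro mult_right_mono) auto
    then have "infdist (x T) \<Gamma> \<le> C * N (x T)" using D x by (intro near) auto
    also have "\<dots> \<le> C * (exp (- \<gamma> * T) * N (x 0))" using D pos by (intro mult_left_mono) auto
    finally show ?thesis .
  qed
  have "stable F \<Gamma>" unfolding stable_def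
  proof (intro allI impI)
    fix \<epsilon> :: real assume \<epsilon>: "0 < \<epsilon>"
    \<comment> \<open>Adding 1 allows division also when \<open>C = 0\<close>.\<close>
    define c where "c = C + 1"
    have c: "0 < c" "C \<le> c" using pos by (auto simp: c_def)
    define e where "e = min \<eta> (\<epsilon> / c / 2)"
    have e: "0 < e" "e \<le> \<eta>" "C * e < \<epsilon>"
    proof -
      show "0 < e" using \<epsilon> pos c by (simp add: e_def)
      have "C * e \<le> c * (\<epsilon> / c / 2)"
        using \<epsilon> pos c by (intro mult_mono) (auto simp: e_def)
      also have "\<dots> < \<epsilon>" using \<epsilon> c by simp
      finally show "C * e < \<epsilon>" .
    qed (simp add: e_def)
    obtain d where d: "d > 0" "\<And>x. infdist x \<Gamma> < d \<Longrightarrow> x \<in> K \<and> N x \<le> e"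
      using small[OF e(1)] by blast
    have "infdist (x t) \<Gamma> < \<epsilon>"
      if x: "solves_on F x {0..T}" "infdist (x 0) \<Gamma> < d" and t: "t \<in> {0..T}" for x T t
    proof -
      have x0: "x 0 \<in> K" "N (x 0) \<le> e" using d(2)[OF x(2)] by auto
      have "infdist (x t) \<Gamma> \<le> C * (exp (- \<gamma> * t) * N (x 0))"
        using t x0 e by (intro est solves_on_subset[OF x(1)]) auto
      also have "exp (- \<gamma> * t) * N (x 0) \<le> 1 * e"
        using pos t x0 by (intro mult_mono) auto
      finally show ?thesis using e(3) pos by (simp add: mult_left_mono)
    qed
    then show "\<exists>\<delta>>0. \<forall>x T. 0 \<le> T \<longrightarrow> solves_on F x {0..T} \<longrightarrow> infdist (x 0) \<Gamma> < \<delta> \<longrightarrow>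
        (\<forall>t\<in>{0..T}. infdist (x t) \<Gamma> < \<epsilon>)"
      using d(1) by blast
  qed
  moreover obtain d where d: "d > 0" "\<And>x. infdist x \<Gamma> < d \<Longrightarrow> x \<in> K \<and> N x \<le> \<eta>"
    using small[OF pos(2)] by blast
  have "\<exists>x. solves_on F x {0..} \<and> x 0 = p" if "infdist p \<Gamma> < d" for p
    by (rule trapped_solution_exists[OF lip V K]) (use d(2)[OF that] decay in auto)
  moreover have "((\<lambda>t. infdist (x t) \<Gamma>) \<longlongrightarrow> 0) at_top"
    if p: "infdist (x 0) \<Gamma> < d" and x: "solves_on F x {0..}" for x
  proof (rule tendsto_sandwich)
    show "\<forall>\<^sub>F t in at_top. 0 \<le> infdist (x t) \<Gamma>" by (simp add: infdist_nonneg)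
    show "\<forall>\<^sub>F t in at_top. infdist (x t) \<Gamma> \<le> C * (exp (- \<gamma> * t) * N (x 0))"
      using eventually_ge_at_top[of 0]
    proof eventually_elim
      case (elim t)
      then show ?case using d(2)[OF p] by (intro est solves_on_subset[OF x]) auto
    qed
    have "filterlim (\<lambda>t. \<gamma> * t) at_top at_top"
      using pos by (intro filterlim_tendsto_pos_mult_at_top[OF tendsto_const]) (auto intro: filterlim_ident)
    then have "((\<lambda>t. exp (- \<gamma> * t)) \<longlongrightarrow> 0) at_top"
      by (intro filterlim_compose[OF exp_at_bot]) (simp add: filterlim_uminus_at_bot)
    then show "((\<lambda>t. C * (exp (- \<gamma> * t) * N (x 0))) \<longlongrightarrow> 0) at_top"
      by (intro tendsto_mult_right_zero tendsto_mult_left_zero)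
  qed auto
  ultimately show ?thesis unfolding asymptotically_stable_def using d(1) by blast
qed

section \<open>Instability by time reversal\<close>

lemma infdist_attains:
  fixes \<Gamma> :: "plane set"
  assumes "compact \<Gamma>" "\<Gamma> \<noteq> {}" "0 \<le> e"
  shows "\<exists>p. infdist p \<Gamma> = e"
proof -
  obtain q where q: "q \<in> \<Gamma>" using assms by blast
  obtain B where B: "\<And>x. x \<in> \<Gamma> \<Longrightarrow> norm x \<le> B"
    using assms(1) compact_imp_bounded bounded_iff by metis
  have "0 \<le> B" using B[OF q] norm_ge_zero order_trans by blast
  let ?p = "(B + e, 0) :: plane"
  have "e \<le> infdist ?p \<Gamma>"
    unfolding infdist_def using assms(2)
  proof (simp, intro cINF_greatest)
    fix y assume "y \<in> \<Gamma>"
    have "norm ?p \<le> dist ?p y + norm y" by (metis dist_norm norm_triangle_sub add.commute)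
    then show "e \<le> dist ?p y" using B[OF \<open>y \<in> \<Gamma>\<close>] \<open>0 \<le> B\<close> \<open>0 \<le> e\<close> by (simp add: norm_Pair)
  qed
  moreover have "infdist q \<Gamma> \<le> e" using q assms by simp
  moreover have "connected (range (\<lambda>p. infdist p \<Gamma>))"
    by (intro connected_continuous_image continuous_on_infdist continuous_intros connected_UNIV)
  ultimately have "e \<in> range (\<lambda>p. infdist p \<Gamma>)"
    by (meson connected_contains_Icc atLeastAtMost_iff rangeI subsetD)
  then show ?thesis by blast
qed

text \<open>The reversed flow carries a point at a fixed distance arbitrarily close to
  \<open>\<Gamma>\<close>. Run backwards, this is a solution of \<open>F\<close> that starts
  arbitrarily close and reaches the fixed distance.\<close>

lemma unstable_of_asymptotically_stable_reverse:
  assumes as: "asymptotically_stable (\<lambda>p. - F p) \<Gamma>" and \<Gamma>: "compact \<Gamma>" "\<Gamma> \<noteq> {}"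
  shows "unstable F \<Gamma>"
proof
  assume st: "stable F \<Gamma>"
  obtain d where d: "d > 0" "\<And>p. infdist p \<Gamma> < d \<Longrightarrow> \<exists>x. solves_on (\<lambda>p. - F p) x {0..} \<and> x 0 = p"
    "\<And>x. infdist (x 0) \<Gamma> < d \<Longrightarrow> solves_on (\<lambda>p. - F p) x {0..} \<Longrightarrow> ((\<lambda>t. infdist (x t) \<Gamma>) \<longlongrightarrow> 0) at_top"
    using as unfolding asymptotically_stable_def by blast
  \<comment> \<open>The distance is exactly \<open>d / 2\<close>: within the basin of radius
    \<open>d\<close>, and incompatible with the strict bound \<open>d / 2\<close> that stability
    would give.\<close>
  obtain p where p: "infdist p \<Gamma> = d / 2" using infdist_attains[OF \<Gamma>, of "d / 2"] d(1) by auto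
  then have pd: "infdist p \<Gamma> < d" using d(1) by linarith
  from d(2)[OF this] obtain x where x: "solves_on (\<lambda>p. - F p) x {0..}" "x 0 = p" by blast
  have "0 < d / 2" using d(1) by simp
  from st[unfolded stable_def, THEN spec, THEN mp, OF this]
  obtain \<delta> where \<delta>: "\<delta> > 0" "\<forall>x. \<forall>T\<ge>0. solves_on F x {0..T} \<longrightarrow> infdist (x 0) \<Gamma> < \<delta> \<longrightarrow>
      (\<forall>t\<in>{0..T}. infdist (x t) \<Gamma> < d / 2)"
    by (elim exE conjE)
  have "((\<lambda>t. infdist (x t) \<Gamma>) \<longlongrightarrow> 0) at_top" using d(3)[of x] x pd by simp
  then have "\<forall>\<^sub>F t in at_top. infdist (x t) \<Gamma> < \<delta> \<and> 0 \<le> t"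
    using \<delta>(1) by (intro eventually_conj order_tendstoD eventually_ge_at_top)
  then obtain T where T: "infdist (x T) \<Gamma> < \<delta>" "0 \<le> T"
    using eventually_happens trivial_limit_at_top_linorder by blast
  have "solves_on (\<lambda>p. - F p) x {0..T}" by (rule solves_on_subset[OF x(1)]) auto
  from solves_on_reverse[OF this] have "solves_on F (\<lambda>t. x (T - t)) {0..T}" by simp
  then have "infdist (x (T - T)) \<Gamma> < d / 2"
    using \<delta>(2)[THEN spec[of _ "\<lambda>t. x (T - t)"], THEN spec[of _ T], THEN mp, THEN mp, THEN mp, THEN bspec[of _ _ T]] T
    by simp
  then show False using p x by simp
qed

section \<open>Polar coordinates\<close>

definition polar :: "real \<Rightarrow> real \<Rightarrow> plane" where
  "polar r \<phi> = (r * cos \<phi>, r * sin \<phi>)"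

lemma norm_polar [simp]: "norm (polar r \<phi>) = \<bar>r\<bar>"
proof -
  have "(norm (polar r \<phi>))\<^sup>2 = \<bar>r\<bar>\<^sup>2"
    by (simp add: polar_def norm_Pair power_mult_distrib flip: distrib_left)
  then show ?thesis by (metis abs_ge_zero norm_ge_zero power2_eq_iff_nonneg)
qed

lemma polar_exists:
  obtains \<theta> where "0 \<le> \<theta>" "\<theta> < 2 * pi" "x = polar (norm x) \<theta>"
proof (cases "x = 0")
  case True
  then show ?thesis using that[of 0] by (simp add: polar_def zero_prod_def)
next
  case False
  define n where "n = norm x"
  have n: "n > 0" using False by (simp add: n_def)
  moreover have "n\<^sup>2 = (fst x)\<^sup>2 + (snd x)\<^sup>2" by (simp add: n_def norm_prod_def)
  ultimately have "(fst x / n)\<^sup>2 + (snd x / n)\<^sup>2 = n\<^sup>2 / n\<^sup>2"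
    by (simp only: power_divide add_divide_distrib)
  with n have "(fst x / n)\<^sup>2 + (snd x / n)\<^sup>2 = 1" by simp
  then obtain t where "0 \<le> t" "t < 2 * pi" "fst x / n = cos t" "snd x / n = sin t"
    using sincos_total_2pi by blast
  with n show ?thesis
    by (intro that[of t]) (auto simp: polar_def prod_eq_iff field_simps simp flip: n_def)
qed

text \<open>A positive \<open>r\<close> excludes the origin, where the angle is arbitrary, and a
  nonnegative \<open>s\<close> excludes the representation by the opposite angle and a negative
  radius.\<close>

lemma polar_eqD:
  assumes "polar r \<theta> = polar s \<phi>" "0 < r" "0 \<le> s"
  shows "r = s" "cos \<theta> = cos \<phi>" "sin \<theta> = sin \<phi>"
proof -
  have "\<bar>r\<bar> = \<bar>s\<bar>" by (metis assms(1) norm_polar)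
  with assms(2,3) show "r = s" by simp
  with assms show "cos \<theta> = cos \<phi>" "sin \<theta> = sin \<phi>" by (auto simp: polar_def)
qed

lemma periodic_add_int:
  fixes f :: "real \<Rightarrow> 'a"
  assumes "\<And>x. f (x + c) = f x"
  shows "f (x + of_int n * c) = f x"
proof (induction n rule: int_induct[where k = 0])
  case (step1 i)
  then show ?case using assms[of "x + of_int i * c"] by (simp add: algebra_simps)
next
  case (step2 i)
  then show ?case using assms[of "x + of_int (i - 1) * c"] by (simp add: algebra_simps)
qed simp

lemma periodic_cong_angle:
  fixes f :: "real \<Rightarrow> 'a"
  assumes "\<And>x. f (x + 2 * pi) = f x" "cos \<theta> = cos \<phi>" "sin \<theta> = sin \<phi>"
  shows "f \<theta> = f \<phi>"
proof -
  obtain n :: int where "\<theta> = \<phi> + 2 * pi * n" using sin_cos_eq_iff assms(2,3) by metis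
  then show ?thesis using periodic_add_int[of f, OF assms(1), of \<phi> n] by (simp add: mult_ac)
qed

lemma periodic_bounded:
  fixes f :: "real \<Rightarrow> real"
  assumes "continuous_on UNIV f" "\<And>x. f (x + 2 * pi) = f x"
  shows "\<exists>B. \<forall>x. \<bar>f x\<bar> \<le> B"
proof -
  have "compact (f ` {0..2 * pi})"
    by (rule compact_continuous_image) (auto intro: continuous_on_subset[OF assms(1)])
  then obtain B where B: "\<And>x. x \<in> {0..2 * pi} \<Longrightarrow> \<bar>f x\<bar> \<le> B"
    by (metis bounded_iff compact_imp_bounded image_eqI real_norm_def)
  have "\<bar>f x\<bar> \<le> B" for x
  proof -
    obtain t where t: "0 \<le> t" "t < 2 * pi" "cos x = cos t" "sin x = sin t"
      using sincos_total_2pi[of "cos x" "sin x"] by auto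
    then have "f x = f t" using periodic_cong_angle[of f, OF assms(2)] by blast
    then show ?thesis using B[of t] t by simp
  qed
  then show ?thesis by blast
qed

text \<open>The angle is the integral of \<open>(v w' - w v') / (v\<^sup>2 + w\<^sup>2)\<close>; in the frame rotated by it
  the position divided by its norm has derivative \<open>0\<close>.\<close>

lemma polar_lift:
  fixes x x' :: "real \<Rightarrow> plane"
  assumes T: "0 \<le> T"
    and x: "\<And>t. t \<in> {0..T} \<Longrightarrow> (x has_vector_derivative x' t) (at t within {0..T})"
    and cont: "continuous_on {0..T} x'" and nz: "\<And>t. t \<in> {0..T} \<Longrightarrow> x t \<noteq> 0"
    and x0: "x 0 = polar (norm (x 0)) \<theta>0"
  shows "\<exists>\<theta>. \<theta> 0 = \<theta>0 \<and> (\<forall>t\<in>{0..T}. x t = polar (norm (x t)) (\<theta> t) \<and>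
    (\<theta> has_vector_derivative (fst (x t) * snd (x' t) - snd (x t) * fst (x' t)) / (norm (x t))\<^sup>2) (at t within {0..T}) \<and>
    ((\<lambda>t. norm (x t)) has_vector_derivative (x t \<bullet> x' t) / norm (x t)) (at t within {0..T}))"
proof -
  define v w v' w' n where "v t = fst (x t)" and "w t = snd (x t)" and "v' t = fst (x' t)"
    and "w' t = snd (x' t)" and "n t = norm (x t)" for t
  note defs = v_def w_def v'_def w'_def n_def
  have v: "(v has_real_derivative v' t) (at t within {0..T})"
    and w: "(w has_real_derivative w' t) (at t within {0..T})" if "t \<in> {0..T}" for t
    unfolding has_real_derivative_iff_has_vector_derivative defs
    using bounded_linear.has_vector_derivative[OF bounded_linear_fst x[OF that]]
      bounded_linear.has_vector_derivative[OF bounded_linear_snd x[OF that]] by auto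
  have n_eq: "n t = sqrt ((v t)\<^sup>2 + (w t)\<^sup>2)" for t by (simp add: defs norm_prod_def)
  have n_pos: "n t > 0" if "t \<in> {0..T}" for t using nz[OF that] by (simp add: defs)
  have n2: "(n t)\<^sup>2 = (v t)\<^sup>2 + (w t)\<^sup>2" for t by (simp add: n_eq)
  have n: "(n has_real_derivative (v t * v' t + w t * w' t) / n t) (at t within {0..T})"
    if t: "t \<in> {0..T}" for t
  proof -
    have "((\<lambda>t. sqrt ((v t)\<^sup>2 + (w t)\<^sup>2)) has_real_derivative
        inverse (sqrt ((v t)\<^sup>2 + (w t)\<^sup>2)) / 2 * (2 * (v t * v' t + w t * w' t))) (at t within {0..T})"
      using n_pos[OF t] unfolding n_eq
      by (intro DERIV_chain2[of sqrt] DERIV_real_sqrt) (auto intro!: derivative_eq_intros v w t)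
    moreover have "n = (\<lambda>t. sqrt ((v t)\<^sup>2 + (w t)\<^sup>2))" by (rule ext) (rule n_eq)
    moreover have "inverse a / 2 * (2 * X) = X / a" for a X :: real by (cases "a = 0") (simp_all add: field_simps)
    ultimately show ?thesis by metis
  qed
  have "continuous_on {0..T} x"
    using x by (meson continuous_on_eq_continuous_within has_vector_derivative_continuous)
  then have "continuous_on {0..T} (\<lambda>t. (v t * w' t - w t * v' t) / (n t)\<^sup>2)"
    unfolding defs using cont nz by (intro continuous_intros) auto
  from antiderivative_continuous[OF this] obtain \<theta>1 where \<theta>1: "\<And>t. t \<in> {0..T} \<Longrightarrow>
      (\<theta>1 has_vector_derivative (v t * w' t - w t * v' t) / (n t)\<^sup>2) (at t within {0..T})"
    by blast
  define \<theta> where "\<theta> t = \<theta>1 t - \<theta>1 0 + \<theta>0" for t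
  have \<theta>: "(\<theta> has_real_derivative (v t * w' t - w t * v' t) / (n t)\<^sup>2) (at t within {0..T})"
    if "t \<in> {0..T}" for t
    unfolding has_real_derivative_iff_has_vector_derivative \<theta>_def
    using \<theta>1[OF that] by (auto intro!: derivative_eq_intros)
  \<comment> \<open>The coordinates of the unit vector \<open>x t / n t\<close> in the rotated
    frame. They start at (1, 0), and having derivative 0 they stay there, which is the polar
    representation with angle \<open>\<theta>\<close>.\<close>
  define \<alpha> \<beta> where "\<alpha> t = (v t * cos (\<theta> t) + w t * sin (\<theta> t)) / n t"
    and "\<beta> t = (w t * cos (\<theta> t) - v t * sin (\<theta> t)) / n t" for t
  have zero: "(\<alpha> has_derivative (\<lambda>h. 0)) (at t within {0..T})" "(\<beta> has_derivative (\<lambda>h. 0)) (at t within {0..T})"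
    if t: "t \<in> {0..T}" for t
  proof -
    note D = v[OF t] w[OF t] \<theta>[OF t] n[OF t]
    have nt: "n t \<noteq> 0" using n_pos[OF t] by simp
    define c s q where "c = cos (\<theta> t)" and "s = sin (\<theta> t)" and "q = (v t * w' t - w t * v' t) / (n t)\<^sup>2"
    have \<theta>q: "(\<theta> has_real_derivative q) (at t within {0..T})" using D(3) by (simp add: q_def)
    have q: "q * (n t)\<^sup>2 = v t * w' t - w t * v' t" using nt by (simp add: q_def)
    have "(\<alpha> has_real_derivative ((v' t * c - v t * (s * q) + (w' t * s + w t * (c * q))) * n t -
        (v t * c + w t * s) * ((v t * v' t + w t * w' t) / n t)) / (n t * n t)) (at t within {0..T})"
      unfolding \<alpha>_def[abs_def] c_def s_def
      by (rule DERIV_divide[OF DERIV_add[OF DERIV_mult[OF D(1) DERIV_chain2[OF DERIV_cos \<theta>q]]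
            DERIV_mult[OF D(2) DERIV_chain2[OF DERIV_sin \<theta>q]]] D(4) nt, THEN DERIV_cong])
        (simp add: algebra_simps)
    moreover have "((v' t * c - v t * (s * q) + (w' t * s + w t * (c * q))) * n t -
        (v t * c + w t * s) * ((v t * v' t + w t * w' t) / n t)) = 
        ((v' t * c + w' t * s) * (n t)\<^sup>2 + (w t * c - v t * s) * (q * (n t)\<^sup>2) -
        (v t * c + w t * s) * (v t * v' t + w t * w' t)) / n t"
      using nt by (simp add: field_simps power2_eq_square)
    also have "\<dots> = 0" unfolding q unfolding n2 by (simp add: algebra_simps power2_eq_square)
    ultimately show "(\<alpha> has_derivative (\<lambda>h. 0)) (at t within {0..T})"
      by (simp add: has_field_derivative_def lambda_zero)
    have "(\<beta> has_real_derivative ((w' t * c - w t * (s * q) - (v' t * s + v t * (c * q))) * n t -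
        (w t * c - v t * s) * ((v t * v' t + w t * w' t) / n t)) / (n t * n t)) (at t within {0..T})"
      unfolding \<beta>_def[abs_def] c_def s_def
      by (rule DERIV_divide[OF DERIV_diff[OF DERIV_mult[OF D(2) DERIV_chain2[OF DERIV_cos \<theta>q]]
            DERIV_mult[OF D(1) DERIV_chain2[OF DERIV_sin \<theta>q]]] D(4) nt, THEN DERIV_cong])
        (simp add: algebra_simps)
    moreover have "((w' t * c - w t * (s * q) - (v' t * s + v t * (c * q))) * n t -
        (w t * c - v t * s) * ((v t * v' t + w t * w' t) / n t)) = 
        ((w' t * c - v' t * s) * (n t)\<^sup>2 - (w t * s + v t * c) * (q * (n t)\<^sup>2) -
        (w t * c - v t * s) * (v t * v' t + w t * w' t)) / n t"
      using nt by (simp add: field_simps power2_eq_square)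
    also have "\<dots> = 0" unfolding q unfolding n2 by (simp add: algebra_simps power2_eq_square)
    ultimately show "(\<beta> has_derivative (\<lambda>h. 0)) (at t within {0..T})"
      by (simp add: has_field_derivative_def lambda_zero)
  qed
  have x0': "v 0 = n 0 * cos \<theta>0" "w 0 = n 0 * sin \<theta>0"
    using x0 by (auto simp: defs polar_def prod_eq_iff)
  have \<theta>_0: "\<theta> 0 = \<theta>0" by (simp add: \<theta>_def)
  have n0: "n 0 > 0" using n_pos T by auto
  have "n 0 * cos \<theta>0 * cos \<theta>0 + n 0 * sin \<theta>0 * sin \<theta>0 = n 0"
    using sin_cos_squared_add3[of \<theta>0] by algebra
  then have "\<alpha> 0 = 1" "\<beta> 0 = 0"
    using n0 by (simp_all add: \<alpha>_def \<beta>_def \<theta>_0 x0')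
  then have const: "\<alpha> t = 1" "\<beta> t = 0" if "t \<in> {0..T}" for t
    using has_derivative_zero_unique[OF convex_real_interval(5), of 0 T] zero that T
    by (metis atLeastAtMost_iff order_refl)+
  have "x t = polar (n t) (\<theta> t)" if t: "t \<in> {0..T}" for t
  proof -
    define c s where "c = cos (\<theta> t)" and "s = sin (\<theta> t)"
    have e: "v t * c + w t * s = n t" "w t * c - v t * s = 0"
      using const[OF t] n_pos[OF t] by (auto simp: \<alpha>_def \<beta>_def c_def s_def)
    have one: "s * s + c * c = 1"
      using sin_cos_squared_add3[of "\<theta> t"] by (simp only: add.commute c_def s_def)
    have "v t * (s * s + c * c) = n t * c - 0 * s" "w t * (s * s + c * c) = n t * s + 0 * c"
      unfolding e[symmetric] by (simp_all add: algebra_simps)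
    then have "v t = n t * cos (\<theta> t)" "w t = n t * sin (\<theta> t)"
      unfolding one by (simp_all add: c_def s_def)
    then show ?thesis by (simp add: polar_def prod_eq_iff defs)
  qed
  moreover have "x t \<bullet> x' t = v t * v' t + w t * w' t" for t
    by (simp add: inner_prod_def defs)
  ultimately show ?thesis
    using \<theta>_0 \<theta> n unfolding has_real_derivative_iff_has_vector_derivative
    by (intro exI[of _ \<theta>]) (simp add: defs[abs_def])
qed

section \<open>The periodic amplitude function\<close>

text \<open>The difference of two values of a Moebius transformation is its determinant times
  \<open>x - y\<close> over the product of the two denominators.\<close>

lemma moebius_lipschitz:
  fixes a b c e x y d :: real
  assumes d: "0 < d" "d \<le> \<bar>c * x + e\<bar>" "d \<le> \<bar>c * y + e\<bar>"
  shows "\<bar>(a * x + b) / (c * x + e) - (a * y + b) / (c * y + e)\<bar> \<le> (\<bar>a\<bar> * \<bar>e\<bar> + \<bar>b\<bar> * \<bar>c\<bar>) / d\<^sup>2 * \<bar>x - y\<bar>"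
proof -
  have nz: "c * x + e \<noteq> 0" "c * y + e \<noteq> 0" using d by auto
  have "(a * x + b) / (c * x + e) - (a * y + b) / (c * y + e) =
      (a * e - b * c) * (x - y) / ((c * x + e) * (c * y + e))"
    using nz by (simp add: divide_simps) (simp add: algebra_simps)
  also have "\<bar>\<dots>\<bar> = \<bar>a * e - b * c\<bar> * \<bar>x - y\<bar> / (\<bar>c * x + e\<bar> * \<bar>c * y + e\<bar>)"
    by (simp add: abs_mult)
  also have "\<dots> \<le> (\<bar>a\<bar> * \<bar>e\<bar> + \<bar>b\<bar> * \<bar>c\<bar>) * \<bar>x - y\<bar> / (d * d)"
    using d by (intro frac_le mult_right_mono mult_mono)
      (auto simp: abs_mult[symmetric] abs_triangle_ineq4)
  finally show ?thesis by (simp add: power2_eq_square)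
qed

text \<open>\<open>\<kappa>\<close> and \<open>\<Omega>\<close> are the radial and angular
  coefficients of the polar system and \<open>s\<close> is the mean of \<open>\<kappa>\<close>. A
  single bound \<open>C\<close> for all coefficient functions keeps the later smallness conditions
  short.\<close>

locale averaged_polar =
  fixes \<omega> s C :: real and \<kappa> \<Omega> h :: "real \<Rightarrow> real"
  assumes omega: "\<omega> \<noteq> 0" and s: "s < 0" and C: "1 \<le> C"
    and cont: "continuous_on UNIV \<kappa>" "continuous_on UNIV \<Omega>"
    and per: "\<And>\<phi>. \<kappa> (\<phi> + 2 * pi) = \<kappa> \<phi>" "\<And>\<phi>. \<Omega> (\<phi> + 2 * pi) = \<Omega> \<phi>" "\<And>\<phi>. h (\<phi> + 2 * pi) = h \<phi>"
    and h': "\<And>\<phi>. (h has_real_derivative (\<kappa> \<phi> - s) / \<omega>) (at \<phi>)"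
    and bounds: "\<And>\<phi>. \<bar>\<kappa> \<phi>\<bar> \<le> C" "\<And>\<phi>. \<bar>\<Omega> \<phi>\<bar> \<le> C" "\<And>\<phi>. \<bar>h \<phi>\<bar> \<le> C" "\<And>\<phi>. \<bar>(\<kappa> \<phi> - s) * \<Omega> \<phi> / \<omega>\<bar> \<le> C"
begin

text \<open>This is \<open>h' * \<Omega>\<close>: the angle moves with speed
  \<open>\<omega> + \<Omega> * r\<close> instead of \<open>\<omega>\<close>, so the correction
  \<open>h\<close> leaves the error \<open>k * r\<close> in the equation for
  \<open>u\<close>.\<close>

definition k :: "real \<Rightarrow> real" where
  "k \<phi> = (\<kappa> \<phi> - s) * \<Omega> \<phi> / \<omega>"

text \<open>Chosen such that the forcing term of \<open>z' = - \<mu> z + M\<close> below satisfies \<open>\<bar>M\<bar> \<le> \<mu> K\<close> for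
  \<open>\<bar>z\<bar> \<le> K\<close>.\<close>

definition K :: real where
  "K = 2 * C * (1 - 2 / s)"

lemma k_bound: "\<bar>k \<phi>\<bar> \<le> C"
  using bounds(4) by (simp add: k_def)

lemma K_ge: "2 * C \<le> K"
proof -
  have "2 * C * 1 \<le> 2 * C * (1 - 2 / s)" using C s by (intro mult_left_mono) (auto simp: field_simps)
  then show ?thesis by (simp add: K_def)
qed

lemma cont_h: "continuous_on UNIV h"
  using h' by (meson DERIV_isCont continuous_at_imp_continuous_on)

lemma cont_k: "continuous_on UNIV k"
  unfolding k_def[abs_def] using cont omega by (intro continuous_intros) auto

lemma k_per: "k (\<phi> + 2 * pi) = k \<phi>"
  by (simp add: k_def per)

end

text \<open>The second condition says \<open>K + C \<le> - s / (2 * \<mu>)\<close>, so that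
  \<open>z\<close> and \<open>h\<close> perturb the leading value \<open>- s / \<mu>\<close> of
  \<open>den\<close> by at most half. The third then bounds \<open>\<Omega>\<close> by a quarter of
  \<open>\<omega> * den\<close>, so that the denominator of \<open>M\<close> cannot vanish.\<close>

locale periodic_amplitude = averaged_polar +
  fixes \<mu> :: real
  assumes mu: "0 < \<mu>" "2 * \<mu> * (K + C) \<le> - s" "8 * C * \<mu> \<le> \<bar>\<omega>\<bar> * - s"
begin

text \<open>With \<open>u = - s/\<mu> + z\<close> the radius is \<open>1 / den \<phi> z\<close>. The equation for \<open>z\<close> is written in the
  variable \<open>t = \<phi>/\<omega>\<close>, so that both signs of \<open>\<omega>\<close> give damping forwards in \<open>t\<close>; \<open>clamp\<close> makes its
  right-hand side globally Lipschitz.\<close>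

definition den :: "real \<Rightarrow> real \<Rightarrow> real" where
  "den \<phi> z = - s / \<mu> + z - h \<phi>"

text \<open>Since \<open>- \<mu> / r - s = - \<mu> * z + \<mu> * h\<close>, the slope
  \<open>\<omega> * dz/d\<phi>\<close> is \<omega> times
  \<open>- \<mu> * z + \<mu> * h + k / den\<close> over \<open>\<omega> + \<Omega> / den\<close>.
  Clearing the inner fractions and splitting off \<open>- \<mu> * z\<close> leaves
  \<open>M\<close>.\<close>

definition M :: "real \<Rightarrow> real \<Rightarrow> real" where
  "M \<phi> z = (\<mu> * \<omega> * h \<phi> * den \<phi> z + \<omega> * k \<phi> + \<mu> * z * \<Omega> \<phi>) / (\<omega> * den \<phi> z + \<Omega> \<phi>)"

definition clamp :: "real \<Rightarrow> real" where
  "clamp y = max (- K) (min K y)"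

lemma clamp: "\<bar>clamp y\<bar> \<le> K" "\<bar>y\<bar> \<le> K \<Longrightarrow> clamp y = y" "\<bar>clamp x - clamp y\<bar> \<le> \<bar>x - y\<bar>"
  using K_ge C by (auto simp: clamp_def)

lemma den_ge:
  assumes "\<bar>z\<bar> \<le> K"
  shows "- s / \<mu> / 2 \<le> den \<phi> z" "0 < den \<phi> z" "den \<phi> z \<le> - s / \<mu> + K + C"
    "\<bar>\<Omega> \<phi>\<bar> \<le> \<bar>\<omega>\<bar> / 4 * den \<phi> z" "3 / 4 * \<bar>\<omega>\<bar> * den \<phi> z \<le> \<bar>\<omega> * den \<phi> z + \<Omega> \<phi>\<bar>"
proof -
  have "K + C \<le> - s / \<mu> / 2" using mu by (simp add: field_simps)
  then show 1: "- s / \<mu> / 2 \<le> den \<phi> z" using assms bounds(3)[of \<phi>] by (simp add: den_def)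
  moreover have "0 < - s / \<mu> / 2" using s mu by (simp add: field_simps)
  ultimately show 2: "0 < den \<phi> z" by linarith
  show "den \<phi> z \<le> - s / \<mu> + K + C" using assms bounds(3)[of \<phi>] by (simp add: den_def)
  have "C \<le> \<bar>\<omega>\<bar> / 4 * (- s / \<mu> / 2)" using mu by (simp add: field_simps)
  also have "\<dots> \<le> \<bar>\<omega>\<bar> / 4 * den \<phi> z" using 1 by (intro mult_left_mono) auto
  finally show 3: "\<bar>\<Omega> \<phi>\<bar> \<le> \<bar>\<omega>\<bar> / 4 * den \<phi> z" using bounds(2)[of \<phi>] by linarith
  have "\<bar>\<omega> * den \<phi> z\<bar> - \<bar>\<Omega> \<phi>\<bar> \<le> \<bar>\<omega> * den \<phi> z + \<Omega> \<phi>\<bar>" by linarith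
  then show "3 / 4 * \<bar>\<omega>\<bar> * den \<phi> z \<le> \<bar>\<omega> * den \<phi> z + \<Omega> \<phi>\<bar>"
    using 2 3 by (simp add: abs_mult)
qed

lemma den_nz: "\<bar>z\<bar> \<le> K \<Longrightarrow> \<omega> * den \<phi> z + \<Omega> \<phi> \<noteq> 0"
  using den_ge(2,5)[of z \<phi>] omega by (auto simp: mult_le_0_iff)

text \<open>With this bound the damping \<open>- \<mu> * z\<close> beats the forcing at the ends of
  the interval from \<open>- K\<close> to \<open>K\<close>.\<close>

lemma M_bound:
  assumes z: "\<bar>z\<bar> \<le> K"
  shows "\<bar>M \<phi> z\<bar> \<le> \<mu> * K"
proof -
  let ?D = "den \<phi> z"
  note D = den_ge[OF z, of \<phi>]
  have w: "0 < \<bar>\<omega>\<bar>" using omega by simp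
  have "\<bar>\<mu> * \<omega> * h \<phi> * ?D\<bar> \<le> \<mu> * \<bar>\<omega>\<bar> * C * ?D"
    using mu D(2) bounds(3)[of \<phi>] by (auto simp: abs_mult intro!: mult_mono)
  moreover have "\<bar>\<omega> * k \<phi>\<bar> \<le> \<bar>\<omega>\<bar> * (C * (- 2 * \<mu> / s) * ?D)"
  proof -
    \<comment> \<open>The factor 1 is at most \<open>(- 2 * \<mu> / s) * den\<close> by the lower
      bound for \<open>den\<close>. This extracts the factor \<mu> from a term that does not show
      one.\<close>
    have "\<bar>k \<phi>\<bar> * 1 \<le> C * ((- 2 * \<mu> / s) * ?D)"
      using k_bound[of \<phi>] D(1) s mu C
      by (intro mult_mono) (auto simp: field_simps)
    then show ?thesis unfolding abs_mult by (intro mult_left_mono) auto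
  qed
  moreover have "\<bar>\<mu> * z * \<Omega> \<phi>\<bar> \<le> \<mu> * K * (\<bar>\<omega>\<bar> / 4 * ?D)"
    unfolding abs_mult using mu z D(2,4) K_ge C by (intro mult_mono) auto
  ultimately have "\<bar>\<mu> * \<omega> * h \<phi> * ?D + \<omega> * k \<phi> + \<mu> * z * \<Omega> \<phi>\<bar> \<le>
      \<mu> * \<bar>\<omega>\<bar> * C * ?D + \<bar>\<omega>\<bar> * (C * (- 2 * \<mu> / s) * ?D) + \<mu> * K * (\<bar>\<omega>\<bar> / 4 * ?D)"
    by linarith
  also have "\<dots> = \<mu> * (C * (1 - 2 / s) + K / 4) * (\<bar>\<omega>\<bar> * ?D)"
    by (simp add: algebra_simps)
  \<comment> \<open>Here the value of \<open>K\<close> is used: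
    \<open>C * (1 - 2 / s) = K / 2\<close>, and \<open>K / 2 + K / 4\<close> is exactly the fraction
    3/4 that the lower bound for the denominator provides.\<close>
  also have "\<dots> = \<mu> * K * (3 / 4 * \<bar>\<omega>\<bar> * ?D)"
    by (simp add: K_def)
  also have "\<dots> \<le> \<mu> * K * \<bar>\<omega> * ?D + \<Omega> \<phi>\<bar>"
    using D(5) mu K_ge C by (intro mult_left_mono) auto
  finally show ?thesis
    using den_nz[OF z, of \<phi>] by (simp add: M_def abs_divide divide_simps)
qed

text \<open>As a function of \<open>z\<close>, \<open>M \<phi> z\<close> is a Moebius transformation.\<close>

definition Lip :: real where
  "Lip = \<mu> + (\<mu> * C * (\<bar>\<omega>\<bar> + 1) * (\<bar>\<omega>\<bar> * (- s / \<mu> + C) + C) +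
     (\<mu> * \<bar>\<omega>\<bar> * C * (- s / \<mu> + C) + \<bar>\<omega>\<bar> * C) * \<bar>\<omega>\<bar>) / (3 / 4 * \<bar>\<omega>\<bar> * (- s / \<mu> / 2))\<^sup>2"

lemma M_lipschitz:
  assumes x: "\<bar>x\<bar> \<le> K" and y: "\<bar>y\<bar> \<le> K"
  shows "\<bar>M \<phi> x - M \<phi> y\<bar> \<le> (Lip - \<mu>) * \<bar>x - y\<bar>"
proof -
  define a b e where "a = \<mu> * \<omega> * h \<phi> + \<mu> * \<Omega> \<phi>"
    and "b = \<mu> * \<omega> * h \<phi> * (- s / \<mu> - h \<phi>) + \<omega> * k \<phi>"
    and "e = \<omega> * (- s / \<mu> - h \<phi>) + \<Omega> \<phi>"
  define d where "d = 3 / 4 * \<bar>\<omega>\<bar> * (- s / \<mu> / 2)"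
  have "0 < - s / \<mu> / 2" using s mu by (simp add: field_simps)
  then have d: "0 < d" unfolding d_def using omega by (intro mult_pos_pos) auto
  have M: "M \<phi> z = (a * z + b) / (\<omega> * z + e)" for z
    unfolding M_def den_def a_def b_def e_def by (simp add: algebra_simps)
  have dle: "d \<le> \<bar>\<omega> * z + e\<bar>" if "\<bar>z\<bar> \<le> K" for z
  proof -
    have "d \<le> 3 / 4 * \<bar>\<omega>\<bar> * den \<phi> z" unfolding d_def
      using den_ge(1)[OF that] by (intro mult_left_mono) auto
    also have "\<dots> \<le> \<bar>\<omega> * den \<phi> z + \<Omega> \<phi>\<bar>" by (rule den_ge(5)[OF that])
    also have "\<omega> * den \<phi> z + \<Omega> \<phi> = \<omega> * z + e" by (simp add: e_def den_def algebra_simps)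
    finally show ?thesis .
  qed
  have u: "\<bar>- s / \<mu> - h \<phi>\<bar> \<le> - s / \<mu> + C" "0 \<le> - s / \<mu> + C"
  proof -
    have "0 \<le> - s / \<mu>" using s mu by (simp add: field_simps)
    then show "\<bar>- s / \<mu> - h \<phi>\<bar> \<le> - s / \<mu> + C" "0 \<le> - s / \<mu> + C"
      using bounds(3)[of \<phi>] C by linarith+
  qed
  have A: "\<bar>a\<bar> \<le> \<mu> * C * (\<bar>\<omega>\<bar> + 1)"
  proof -
    have "\<bar>a\<bar> \<le> \<bar>\<mu> * \<omega> * h \<phi>\<bar> + \<bar>\<mu> * \<Omega> \<phi>\<bar>" unfolding a_def by (rule abs_triangle_ineq)
    also have "\<dots> \<le> \<mu> * \<bar>\<omega>\<bar> * C + \<mu> * C"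
      unfolding abs_mult using mu bounds(2,3)[of \<phi>] by (intro add_mono mult_mono) auto
    finally show ?thesis by (simp add: algebra_simps)
  qed
  have B: "\<bar>b\<bar> \<le> \<mu> * \<bar>\<omega>\<bar> * C * (- s / \<mu> + C) + \<bar>\<omega>\<bar> * C"
  proof -
    have "\<bar>b\<bar> \<le> \<bar>\<mu> * \<omega> * h \<phi> * (- s / \<mu> - h \<phi>)\<bar> + \<bar>\<omega> * k \<phi>\<bar>" unfolding b_def by (rule abs_triangle_ineq)
    also have "\<dots> \<le> \<mu> * \<bar>\<omega>\<bar> * C * (- s / \<mu> + C) + \<bar>\<omega>\<bar> * C"
      unfolding abs_mult using mu bounds(3)[of \<phi>] k_bound[of \<phi>] u C by (intro add_mono mult_mono) auto
    finally show ?thesis .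
  qed
  have E: "\<bar>e\<bar> \<le> \<bar>\<omega>\<bar> * (- s / \<mu> + C) + C"
  proof -
    have "\<bar>e\<bar> \<le> \<bar>\<omega> * (- s / \<mu> - h \<phi>)\<bar> + \<bar>\<Omega> \<phi>\<bar>" unfolding e_def by (rule abs_triangle_ineq)
    also have "\<dots> \<le> \<bar>\<omega>\<bar> * (- s / \<mu> + C) + C"
      unfolding abs_mult using bounds(2)[of \<phi>] u by (intro add_mono mult_mono) auto
    finally show ?thesis .
  qed
  have "\<bar>M \<phi> x - M \<phi> y\<bar> \<le> (\<bar>a\<bar> * \<bar>e\<bar> + \<bar>b\<bar> * \<bar>\<omega>\<bar>) / d\<^sup>2 * \<bar>x - y\<bar>"
    unfolding M by (rule moebius_lipschitz[OF d dle[OF x] dle[OF y]])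
  also have "\<dots> \<le> (Lip - \<mu>) * \<bar>x - y\<bar>"
    unfolding Lip_def d_def[symmetric] add_diff_cancel_left'
    using A B E mu C by (intro mult_right_mono divide_right_mono add_mono mult_mono) auto
  finally show ?thesis .
qed

definition rhs :: "real \<Rightarrow> real \<Rightarrow> real" where
  "rhs t y = - \<mu> * y + M (\<omega> * t) (clamp y)"

lemma rhs_lipschitz: "Lip-lipschitz_on UNIV (rhs t)"
proof (rule lipschitz_onI)
  have nn: "0 \<le> Lip - \<mu>"
    \<comment> \<open>Two admissible arguments at distance 1 show that the Lipschitz constant is
      nonnegative without inspecting its formula.\<close>
    using M_lipschitz[of K "K - 1" 0] K_ge C by (simp add: abs_if split: if_splits) 
  then show "0 \<le> Lip" using mu by linarith
  fix x y
  have "\<bar>M (\<omega> * t) (clamp x) - M (\<omega> * t) (clamp y)\<bar> \<le> (Lip - \<mu>) * \<bar>clamp x - clamp y\<bar>"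
    by (rule M_lipschitz) (rule clamp)+
  also have "\<dots> \<le> (Lip - \<mu>) * \<bar>x - y\<bar>" using nn clamp(3) by (intro mult_left_mono) auto
  finally have *: "\<bar>M (\<omega> * t) (clamp x) - M (\<omega> * t) (clamp y)\<bar> \<le> (Lip - \<mu>) * \<bar>x - y\<bar>" .
  have "\<bar>rhs t x - rhs t y\<bar> \<le> \<bar>- \<mu> * (x - y)\<bar> + \<bar>M (\<omega> * t) (clamp x) - M (\<omega> * t) (clamp y)\<bar>"
    unfolding rhs_def by (rule order_trans[OF _ abs_triangle_ineq]) (simp add: algebra_simps)
  also have "\<bar>- \<mu> * (x - y)\<bar> = \<mu> * \<bar>x - y\<bar>" using mu by (simp add: abs_mult)
  finally show "dist (rhs t x) (rhs t y) \<le> Lip * dist x y"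
    using * by (simp add: dist_real_def algebra_simps)
qed

lemma rhs_continuous: "continuous_on UNIV (\<lambda>(t, y). rhs t y)"
proof -
  have c: "continuous_on UNIV (\<lambda>x::real\<times>real. g (\<omega> * fst x))" if "continuous_on UNIV g" for g :: "real \<Rightarrow> real"
    by (rule continuous_on_compose2[OF that]) (auto intro!: continuous_intros)
  show ?thesis
    unfolding rhs_def M_def den_def clamp_def split_beta
  proof (intro continuous_intros c cont cont_h cont_k ballI)
    fix x :: "real \<times> real"
    show "\<omega> * (- s / \<mu> + max (- K) (min K (snd x)) - h (\<omega> * fst x)) + \<Omega> (\<omega> * fst x) \<noteq> 0"
      using den_nz[OF clamp(1), of "\<omega> * fst x" "snd x"] by (simp add: den_def clamp_def)
  qed
qed

lemma rhs_periodic: "rhs (t + 2 * pi / \<bar>\<omega>\<bar>) y = rhs t y"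
proof -
  have "\<omega> * (t + 2 * pi / \<bar>\<omega>\<bar>) = \<omega> * t + (if \<omega> > 0 then 2 * pi else - 2 * pi)"
    using omega by (simp add: field_simps)
  then have "f (\<omega> * (t + 2 * pi / \<bar>\<omega>\<bar>)) = f (\<omega> * t)" if "\<And>x. f (x + 2 * pi) = f x" for f :: "real \<Rightarrow> real"
    using that[of "\<omega> * t"] that[of "\<omega> * t - 2 * pi"] by (cases "\<omega> > 0") auto
  from this[of \<Omega>, OF per(2)] this[of h, OF per(3)] this[of k, OF k_per] show ?thesis
    unfolding rhs_def M_def den_def by simp
qed

text \<open>With the integrating factor \<open>exp (\<mu> * t)\<close> the derivative is bounded by
  that of \<open>K * exp (\<mu> * t)\<close>. The clamp makes the bound on \<open>M\<close>
  available before anything is known about \<open>y\<close>.\<close>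

lemma solution_trapped:
  assumes y: "\<And>t. (y has_vector_derivative rhs t (y t)) (at t)" and y0: "\<bar>y 0\<bar> \<le> K" and t: "0 \<le> t"
  shows "\<bar>y t\<bar> \<le> K"
proof (cases "t = 0")
  case False
  then have t: "0 < t" using t by simp
  have d: "((\<lambda>t. exp (\<mu> * t) * y t) has_real_derivative exp (\<mu> * t) * M (\<omega> * t) (clamp (y t))) (at t)" for t
  proof -
    have "(y has_real_derivative rhs t (y t)) (at t)"
      using y by (simp add: has_real_derivative_iff_has_vector_derivative)
    then show ?thesis unfolding rhs_def
      by (auto intro!: derivative_eq_intros simp: algebra_simps)
  qed
  have "norm (exp (\<mu> * t) * y t - exp (\<mu> * 0) * y 0) \<le> K * exp (\<mu> * t) - K * exp (\<mu> * 0)"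
  proof (rule differentiable_bound_general[OF t,
        where f' = "\<lambda>t. exp (\<mu> * t) * M (\<omega> * t) (clamp (y t))" and \<phi>' = "\<lambda>t. \<mu> * K * exp (\<mu> * t)"])
    show "continuous_on {0..t} (\<lambda>t. exp (\<mu> * t) * y t)"
      using d by (meson DERIV_isCont continuous_at_imp_continuous_on)
    show "continuous_on {0..t} (\<lambda>t. K * exp (\<mu> * t))" by (intro continuous_intros)
    fix x
    show "((\<lambda>t. exp (\<mu> * t) * y t) has_vector_derivative exp (\<mu> * x) * M (\<omega> * x) (clamp (y x))) (at x)"
      using d by (simp add: has_real_derivative_iff_has_vector_derivative)
    have "((\<lambda>t. K * exp (\<mu> * t)) has_real_derivative \<mu> * K * exp (\<mu> * x)) (at x)"
      by (auto intro!: derivative_eq_intros)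
    then show "((\<lambda>t. K * exp (\<mu> * t)) has_vector_derivative \<mu> * K * exp (\<mu> * x)) (at x)"
      by (simp add: has_real_derivative_iff_has_vector_derivative)
    show "norm (exp (\<mu> * x) * M (\<omega> * x) (clamp (y x))) \<le> \<mu> * K * exp (\<mu> * x)"
      using M_bound[OF clamp(1)] by (simp add: abs_mult mult.commute)
  qed
  then have "\<bar>exp (\<mu> * t) * y t\<bar> \<le> exp (\<mu> * t) * K" using y0 by (simp add: mult.commute)
  then show ?thesis by (simp add: abs_mult)
qed (use y0 in simp)

text \<open>The time \<open>2 * pi / \<bar>\<omega>\<bar>\<close> map is continuous by the Gronwall
  estimate and maps a compact interval to itself, so it has a fixed point. Uniqueness of the
  periodic orbit comes later, from the decay of \<open>Z\<close>.\<close>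

lemma periodic_solution:
  "\<exists>z. \<forall>t. (z has_vector_derivative rhs t (z t)) (at t) \<and> z (t + 2 * pi / \<bar>\<omega>\<bar>) = z t \<and> \<bar>z t\<bar> \<le> K"
proof -
  let ?T = "2 * pi / \<bar>\<omega>\<bar>"
  have T: "0 < ?T" using omega by simp
  have "\<exists>x. x 0 = p \<and> (\<forall>t. (x has_vector_derivative rhs t (x t)) (at t))" for p
  proof (rule ivp_global[OF rhs_continuous rhs_lipschitz])
    fix t
    have "\<bar>rhs t p\<bar> \<le> \<bar>- \<mu> * p\<bar> + \<bar>M (\<omega> * t) (clamp p)\<bar>" unfolding rhs_def by (rule abs_triangle_ineq)
    also have "\<dots> \<le> \<mu> * \<bar>p\<bar> + \<mu> * K" using M_bound[OF clamp(1)] mu by (simp add: abs_mult)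
    finally show "norm (rhs t p) \<le> \<mu> * \<bar>p\<bar> + \<mu> * K" by simp
  qed
  then obtain y where y0: "\<And>p. y p 0 = p"
    and y: "\<And>p t. (y p has_vector_derivative rhs t (y p t)) (at t)" by metis
  have "\<exists>p\<in>{-K..K}. y p ?T = p"
  proof (rule brouwer)
    show "continuous_on {-K..K} (\<lambda>p. y p ?T)"
    proof (rule lipschitz_on_continuous_on, rule lipschitz_onI)
      fix p q
      have "norm (y p ?T - y q ?T) \<le> exp (Lip * ?T) * norm (y p 0 - y q 0)"
        by (rule gronwall[where f = rhs, OF less_imp_le[OF T] has_vector_derivative_at_within[OF y]
            has_vector_derivative_at_within[OF y] rhs_lipschitz]) auto
      then show "dist (y p ?T) (y q ?T) \<le> exp (Lip * ?T) * dist p q" by (simp add: dist_norm y0)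
    qed simp
    show "(\<lambda>p. y p ?T) \<in> {-K..K} \<rightarrow> {-K..K}"
    proof
      fix p assume "p \<in> {-K..K}"
      then have "\<bar>y p 0\<bar> \<le> K" by (simp add: y0 abs_le_iff)
      from solution_trapped[where y = "y p", OF y this less_imp_le[OF T]] have "\<bar>y p ?T\<bar> \<le> K" .
      then show "y p ?T \<in> {-K..K}" by auto
    qed
  qed (use K_ge C in auto)
  then obtain p where "p \<in> {-K..K}" and pT: "y p ?T = p" by blast
  then have p: "\<bar>p\<bar> \<le> K" "y p ?T = p" by auto
  define z where "z = y p"
  have z: "(z has_vector_derivative rhs t (z t)) (at t)" for t using y by (simp add: z_def)
  have "(\<lambda>t. z (t + ?T)) = z"
  proof (rule ode_unique[where f = rhs and L = Lip and S = UNIV and ?t0.0 = 0])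
    fix t
    show "((\<lambda>t. z (t + ?T)) has_vector_derivative rhs t (z (t + ?T))) (at t)"
      using has_vector_derivative_shift[OF z[of "t + ?T"]] rhs_periodic by simp
  qed (use z rhs_lipschitz p y0 in \<open>auto simp: z_def\<close>)
  then have per: "z (t + ?T) = z t" for t by metis
  have "\<bar>z t\<bar> \<le> K" for t
  proof -
    \<comment> \<open>Trapping works only forwards from time 0; negative times are moved to
      nonnegative ones by whole periods.\<close>
    obtain n :: nat where "- t / ?T \<le> real n" using real_arch_simple by blast
    then have "- t \<le> real n * ?T" unfolding pos_divide_le_eq[OF T] .
    then have n: "0 \<le> t + of_int (int n) * ?T" by simp
    have "\<bar>z 0\<bar> \<le> K" using p y0 by (simp add: z_def)
    from solution_trapped[where y = z, OF z this n] have "\<bar>z (t + of_int (int n) * ?T)\<bar> \<le> K" .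
    then show ?thesis using periodic_add_int[of z, OF per, of t "int n"] by simp
  qed
  with z per show ?thesis by blast
qed

text \<open>The substitution \<open>t = \<phi> / \<omega>\<close> is undone. The clamp disappears
  because the periodic solution stays where it is the identity.\<close>

lemma periodic_amplitude:
  "\<exists>z. \<forall>\<phi>. \<bar>z \<phi>\<bar> \<le> K \<and> z (\<phi> + 2 * pi) = z \<phi> \<and>
    (z has_real_derivative (- \<mu> * z \<phi> + \<mu> * h \<phi> + k \<phi> / den \<phi> (z \<phi>)) / (\<omega> + \<Omega> \<phi> / den \<phi> (z \<phi>))) (at \<phi>)"
proof -
  obtain z where z: "\<And>t. (z has_vector_derivative rhs t (z t)) (at t)"
    "\<And>t. z (t + 2 * pi / \<bar>\<omega>\<bar>) = z t" "\<And>t. \<bar>z t\<bar> \<le> K"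
    using periodic_solution by blast
  have "z ((\<phi> + 2 * pi) / \<omega>) = z (\<phi> / \<omega>)" for \<phi>
    using z(2)[of "\<phi> / \<omega>"] z(2)[of "(\<phi> + 2 * pi) / \<omega>"] omega
    by (cases "\<omega> > 0") (auto simp: add_divide_distrib)
  moreover have "((\<lambda>\<phi>. z (\<phi> / \<omega>)) has_real_derivative (- \<mu> * z (\<phi> / \<omega>) + \<mu> * h \<phi> + k \<phi> / den \<phi> (z (\<phi> / \<omega>))) /
      (\<omega> + \<Omega> \<phi> / den \<phi> (z (\<phi> / \<omega>)))) (at \<phi>)" for \<phi>
  proof -
    let ?z = "z (\<phi> / \<omega>)"
    define D where "D = den \<phi> ?z"
    have D: "D \<noteq> 0" "\<omega> * D + \<Omega> \<phi> \<noteq> 0" "\<omega> + \<Omega> \<phi> / D \<noteq> 0"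
      using den_ge(2)[OF z(3)[of "\<phi> / \<omega>"], of \<phi>] den_nz[OF z(3)[of "\<phi> / \<omega>"], of \<phi>] by (auto simp: D_def field_simps)
    have "(z has_real_derivative rhs (\<phi> / \<omega>) ?z) (at (\<phi> / \<omega>))"
      using z(1) by (simp add: has_real_derivative_iff_has_vector_derivative)
    then have "((\<lambda>\<phi>. z (\<phi> / \<omega>)) has_real_derivative rhs (\<phi> / \<omega>) ?z * (1 / \<omega>)) (at \<phi>)"
      by (rule DERIV_chain2) (auto intro!: derivative_eq_intros omega)
    moreover have "rhs (\<phi> / \<omega>) ?z * (1 / \<omega>) = (- \<mu> * ?z + \<mu> * h \<phi> + k \<phi> / D) / (\<omega> + \<Omega> \<phi> / D)"
    proof -
      define N where "N = - \<mu> * ?z * D + \<mu> * h \<phi> * D + k \<phi>"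
      have "rhs (\<phi> / \<omega>) ?z = - \<mu> * ?z + (\<mu> * \<omega> * h \<phi> * D + \<omega> * k \<phi> + \<mu> * ?z * \<Omega> \<phi>) / (\<omega> * D + \<Omega> \<phi>)"
        using omega by (simp add: rhs_def M_def clamp(2)[OF z(3)] D_def)
      also have "\<dots> = \<omega> * N / (\<omega> * D + \<Omega> \<phi>)"
        using D(2) by (simp add: N_def divide_simps) (simp add: algebra_simps)
      finally have 1: "rhs (\<phi> / \<omega>) ?z * (1 / \<omega>) = N / (\<omega> * D + \<Omega> \<phi>)" using omega by simp
      have 2: "- \<mu> * ?z + \<mu> * h \<phi> + k \<phi> / D = N / D" "\<omega> + \<Omega> \<phi> / D = (\<omega> * D + \<Omega> \<phi>) / D"
        using D(1) by (simp_all add: N_def add_divide_distrib diff_divide_distrib)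
      show ?thesis unfolding 1 2 using D(1) by simp
    qed
    ultimately show ?thesis by (simp add: D_def)
  qed
  ultimately show ?thesis using z(3) by (intro exI[of _ "\<lambda>\<phi>. z (\<phi> / \<omega>)"]) blast
qed

end

section \<open>Homogeneous quadratic perturbations of a rotation\<close>

text \<open>By homogeneity \<open>Q\<close> at radius \<open>r\<close> is \<open>r\<^sup>2\<close>
  times its value on the unit circle. Its components along the radius and along the tangent are the
  coefficients \<open>\<kappa>\<close> and \<open>\<Omega>\<close> of the polar system.\<close>

definition radial :: "(plane \<Rightarrow> plane) \<Rightarrow> real \<Rightarrow> real" where
  "radial Q \<phi> = cos \<phi> * fst (Q (polar 1 \<phi>)) + sin \<phi> * snd (Q (polar 1 \<phi>))"

definition angular :: "(plane \<Rightarrow> plane) \<Rightarrow> real \<Rightarrow> real" where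
  "angular Q \<phi> = cos \<phi> * snd (Q (polar 1 \<phi>)) - sin \<phi> * fst (Q (polar 1 \<phi>))"

definition hfield :: "real \<Rightarrow> (plane \<Rightarrow> plane) \<Rightarrow> real \<Rightarrow> plane \<Rightarrow> plane" where
  "hfield \<omega> Q \<mu> x = \<mu> *\<^sub>R x + \<omega> *\<^sub>R (- snd x, fst x) + Q x"

text \<open>Lipschitz continuity is the only regularity, which admits the kinks of piecewise
  quadratic terms. It is required on a disc because quadratic growth generally rules out a global
  constant.\<close>

locale homogeneous_field =
  fixes \<omega> L :: real and Q :: "plane \<Rightarrow> plane"
  assumes omega: "\<omega> \<noteq> 0"
    and hom: "\<And>c x. 0 \<le> c \<Longrightarrow> Q (c *\<^sub>R x) = c\<^sup>2 *\<^sub>R Q x"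
    and lip: "L-lipschitz_on (cball 0 1) Q"
begin

lemma Q_0: "Q 0 = 0"
  using hom[of 0 0] by simp

lemma Q_bound: "norm x \<le> 1 \<Longrightarrow> norm (Q x) \<le> L * (norm x)\<^sup>2"
proof (cases "x = 0")
  case False
  let ?e = "inverse (norm x) *\<^sub>R x"
  have "norm (Q x) = (norm x)\<^sup>2 * norm (Q ?e)"
    using hom[of "norm x" ?e] False by simp
  also have "norm (Q ?e) \<le> L * norm ?e"
    using lipschitz_on_normD[OF lip, of ?e 0] False Q_0 by simp
  finally show ?thesis using False by (simp add: mult.commute mult_left_mono)
qed (simp add: Q_0)

lemma Q_polar: "0 \<le> r \<Longrightarrow> Q (polar r \<phi>) = r\<^sup>2 *\<^sub>R Q (polar 1 \<phi>)"
  using hom[of r "polar 1 \<phi>"] by (simp add: polar_def)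

lemma hfield_polar:
  assumes "0 \<le> r"
  shows "hfield \<omega> Q \<mu> (polar r \<phi>) =
    ((\<mu> * r + radial Q \<phi> * r\<^sup>2) * cos \<phi> - r * (\<omega> + angular Q \<phi> * r) * sin \<phi>,
     (\<mu> * r + radial Q \<phi> * r\<^sup>2) * sin \<phi> + r * (\<omega> + angular Q \<phi> * r) * cos \<phi>)"
proof -
  define a b where "a = fst (Q (polar 1 \<phi>))" and "b = snd (Q (polar 1 \<phi>))"
  have 1: "cos \<phi> * cos \<phi> = 1 - sin \<phi> * sin \<phi>"
    using sin_cos_squared_add3[of \<phi>] by linarith
  have "radial Q \<phi> * cos \<phi> - angular Q \<phi> * sin \<phi> = a * (cos \<phi> * cos \<phi>) + a * (sin \<phi> * sin \<phi>)"
    "radial Q \<phi> * sin \<phi> + angular Q \<phi> * cos \<phi> = b * (cos \<phi> * cos \<phi>) + b * (sin \<phi> * sin \<phi>)"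
    by (simp_all add: radial_def angular_def a_def b_def algebra_simps)
  then have *: "a = radial Q \<phi> * cos \<phi> - angular Q \<phi> * sin \<phi>"
    "b = radial Q \<phi> * sin \<phi> + angular Q \<phi> * cos \<phi>"
    by (simp_all add: 1 algebra_simps)
  have Q1: "Q (polar 1 \<phi>) = (a, b)" by (simp add: a_def b_def)
  show ?thesis unfolding hfield_def Q_polar[OF assms] Q1 unfolding *
    by (simp add: polar_def algebra_simps power2_eq_square)
qed

lemma hfield_lipschitz: "(\<bar>\<mu>\<bar> + \<bar>\<omega>\<bar> + L)-lipschitz_on (cball 0 1) (hfield \<omega> Q \<mu>)"
proof -
  have "1-lipschitz_on (cball 0 1) (\<lambda>x::plane. (- snd x, fst x))"
    by (rule lipschitz_onI) (simp_all add: dist_norm norm_prod_def power2_commute add.commute)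
  then have "(\<bar>\<mu>\<bar> * 1 + \<bar>\<omega>\<bar> * 1 + L)-lipschitz_on (cball 0 1) (hfield \<omega> Q \<mu>)"
    unfolding hfield_def by (intro lipschitz_intros lip)
  then show ?thesis by simp
qed

lemma hfield_0: "hfield \<omega> Q \<mu> 0 = 0"
  using Q_0 by (simp add: hfield_def zero_prod_def)

lemma polar_solution:
  assumes T: "0 \<le> T" and sol: "solves_on (hfield \<omega> Q \<mu>) x {0..T}"
    and x: "\<And>t. t \<in> {0..T} \<Longrightarrow> x t \<noteq> 0 \<and> norm (x t) \<le> 1"
    and x0: "x 0 = polar (norm (x 0)) \<theta>0"
  shows "\<exists>\<theta>. \<theta> 0 = \<theta>0 \<and> (\<forall>t\<in>{0..T}. x t = polar (norm (x t)) (\<theta> t) \<and>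
    (\<theta> has_real_derivative \<omega> + angular Q (\<theta> t) * norm (x t)) (at t within {0..T}) \<and>
    ((\<lambda>t. norm (x t)) has_real_derivative \<mu> * norm (x t) + radial Q (\<theta> t) * (norm (x t))\<^sup>2) (at t within {0..T}))"
proof -
  let ?F = "hfield \<omega> Q \<mu>"
  have "continuous_on {0..T} (\<lambda>t. ?F (x t))"
    by (rule continuous_on_compose2[OF lipschitz_on_continuous_on[OF hfield_lipschitz]
          solves_on_imp_continuous_on[OF sol]]) (use x in auto)
  then obtain \<theta> where \<theta>0: "\<theta> 0 = \<theta>0" and \<theta>: "\<And>t. t \<in> {0..T} \<Longrightarrow> x t = polar (norm (x t)) (\<theta> t)"
    "\<And>t. t \<in> {0..T} \<Longrightarrow>
      (\<theta> has_vector_derivative (fst (x t) * snd (?F (x t)) - snd (x t) * fst (?F (x t))) / (norm (x t))\<^sup>2) (at t within {0..T})"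
    "\<And>t. t \<in> {0..T} \<Longrightarrow>
      ((\<lambda>t. norm (x t)) has_vector_derivative (x t \<bullet> ?F (x t)) / norm (x t)) (at t within {0..T})"
    using polar_lift[OF T, of x "\<lambda>t. ?F (x t)" \<theta>0] sol x x0 unfolding solves_on_def by blast
  have "(fst (x t) * snd (?F (x t)) - snd (x t) * fst (?F (x t))) / (norm (x t))\<^sup>2 = \<omega> + angular Q (\<theta> t) * norm (x t)"
    and "(x t \<bullet> ?F (x t)) / norm (x t) = \<mu> * norm (x t) + radial Q (\<theta> t) * (norm (x t))\<^sup>2"
    if t: "t \<in> {0..T}" for t
  proof -
    define r c s A B where "r = norm (x t)" and "c = cos (\<theta> t)" and "s = sin (\<theta> t)"
      and "A = \<mu> * r + radial Q (\<theta> t) * r\<^sup>2" and "B = r * (\<omega> + angular Q (\<theta> t) * r)"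
    have r: "r > 0" using x[OF t] by (simp add: r_def)
    have xt: "x t = (r * c, r * s)" using \<theta>(1)[OF t] by (simp add: polar_def r_def c_def s_def)
    have Fx: "?F (x t) = (A * c - B * s, A * s + B * c)"
      using hfield_polar[of r \<mu> "\<theta> t"] \<theta>(1)[OF t] r by (simp add: r_def A_def B_def c_def s_def)
    have 1: "c * c + s * s = 1" using sin_cos_squared_add3[of "\<theta> t"] by (simp add: c_def s_def)
    have "fst (x t) * snd (?F (x t)) - snd (x t) * fst (?F (x t)) = r * B * (c * c + s * s)"
      unfolding Fx unfolding xt by (simp add: algebra_simps)
    then show "(fst (x t) * snd (?F (x t)) - snd (x t) * fst (?F (x t))) / (norm (x t))\<^sup>2 = \<omega> + angular Q (\<theta> t) * norm (x t)"
      unfolding 1 r_def[symmetric] using r by (simp add: B_def power2_eq_square)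
    have "x t \<bullet> ?F (x t) = r * A * (c * c + s * s)"
      unfolding Fx unfolding xt by (simp add: inner_prod_def algebra_simps)
    then show "(x t \<bullet> ?F (x t)) / norm (x t) = \<mu> * norm (x t) + radial Q (\<theta> t) * (norm (x t))\<^sup>2"
      unfolding 1 r_def[symmetric] using r by (simp add: A_def)
  qed
  with \<theta>0 \<theta> show ?thesis unfolding has_real_derivative_iff_has_vector_derivative
    by (intro exI[of _ \<theta>]) simp
qed

lemma origin_stable:
  assumes mu: "\<mu> < 0"
  shows "asymptotically_stable (hfield \<omega> Q \<mu>) {0}"
proof -
  have L: "0 \<le> L" using lip by (rule lipschitz_on_nonneg)
  \<comment> \<open>Inside radius \<open>a\<close> the quadratic part uses up at most half of the
    linear damping, and the rotation is orthogonal to \<open>x\<close>. The summand 1 allows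
    \<open>L = 0\<close>.\<close>
  define a where "a = min 1 (- \<mu> / (2 * (L + 1)))"
  have a: "0 < a" "a \<le> 1" "2 * L * a \<le> - \<mu>"
  proof -
    show "0 < a" using mu L divide_neg_pos[of \<mu> "2 * L + 2"] by (simp add: a_def)
    have "2 * L * a \<le> 2 * (L + 1) * (- \<mu> / (2 * (L + 1)))"
      using L mu divide_neg_pos[of \<mu> "2 * L + 2"] by (intro mult_mono) (auto simp: a_def)
    then show "2 * L * a \<le> - \<mu>" using L by simp
  qed (simp add: a_def)
  show ?thesis
  proof (rule asymptotically_stableI[OF hfield_lipschitz, where V = "ball 0 a" and K = "cball 0 (a / 2)"
        and N = norm and \<gamma> = "- \<mu> / 2" and \<eta> = 1 and C = 1])
    show "ball (0 :: plane) a \<subseteq> cball 0 1" using a(2) by auto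
    fix x :: "real \<Rightarrow> plane" and T :: real
    assume T: "0 \<le> T" and sol: "solves_on (hfield \<omega> Q \<mu>) x {0..T}"
      and V: "x ` {0..T} \<subseteq> ball 0 a" and x0: "x 0 \<in> cball 0 (a / 2)"
    have "norm (x T) \<le> exp (\<mu> / 2 * T) * norm (x 0)"
    proof (rule norm_growth_within[OF T, where x' = "\<lambda>t. hfield \<omega> Q \<mu> (x t)"])
      fix t assume t: "t \<in> {0..T}"
      show "(x has_vector_derivative hfield \<omega> Q \<mu> (x t)) (at t within {0..T})"
        using sol t by (simp add: solves_on_def)
      have nx: "norm (x t) < a" using V t by (metis image_subset_iff mem_ball_0)
      have "x t \<bullet> Q (x t) \<le> norm (x t) * norm (Q (x t))" by (rule norm_cauchy_schwarz)
      also have "\<dots> \<le> a * (L * (norm (x t))\<^sup>2)"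
        using nx a Q_bound[of "x t"] by (intro mult_mono) auto
      also have "\<dots> \<le> - \<mu> / 2 * (norm (x t))\<^sup>2"
        using mult_right_mono[OF a(3), of "(norm (x t))\<^sup>2"] by (simp add: algebra_simps)
      finally have "x t \<bullet> Q (x t) \<le> - \<mu> / 2 * (norm (x t))\<^sup>2" .
      moreover have "x t \<bullet> (- snd (x t), fst (x t)) = 0" by (simp add: inner_prod_def)
      moreover have "x t \<bullet> hfield \<omega> Q \<mu> (x t) =
          \<mu> * (norm (x t))\<^sup>2 + \<omega> * (x t \<bullet> (- snd (x t), fst (x t))) + x t \<bullet> Q (x t)"
        by (simp only: hfield_def inner_add_right inner_scaleR_right power2_norm_eq_inner)
      ultimately show "x t \<bullet> hfield \<omega> Q \<mu> (x t) \<le> \<mu> / 2 * (norm (x t))\<^sup>2"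
        by simp
    qed
    moreover have "exp (\<mu> / 2 * T) * norm (x 0) \<le> 1 * norm (x 0)"
      using mu T by (intro mult_right_mono) (auto simp: mult_le_0_iff)
    ultimately show "x T \<in> cball 0 (a / 2) \<and> norm (x T) \<le> exp (- (- \<mu> / 2) * T) * norm (x 0)"
      using x0 by simp
  next
    show "\<exists>d>0. \<forall>x::plane. infdist x {0} < d \<longrightarrow> x \<in> cball 0 (a / 2) \<and> norm x \<le> e" if "0 < e" for e
      using that a by (intro exI[of _ "min (a / 2) e"]) auto
  qed (use a mu in auto)
qed

lemma periodic_orbit_avoids_0:
  assumes sol: "solves_on (hfield \<omega> Q \<mu>) x UNIV" and x: "\<And>t. norm (x t) \<le> 1" and "x t0 \<noteq> x 0"
  shows "x t \<noteq> 0"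
proof
  assume "x t = 0"
  have "x = (\<lambda>_. 0)"
    by (rule ode_unique[where f = "\<lambda>_. hfield \<omega> Q \<mu>" and S = "cball 0 1" and ?t0.0 = t])
      (use sol x hfield_0 hfield_lipschitz \<open>x t = 0\<close> in \<open>auto simp: solves_on_def\<close>)
  then show False using \<open>x t0 \<noteq> x 0\<close> by simp
qed

end

text \<open>\<open>R\<close> is the radius of the \<mu>-independent neighborhood. The conditions
  before the last make every product of a coefficient and a radius small against 1,
  \<open>\<omega>\<close> and \<open>s\<close>; the last one lets the remainder in
  \<open>rate_ge\<close> use at most half of the main term.\<close>

locale averaged_field = homogeneous_field \<omega> L Q + averaged_polar \<omega> s C "radial Q" "angular Q" h
  for \<omega> L Q s C h +
  fixes R :: real
  assumes R: "0 < R" "R \<le> 1" "4 * C * R \<le> 1" "4 * C * R \<le> \<bar>\<omega>\<bar>" "2 * C * R \<le> - s"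
    "2 * R * (C * (\<bar>\<omega>\<bar> + 1) + 2 * (C * \<bar>\<omega>\<bar> + C\<^sup>2) + (C\<^sup>2 * (\<bar>\<omega>\<bar> + 1) - s * C\<^sup>2)) \<le> - s * \<bar>\<omega>\<bar>"
begin

lemma small_coeff:
  assumes "\<bar>c\<bar> \<le> C" "0 \<le> r" "r \<le> R"
  shows "\<bar>c * r\<bar> \<le> 1 / 4" "\<bar>c * r\<bar> \<le> \<bar>\<omega>\<bar> / 4" "\<bar>c * r\<bar> \<le> - s / 2"
proof -
  have "\<bar>c * r\<bar> \<le> C * R" unfolding abs_mult using assms C by (intro mult_mono) auto
  then show "\<bar>c * r\<bar> \<le> 1 / 4" "\<bar>c * r\<bar> \<le> \<bar>\<omega>\<bar> / 4" "\<bar>c * r\<bar> \<le> - s / 2" using R by auto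
qed

text \<open>The derivative of \<open>1 / r\<close> is \<open>- \<mu> / r - radial Q\<close>, and
  that of \<open>h \<theta>\<close> is \<open>radial Q - s + k * r\<close>, so the oscillating
  coefficient cancels.\<close>

lemma inverse_radius_deriv:
  assumes \<theta>: "(\<theta> has_real_derivative \<omega> + angular Q (\<theta> t) * r t) (at t within S)"
    and r: "(r has_real_derivative \<mu> * r t + radial Q (\<theta> t) * (r t)\<^sup>2) (at t within S)" and "0 < r t"
  shows "((\<lambda>t. 1 / r t + h (\<theta> t)) has_real_derivative - \<mu> / r t - s + k (\<theta> t) * r t) (at t within S)"
proof -
  have "((\<lambda>t. 1 / r t + h (\<theta> t)) has_real_derivative
      - (\<mu> * r t + radial Q (\<theta> t) * (r t)\<^sup>2) / (r t * r t) + (radial Q (\<theta> t) - s) / \<omega> * (\<omega> + angular Q (\<theta> t) * r t)) (at t within S)"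
    by (rule DERIV_add[OF _ DERIV_chain2[OF h' \<theta>]])
      (rule DERIV_divide[OF DERIV_const r, THEN DERIV_cong], use \<open>0 < r t\<close> in auto)
  then show ?thesis
    by (rule DERIV_cong) (use \<open>0 < r t\<close> omega in \<open>simp add: k_def field_simps power2_eq_square\<close>)
qed

lemma no_periodic_orbit:
  assumes mu: "\<mu> \<le> 0" and po: "periodic_orbit (hfield \<omega> Q \<mu>) \<Gamma>" and \<Gamma>: "\<Gamma> \<subseteq> ball 0 R"
  shows False
proof -
  obtain x T where sol: "solves_on (hfield \<omega> Q \<mu>) x UNIV" and T: "T > 0" "\<And>t. x (t + T) = x t"
    and nc: "\<exists>t. x t \<noteq> x 0" and \<Gamma>x: "\<Gamma> = range x"
    using po unfolding periodic_orbit_def by blast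
  have xR: "norm (x t) < R" for t using \<Gamma> \<Gamma>x by (metis mem_ball_0 rangeI subsetD)
  have x1: "norm (x t) \<le> 1" for t using xR[of t] R by linarith
  have nz: "x t \<noteq> 0" for t using nc periodic_orbit_avoids_0[OF sol x1] by blast
  obtain \<theta>0 where x0: "x 0 = polar (norm (x 0)) \<theta>0" using polar_exists by metis
  obtain \<theta> where \<theta>: "\<theta> 0 = \<theta>0" "\<And>t. t \<in> {0..T} \<Longrightarrow> x t = polar (norm (x t)) (\<theta> t)"
    "\<And>t. t \<in> {0..T} \<Longrightarrow> (\<theta> has_real_derivative \<omega> + angular Q (\<theta> t) * norm (x t)) (at t within {0..T})"
    "\<And>t. t \<in> {0..T} \<Longrightarrow> ((\<lambda>t. norm (x t)) has_real_derivative
      \<mu> * norm (x t) + radial Q (\<theta> t) * (norm (x t))\<^sup>2) (at t within {0..T})"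
    using polar_solution[of T \<mu> x \<theta>0] T solves_on_subset[OF sol, of "{0..T}"] nz x1 x0 by auto
  let ?u = "\<lambda>t. 1 / norm (x t) + h (\<theta> t)"
  \<comment> \<open>Monotonicity of this function says that \<open>?u\<close> grows at least with
    speed \<open>- s / 2\<close>, which contradicts its return after a period.\<close>
  let ?f = "\<lambda>t. - ?u t - s / 2 * t"
  have "?f T \<le> ?f 0"
  proof (rule nonincreasing_within[where f' = "\<lambda>t. - (- \<mu> / norm (x t) - s + k (\<theta> t) * norm (x t)) - s / 2"])
    fix t assume t: "t \<in> {0..T}"
    have "(?u has_real_derivative - \<mu> / norm (x t) - s + k (\<theta> t) * norm (x t)) (at t within {0..T})"
      using inverse_radius_deriv[OF \<theta>(3,4)[OF t]] nz[of t] by simp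
    moreover have "((\<lambda>t. s / 2 * t) has_real_derivative s / 2) (at t within {0..T})"
      by (auto intro!: derivative_eq_intros)
    ultimately have "(?f has_real_derivative - (- \<mu> / norm (x t) - s + k (\<theta> t) * norm (x t)) - s / 2) (at t within {0..T})"
      by (intro DERIV_diff DERIV_minus)
    then show "(?f has_vector_derivative - (- \<mu> / norm (x t) - s + k (\<theta> t) * norm (x t)) - s / 2) (at t within {0..T})"
      by (simp add: has_real_derivative_iff_has_vector_derivative)
    have "0 \<le> - \<mu> / norm (x t)" using mu by (simp add: divide_nonpos_nonneg)
    moreover have "\<bar>k (\<theta> t) * norm (x t)\<bar> \<le> - s / 2"
      using xR[of t] by (intro small_coeff k_bound) auto
    ultimately show "- (- \<mu> / norm (x t) - s + k (\<theta> t) * norm (x t)) - s / 2 \<le> 0" by linarith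
  qed (use T in auto)
  moreover have "?u T = ?u 0"
  proof -
    \<comment> \<open>After one period the lifted angle may differ by a multiple of
      \<open>2 * pi\<close>, which the periodic \<open>h\<close> does not see.\<close>
    have xT: "x T = x 0" using T(2)[of 0] by simp
    then have "polar (norm (x 0)) (\<theta> T) = polar (norm (x 0)) (\<theta> 0)"
      using \<theta>(2)[of T] \<theta>(2)[of 0] T by simp
    then have "h (\<theta> T) = h (\<theta> 0)"
      using polar_eqD(2,3) nz[of 0] by (intro periodic_cong_angle[of h, OF per(3)]) auto
    then show ?thesis by (simp add: xT)
  qed
  ultimately show False using mult_neg_pos[OF s T(1)] by simp
qed

end

section \<open>The bifurcating orbit\<close>

text \<open>The left side is the quotient rule for the ratio of \<open>1 / p + h\<close> to
  \<open>1 / r + h\<close>, with both angles moving at the speed of the solution of radius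
  \<open>r\<close>. It has the same factor \<open>r - p\<close> as the ratio minus 1, so the linear
  equation for \<open>Z\<close> is exact.\<close>

lemma gauge_identity:
  fixes r p h k w W m s :: real
  assumes nz: "r \<noteq> 0" "p \<noteq> 0" "1 + h * r \<noteq> 0" "w + W * p \<noteq> 0"
  defines "B \<equiv> - s * w + m * (h * w + W) + (k * w + m * (h * W)) * (r + p) + (k * (h * w + W) + s * (h * W)) * (r * p)"
  shows "((- m / p - s + k * p) / (w + W * p) * (w + W * r) * (1 / r + h) - (1 / p + h) * (- m / r - s + k * r)) /
      ((1 / r + h) * (1 / r + h)) = - (r * B / ((1 + h * r) * (w + W * p))) * ((1 / p + h) / (1 / r + h) - 1)"
proof -
  define D P where "D = w + W * p" and "P = 1 + h * r"
  have D: "D \<noteq> 0" and P: "P \<noteq> 0" using nz by (auto simp: D_def P_def)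
  have e: "1 / r + h = P / r" "1 / p + h = (1 + h * p) / p"
    "- m / p - s + k * p = (- m - s * p + k * p\<^sup>2) / p" "- m / r - s + k * r = (- m - s * r + k * r\<^sup>2) / r"
    using nz by (simp_all add: P_def field_simps power2_eq_square)
  \<comment> \<open>The polynomial vanishes at \<open>r = p\<close>, and \<open>B\<close> is the
    cofactor of \<open>r - p\<close>. It consists of \<open>- s * w\<close> and terms containing
    \<open>m\<close>, \<open>r\<close> or \<open>p\<close>.\<close>
  have "(- m - s * p + k * p\<^sup>2) * (w + W * r) * P - (1 + h * p) * (- m - s * r + k * r\<^sup>2) * D = - ((r - p) * B)"
    by (simp add: B_def D_def P_def algebra_simps power2_eq_square)
  moreover have "(- m - s * p + k * p\<^sup>2) / p / D * (w + W * r) * (P / r) - (1 + h * p) / p * ((- m - s * r + k * r\<^sup>2) / r) =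
      ((- m - s * p + k * p\<^sup>2) * (w + W * r) * P - (1 + h * p) * (- m - s * r + k * r\<^sup>2) * D) / (p * r * D)"
    using nz D by (simp add: diff_divide_distrib)
  ultimately have 1: "(- m - s * p + k * p\<^sup>2) / p / D * (w + W * r) * (P / r) - (1 + h * p) / p * ((- m - s * r + k * r\<^sup>2) / r) =
      - ((r - p) * B) / (p * r * D)" by simp
  have 2: "(1 + h * p) / p / (P / r) - 1 = (r - p) / (p * P)"
    using nz P by (simp add: divide_simps) (simp add: P_def algebra_simps)
  show ?thesis
    unfolding e D_def[symmetric] P_def[symmetric] 1 2 using nz D P by (simp add: divide_simps)
qed

text \<open>\<open>\<mu> \<le> R\<close> lets the conditions on \<open>R\<close> absorb the terms
  with a factor \<mu>; the bound on \<open>3 * (- \<mu> / s)\<close> places an annulus around the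
  orbit inside the disc. \<open>z\<close> is one fixed solution as supplied by
  \<open>periodic_amplitude\<close>.\<close>

locale bifurcating_orbit =
  averaged_field \<omega> L Q s C h R + periodic_amplitude \<omega> s C "radial Q" "angular Q" h \<mu>
  for \<omega> L Q s C h R \<mu> +
  fixes z :: "real \<Rightarrow> real"
  assumes mu_R: "\<mu> \<le> R" "3 * (- \<mu> / s) \<le> R"
    and z: "\<And>\<phi>. \<bar>z \<phi>\<bar> \<le> K" "\<And>\<phi>. z (\<phi> + 2 * pi) = z \<phi>"
      "\<And>\<phi>. (z has_real_derivative (- \<mu> * z \<phi> + \<mu> * h \<phi> + k \<phi> / den \<phi> (z \<phi>)) /
        (\<omega> + angular Q \<phi> / den \<phi> (z \<phi>))) (at \<phi>)"
begin

abbreviation F :: "plane \<Rightarrow> plane" where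
  "F \<equiv> hfield \<omega> Q \<mu>"

definition m :: real where
  "m = - \<mu> / s"

definition \<rho> :: "real \<Rightarrow> real" where
  "\<rho> \<phi> = 1 / den \<phi> (z \<phi>)"

definition orbit :: "plane set" where
  "orbit = range (\<lambda>\<phi>. polar (\<rho> \<phi>) \<phi>)"

lemma m_pos: "0 < m" "3 * m \<le> R" "- s / \<mu> = 1 / m" "m * (K + C) \<le> 1 / 2"
  using mu(1,2) s mu_R by (auto simp: m_def divide_pos_neg field_simps)

lemma rho_bounds: "2 / 3 * m \<le> \<rho> \<phi>" "\<rho> \<phi> \<le> 2 * m" "0 < \<rho> \<phi>" "\<rho> \<phi> \<le> R"
proof -
  have "1 / m / 2 \<le> den \<phi> (z \<phi>)" using den_ge(1)[OF z(1)[of \<phi>], of \<phi>] unfolding m_pos(3) .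
  then have "1 / den \<phi> (z \<phi>) \<le> 1 / (1 / m / 2)" using m_pos by (intro frac_le) auto
  then show 2: "\<rho> \<phi> \<le> 2 * m" by (simp add: \<rho>_def)
  define i where "i = 1 / m"
  have "K + C \<le> i / 2" unfolding i_def using m_pos by (simp add: field_simps)
  then have "den \<phi> (z \<phi>) \<le> 3 / 2 * i"
    using den_ge(3)[OF z(1)[of \<phi>], of \<phi>] unfolding m_pos(3) i_def[symmetric] by linarith
  then have "1 / (3 / 2 * i) \<le> 1 / den \<phi> (z \<phi>)" using den_ge(2)[OF z(1)[of \<phi>], of \<phi>] by (intro frac_le) auto
  then show "2 / 3 * m \<le> \<rho> \<phi>" by (simp add: \<rho>_def i_def)
  then show "0 < \<rho> \<phi>" "\<rho> \<phi> \<le> R" using m_pos 2 by linarith+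
qed

lemma den_z: "den \<phi> (z \<phi>) = 1 / \<rho> \<phi>" "1 / \<rho> \<phi> + h \<phi> = - s / \<mu> + z \<phi>"
  by (simp_all add: \<rho>_def den_def)

lemma z_deriv: "(z has_real_derivative (- \<mu> / \<rho> \<phi> - s + k \<phi> * \<rho> \<phi>) / (\<omega> + angular Q \<phi> * \<rho> \<phi>)) (at \<phi>)"
proof -
  have "- \<mu> / \<rho> \<phi> - s = - \<mu> * (1 / \<rho> \<phi>) - s" by simp
  also have "1 / \<rho> \<phi> = - s / \<mu> + z \<phi> - h \<phi>" using den_z(2)[of \<phi>] by linarith
  also have "- \<mu> * (- s / \<mu> + z \<phi> - h \<phi>) - s = - \<mu> * z \<phi> + \<mu> * h \<phi>"
    using mu(1) by (simp add: field_simps)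
  finally show ?thesis using z(3)[of \<phi>] by (simp add: den_z(1))
qed

lemma rho_deriv:
  "(\<rho> has_real_derivative (\<mu> * \<rho> \<phi> + radial Q \<phi> * (\<rho> \<phi>)\<^sup>2) / (\<omega> + angular Q \<phi> * \<rho> \<phi>)) (at \<phi>)"
proof -
  let ?D = "\<omega> + angular Q \<phi> * \<rho> \<phi>"
  have r: "\<rho> \<phi> > 0" by (rule rho_bounds)
  have D: "?D \<noteq> 0"
    using small_coeff(2)[OF bounds(2)[of \<phi>], of "\<rho> \<phi>"] rho_bounds[of \<phi>] omega by auto
  have "((\<lambda>\<phi>. - s / \<mu> + z \<phi> - h \<phi>) has_real_derivative
      (0 + (- \<mu> / \<rho> \<phi> - s + k \<phi> * \<rho> \<phi>) / ?D - (radial Q \<phi> - s) / \<omega>)) (at \<phi>)"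
    by (intro DERIV_diff DERIV_add DERIV_const z_deriv h')
  then have "((\<lambda>\<phi>. den \<phi> (z \<phi>)) has_real_derivative
      ((- \<mu> / \<rho> \<phi> - s + k \<phi> * \<rho> \<phi>) / ?D - (radial Q \<phi> - s) / \<omega>)) (at \<phi>)"
    by (simp add: den_def)
  then have "((\<lambda>\<phi>. 1 / den \<phi> (z \<phi>)) has_real_derivative
      - ((- \<mu> / \<rho> \<phi> - s + k \<phi> * \<rho> \<phi>) / ?D - (radial Q \<phi> - s) / \<omega>) / (den \<phi> (z \<phi>) * den \<phi> (z \<phi>))) (at \<phi>)"
    using den_ge(2)[OF z(1)[of \<phi>], of \<phi>] by (auto intro!: DERIV_divide[OF DERIV_const, THEN DERIV_cong])
  then have "(\<rho> has_real_derivative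
      - ((- \<mu> / \<rho> \<phi> - s + k \<phi> * \<rho> \<phi>) / ?D - (radial Q \<phi> - s) / \<omega>) * (\<rho> \<phi>)\<^sup>2) (at \<phi>)"
    unfolding \<rho>_def[abs_def] by (simp add: power2_eq_square)
  moreover have "(- \<mu> / \<rho> \<phi> - s + k \<phi> * \<rho> \<phi>) / ?D - (radial Q \<phi> - s) / \<omega> =
      (- \<mu> / \<rho> \<phi> - radial Q \<phi>) / ?D"
    using D r omega by (simp add: divide_simps k_def) (simp add: algebra_simps)
  ultimately have "(\<rho> has_real_derivative - ((- \<mu> / \<rho> \<phi> - radial Q \<phi>) / ?D) * (\<rho> \<phi>)\<^sup>2) (at \<phi>)"
    by (simp only:)
  moreover have "- ((- \<mu> / \<rho> \<phi> - radial Q \<phi>) / ?D) * (\<rho> \<phi>)\<^sup>2 =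
      (\<mu> * \<rho> \<phi> + radial Q \<phi> * (\<rho> \<phi>)\<^sup>2) / ?D"
    using D r by (simp add: divide_simps) (simp add: algebra_simps power2_eq_square)
  ultimately show ?thesis by (simp only:)
qed

lemma rho_per: "\<rho> (\<phi> + 2 * pi) = \<rho> \<phi>"
  by (simp add: \<rho>_def den_def z(2) per)

lemma rho_cont: "continuous_on A \<rho>"
  using rho_deriv by (meson DERIV_isCont continuous_at_imp_continuous_on)

text \<open>A signed measure of the distance from the orbit along the ray of angle
  \<open>\<theta>\<close>: zero exactly for \<open>r = \<rho> \<theta>\<close>, when
  \<open>0 < r \<le> R\<close>.\<close>

definition Z :: "real \<Rightarrow> real \<Rightarrow> real" where
  "Z \<theta> r = (1 / \<rho> \<theta> + h \<theta>) / (1 / r + h \<theta>) - 1"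

lemma one_plus_hr:
  assumes "0 \<le> r" "r \<le> R"
  shows "3 / 4 \<le> 1 + h \<theta> * r" "1 + h \<theta> * r \<le> 5 / 4"
  using small_coeff(1)[OF bounds(3), of r \<theta>] assms by (auto simp: abs_le_iff)

lemma Z_eq:
  assumes "0 < r" "r \<le> R"
  shows "Z \<theta> r = (r - \<rho> \<theta>) / (\<rho> \<theta> * (1 + h \<theta> * r))"
proof -
  have "1 + h \<theta> * r \<noteq> 0" using one_plus_hr(1)[of r \<theta>] assms by linarith
  moreover from this have "1 / r + h \<theta> = (1 + h \<theta> * r) / r" using assms by (simp add: field_simps)
  ultimately show ?thesis
    using rho_bounds(3)[of \<theta>] assms by (simp add: Z_def divide_simps) (simp add: algebra_simps)
qed

lemma Z_cong: "cos \<theta> = cos \<phi> \<Longrightarrow> sin \<theta> = sin \<phi> \<Longrightarrow> Z \<theta> r = Z \<phi> r"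
  by (rule periodic_cong_angle[of "\<lambda>\<theta>. Z \<theta> r"]) (simp_all add: Z_def rho_per per)

definition rate :: "real \<Rightarrow> real \<Rightarrow> real" where
  "rate \<theta> r = r * (- s * \<omega> + \<mu> * (h \<theta> * \<omega> + angular Q \<theta>) + (k \<theta> * \<omega> + \<mu> * (h \<theta> * angular Q \<theta>)) * (r + \<rho> \<theta>) +
     (k \<theta> * (h \<theta> * \<omega> + angular Q \<theta>) + s * (h \<theta> * angular Q \<theta>)) * (r * \<rho> \<theta>)) /
     ((1 + h \<theta> * r) * (\<omega> + angular Q \<theta> * \<rho> \<theta>))"

text \<open>The bracket in \<open>rate\<close> is \<open>- s * \<omega> + E\<close>, where the last
  condition on \<open>R\<close> bounds \<open>E\<close> by half of the main term; the factors below
  it lie between 3/4 and 5/4 after division by \<omega>.\<close>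

lemma rate_ge:
  assumes r: "0 < r" "r \<le> R"
  shows "- s * r / 4 \<le> rate \<theta> r"
proof -
  define W H k' p where "W = angular Q \<theta>" and "H = h \<theta>" and "k' = k \<theta>" and "p = \<rho> \<theta>"
  have b: "\<bar>W\<bar> \<le> C" "\<bar>H\<bar> \<le> C" "\<bar>k'\<bar> \<le> C"
    using bounds[of \<theta>] k_bound[of \<theta>] by (auto simp: W_def H_def k'_def)
  have p: "0 < p" "p \<le> R" using rho_bounds by (auto simp: p_def)
  define E where "E = \<mu> * (H * \<omega> + W) + (k' * \<omega> + \<mu> * (H * W)) * (r + p) + (k' * (H * \<omega> + W) + s * (H * W)) * (r * p)"
  have e: "\<bar>H * \<omega> + W\<bar> \<le> C * (\<bar>\<omega>\<bar> + 1)"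
  proof -
    have "\<bar>H * \<omega> + W\<bar> \<le> \<bar>H\<bar> * \<bar>\<omega>\<bar> + \<bar>W\<bar>" unfolding abs_mult[symmetric] by (rule abs_triangle_ineq)
    also have "\<dots> \<le> C * \<bar>\<omega>\<bar> + C" using b by (intro add_mono mult_right_mono) auto
    finally show ?thesis by (simp add: algebra_simps)
  qed
  have j: "\<bar>H * W\<bar> \<le> C\<^sup>2" unfolding abs_mult power2_eq_square using b C by (intro mult_mono) auto
  have E1: "\<bar>\<mu> * (H * \<omega> + W)\<bar> \<le> R * (C * (\<bar>\<omega>\<bar> + 1))"
    unfolding abs_mult[of \<mu>] using e mu(1) mu_R by (intro mult_mono) auto
  have "\<bar>k' * \<omega> + \<mu> * (H * W)\<bar> \<le> \<bar>k'\<bar> * \<bar>\<omega>\<bar> + \<bar>\<mu>\<bar> * \<bar>H * W\<bar>"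
    unfolding abs_mult[symmetric] by (rule abs_triangle_ineq)
  also have "\<dots> \<le> C * \<bar>\<omega>\<bar> + 1 * C\<^sup>2"
    using b j mu(1) mu_R R by (intro add_mono mult_mono) auto
  finally have "\<bar>(k' * \<omega> + \<mu> * (H * W)) * (r + p)\<bar> \<le> (C * \<bar>\<omega>\<bar> + C\<^sup>2) * (2 * R)"
    unfolding abs_mult[of _ "r + p"] using r p C by (intro mult_mono) auto
  then have E2: "\<bar>(k' * \<omega> + \<mu> * (H * W)) * (r + p)\<bar> \<le> R * (2 * (C * \<bar>\<omega>\<bar> + C\<^sup>2))"
    by (simp add: algebra_simps)
  have "\<bar>k' * (H * \<omega> + W) + s * (H * W)\<bar> \<le> \<bar>k'\<bar> * \<bar>H * \<omega> + W\<bar> + \<bar>s\<bar> * \<bar>H * W\<bar>"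
    unfolding abs_mult[symmetric] by (rule abs_triangle_ineq)
  also have "\<dots> \<le> C * (C * (\<bar>\<omega>\<bar> + 1)) + - s * C\<^sup>2"
    using b j e s C by (intro add_mono mult_mono) auto
  finally have 1: "\<bar>k' * (H * \<omega> + W) + s * (H * W)\<bar> \<le> C\<^sup>2 * (\<bar>\<omega>\<bar> + 1) - s * C\<^sup>2"
    by (simp add: power2_eq_square algebra_simps)
  have 2: "\<bar>r * p\<bar> \<le> R * 1" unfolding abs_mult using r p R by (intro mult_mono) auto
  have E3: "\<bar>(k' * (H * \<omega> + W) + s * (H * W)) * (r * p)\<bar> \<le> R * (C\<^sup>2 * (\<bar>\<omega>\<bar> + 1) - s * C\<^sup>2)"
  proof -
    have "0 \<le> C\<^sup>2 * (\<bar>\<omega>\<bar> + 1) - s * C\<^sup>2" using 1 abs_ge_zero order_trans by blast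
    from mult_mono[OF 1 2 this] show ?thesis by (simp add: abs_mult mult_ac)
  qed
  have "\<bar>E\<bar> \<le> R * (C * (\<bar>\<omega>\<bar> + 1) + 2 * (C * \<bar>\<omega>\<bar> + C\<^sup>2) + (C\<^sup>2 * (\<bar>\<omega>\<bar> + 1) - s * C\<^sup>2))"
    using E1 E2 E3 unfolding E_def distrib_left[of R] by linarith
  then have E: "\<bar>E\<bar> \<le> - s / 2 * \<bar>\<omega>\<bar>" using R(6) by linarith
  \<comment> \<open>Dividing numerator and denominator by \<omega> treats both directions of
    rotation at once.\<close>
  have B: "- s / 2 \<le> (- s * \<omega> + E) / \<omega>"
  proof -
    have "\<bar>E / \<omega>\<bar> \<le> - s / 2" using E omega by (simp add: abs_divide pos_divide_le_eq)
    moreover have "(- s * \<omega> + E) / \<omega> = - s + E / \<omega>" using omega by (simp add: add_divide_distrib diff_divide_distrib)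
    ultimately show ?thesis by linarith
  qed
  define q where "q = (\<omega> + W * p) / \<omega>"
  have q: "3 / 4 \<le> q" "q \<le> 5 / 4"
  proof -
    have "\<bar>W * p / \<omega>\<bar> \<le> 1 / 4"
      using small_coeff(2)[OF b(1), of p] p omega by (simp add: abs_divide pos_divide_le_eq)
    moreover have "q = 1 + W * p / \<omega>" using omega by (simp add: q_def add_divide_distrib)
    ultimately show "3 / 4 \<le> q" "q \<le> 5 / 4" by linarith+
  qed
  have P: "3 / 4 \<le> 1 + H * r" "1 + H * r \<le> 5 / 4" using one_plus_hr[of r \<theta>] r by (auto simp: H_def)
  have "\<omega> + W * p = \<omega> * q" using omega by (simp add: q_def)
  moreover have "rate \<theta> r = r * (- s * \<omega> + E) / ((1 + H * r) * (\<omega> + W * p))"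
    unfolding rate_def E_def W_def H_def k'_def p_def by (simp only: add.assoc)
  ultimately have rate_eq: "rate \<theta> r = r * (((- s * \<omega> + E) / \<omega>) / ((1 + H * r) * q))"
    by (simp add: mult_ac)
  \<comment> \<open>The resulting constant is 8/25, which is rounded down to 1/4 below.\<close>
  have "(- s / 2) / (5 / 4 * (5 / 4)) \<le> X / (Y * q)"
    if "- s / 2 \<le> X" "3 / 4 \<le> Y" "Y \<le> 5 / 4" for X Y
    using that s q by (intro frac_le mult_mono mult_pos_pos) auto
  from mult_left_mono[OF this[OF B P], of r]
  have "r * ((- s / 2) / (5 / 4 * (5 / 4))) \<le> rate \<theta> r" unfolding rate_eq using r by linarith
  moreover have "- s * r / 4 \<le> r * ((- s / 2) / (5 / 4 * (5 / 4)))"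
    using mult_pos_pos[OF r(1), of "- s"] s by (simp add: algebra_simps)
  ultimately show ?thesis by linarith
qed

text \<open>The orbit is evaluated at the current angle of the solution, not at the same time. Hence
  \<open>\<rho> (\<theta> t)\<close> moves with the angular speed belonging to \<open>r\<close>, and
  no phase drift enters.\<close>

lemma Z_deriv:
  assumes \<theta>: "(\<theta> has_real_derivative \<omega> + angular Q (\<theta> t) * r t) (at t within S)"
    and r: "(r has_real_derivative \<mu> * r t + radial Q (\<theta> t) * (r t)\<^sup>2) (at t within S)"
    and rR: "0 < r t" "r t \<le> R"
  shows "((\<lambda>t. Z (\<theta> t) (r t)) has_real_derivative - rate (\<theta> t) (r t) * Z (\<theta> t) (r t)) (at t within S)"
proof -
  let ?n = "(- \<mu> / \<rho> (\<theta> t) - s + k (\<theta> t) * \<rho> (\<theta> t)) / (\<omega> + angular Q (\<theta> t) * \<rho> (\<theta> t))"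
  have nz: "1 + h (\<theta> t) * r t \<noteq> 0" using one_plus_hr(1)[of "r t" "\<theta> t"] rR by linarith
  then have "1 / r t + h (\<theta> t) \<noteq> 0" using rR by (auto simp: field_simps)
  moreover have "((\<lambda>t. 1 / \<rho> (\<theta> t) + h (\<theta> t)) has_real_derivative ?n * (\<omega> + angular Q (\<theta> t) * r t)) (at t within S)"
    unfolding den_z(2) using DERIV_add[OF DERIV_const[of "- s / \<mu>"] DERIV_chain2[OF z_deriv \<theta>]] by (simp only: add_0_left)
  ultimately have "((\<lambda>t. Z (\<theta> t) (r t)) has_real_derivative
      (?n * (\<omega> + angular Q (\<theta> t) * r t) * (1 / r t + h (\<theta> t)) -
       (1 / \<rho> (\<theta> t) + h (\<theta> t)) * (- \<mu> / r t - s + k (\<theta> t) * r t)) /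
      ((1 / r t + h (\<theta> t)) * (1 / r t + h (\<theta> t))) - 0) (at t within S)"
    unfolding Z_def
    by (intro DERIV_diff DERIV_const DERIV_divide inverse_radius_deriv[where r = r and \<theta> = \<theta>, OF \<theta> r rR(1)])
  moreover have "\<omega> + angular Q (\<theta> t) * \<rho> (\<theta> t) \<noteq> 0"
    using small_coeff(2)[OF bounds(2)[of "\<theta> t"], of "\<rho> (\<theta> t)"] rho_bounds[of "\<theta> t"] omega by auto
  ultimately show ?thesis
    unfolding Z_def rate_def
    using gauge_identity[of "r t" "\<rho> (\<theta> t)" "h (\<theta> t)" \<omega> "angular Q (\<theta> t)" \<mu> s "k (\<theta> t)"] nz rR rho_bounds(3)[of "\<theta> t"]
    by simp
qed

text \<open>Away from the origin the chosen angle is determined up to multiples of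
  \<open>2 * pi\<close>, and \<open>Z\<close> is periodic in it, so the choice does not matter
  there.\<close>

definition gauge :: "plane \<Rightarrow> real" where
  "gauge x = \<bar>Z (SOME \<theta>. x = polar (norm x) \<theta>) (norm x)\<bar>"

lemma gauge_polar:
  assumes "0 < r"
  shows "gauge (polar r \<theta>) = \<bar>Z \<theta> r\<bar>"
proof -
  define \<phi> where "\<phi> = (SOME \<phi>. polar r \<theta> = polar r \<phi>)"
  have "polar r \<theta> = polar r \<phi>" unfolding \<phi>_def by (rule someI) simp
  from polar_eqD(2,3)[OF this assms less_imp_le[OF assms]] have "Z \<phi> r = Z \<theta> r"
    by (intro Z_cong) simp_all
  then show ?thesis using assms by (simp add: gauge_def \<phi>_def)
qed

text \<open>A lower bound \<open>a\<close> for the radius turns the rate into a constant. It will be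
  \<open>m / 4\<close> near the orbit, and the least radius over a period for an arbitrary periodic
  orbit.\<close>

lemma gauge_decay:
  assumes T: "0 \<le> T" and sol: "solves_on F x {0..T}" and a: "0 < a"
    and x: "\<And>t. t \<in> {0..T} \<Longrightarrow> a \<le> norm (x t) \<and> norm (x t) \<le> R"
  shows "gauge (x T) \<le> exp (- (- s * a / 4) * T) * gauge (x 0)"
proof -
  obtain \<theta>0 where x0: "x 0 = polar (norm (x 0)) \<theta>0" using polar_exists by metis
  have nx: "0 < norm (x t)" "x t \<noteq> 0" "norm (x t) \<le> 1" if "t \<in> {0..T}" for t
    using x[OF that] a R by auto
  obtain \<theta> where \<theta>: "\<theta> 0 = \<theta>0" "\<And>t. t \<in> {0..T} \<Longrightarrow> x t = polar (norm (x t)) (\<theta> t)"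
    "\<And>t. t \<in> {0..T} \<Longrightarrow> (\<theta> has_real_derivative \<omega> + angular Q (\<theta> t) * norm (x t)) (at t within {0..T})"
    "\<And>t. t \<in> {0..T} \<Longrightarrow> ((\<lambda>t. norm (x t)) has_real_derivative
      \<mu> * norm (x t) + radial Q (\<theta> t) * (norm (x t))\<^sup>2) (at t within {0..T})"
    using polar_solution[OF T sol _ x0] nx by blast
  have "\<bar>Z (\<theta> T) (norm (x T))\<bar> \<le> exp (- (- s * a / 4) * T) * \<bar>Z (\<theta> 0) (norm (x 0))\<bar>"
  proof (rule decay_within[OF T, where Z = "\<lambda>t. Z (\<theta> t) (norm (x t))" and g = "\<lambda>t. rate (\<theta> t) (norm (x t))"])
    fix t assume t: "t \<in> {0..T}"
    show "((\<lambda>t. Z (\<theta> t) (norm (x t))) has_vector_derivative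
        - rate (\<theta> t) (norm (x t)) * Z (\<theta> t) (norm (x t))) (at t within {0..T})"
      unfolding has_real_derivative_iff_has_vector_derivative[symmetric]
      by (rule Z_deriv[where r = "\<lambda>t. norm (x t)", OF \<theta>(3,4)[OF t]]) (use x[OF t] nx[OF t] in auto)
    have "- s * a \<le> - s * norm (x t)" using x[OF t] s by (intro mult_left_mono) auto
    then show "- s * a / 4 \<le> rate (\<theta> t) (norm (x t))"
      using rate_ge[of "norm (x t)" "\<theta> t"] x[OF t] nx[OF t] by linarith
  qed
  moreover have "gauge (x t) = \<bar>Z (\<theta> t) (norm (x t))\<bar>" if "t \<in> {0..T}" for t
    using gauge_polar[OF nx(1)[OF that], of "\<theta> t"] \<theta>(2)[OF that] by simp
  ultimately show ?thesis using T by simp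
qed

end

section \<open>Time parametrization and uniqueness of the periodic orbit\<close>

text \<open>The flow is the inverse of the time function \<open>\<integral> d\<phi> / q \<phi>\<close>.\<close>

lemma circle_flow:
  fixes q :: "real \<Rightarrow> real"
  assumes q: "continuous_on UNIV q" "\<And>\<phi>. q (\<phi> + 2 * pi) = q \<phi>" "\<And>\<phi>. 0 < q \<phi>"
  shows "\<exists>\<psi> T. 0 < T \<and> (\<forall>t. (\<psi> has_real_derivative q (\<psi> t)) (at t)) \<and>
    (\<forall>t. \<psi> (t + T) = \<psi> t + 2 * pi) \<and> surj \<psi>"
proof -
  have q0: "q \<phi> \<noteq> 0" for \<phi> using q(3)[of \<phi>] by simp
  obtain B where B: "\<And>x. \<bar>q x\<bar> \<le> B" using periodic_bounded[OF q(1,2)] by blast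
  have Bpos: "0 < B" using B[of 0] q(3)[of 0] by linarith
  have "continuous_on UNIV (\<lambda>x. 1 / q x)" using q0 by (intro continuous_intros q(1)) auto
  from antiderivative_exists[OF this] obtain \<tau> where \<tau>0: "\<tau> 0 = 0"
    and \<tau>: "\<And>x. (\<tau> has_real_derivative 1 / q x) (at x)"
    by (auto simp: has_real_derivative_iff_has_vector_derivative)
  have \<tau>_cont: "continuous_on A \<tau>" for A
    using \<tau> by (meson DERIV_isCont continuous_at_imp_continuous_on)
  \<comment> \<open>Growth at least linear gives both injectivity and surjectivity of the time
    function.\<close>
  have \<tau>_mono: "(y - x) / B \<le> \<tau> y - \<tau> x" if xy: "x < y" for x y
  proof -
    obtain c where c: "\<tau> y - \<tau> x = (y - x) * (1 / q c)" using MVT2[OF xy, of \<tau> "\<lambda>x. 1 / q x"] \<tau> by blast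
    have "1 / B \<le> 1 / q c" using B[of c] q(3)[of c] by (intro frac_le) auto
    then have "(y - x) * (1 / B) \<le> (y - x) * (1 / q c)" using that by (intro mult_left_mono) auto
    then show ?thesis by (simp add: c)
  qed
  have \<tau>_strict: "\<tau> x < \<tau> y" if "x < y" for x y
    using \<tau>_mono[OF that] divide_pos_pos[of "y - x" B] that Bpos by linarith
  then have inj: "inj \<tau>" by (metis linorder_injI less_irrefl)
  have surj: "\<exists>x. \<tau> x = t" for t
  proof -
    define y where "y = B * (\<bar>t\<bar> + 1)"
    have y: "0 < y" "y / B = \<bar>t\<bar> + 1" using Bpos by (auto simp: y_def)
    have "\<tau> (- y) \<le> t" "t \<le> \<tau> y"
      using \<tau>_mono[of "- y" 0] \<tau>_mono[of 0 y] y by (auto simp: \<tau>0)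
    then show ?thesis using IVT'[of \<tau> "- y" t y] \<tau>_cont y(1) by auto
  qed
  define \<psi> where "\<psi> = inv \<tau>"
  have \<psi>1: "\<psi> (\<tau> x) = x" for x unfolding \<psi>_def using inj by simp
  have \<psi>2: "\<tau> (\<psi> t) = t" for t using surj \<psi>1 by metis
  have "(\<psi> has_real_derivative q (\<psi> t)) (at t)" for t
  proof -
    have "(\<psi> has_derivative (*) (q (\<psi> t))) (at (\<tau> (\<psi> t)))"
      by (rule has_derivative_inverse_strong[where S = UNIV and f' = "(*) (1 / q (\<psi> t))"])
        (use \<tau> q0 \<psi>1 \<tau>_cont in \<open>auto simp: has_field_derivative_def fun_eq_iff\<close>)
    then show ?thesis by (simp add: \<psi>2 has_field_derivative_def)
  qed
  moreover have "\<psi> (t + \<tau> (2 * pi)) = \<psi> t + 2 * pi" for t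
  proof -
    \<comment> \<open>The time for a full turn does not depend on the starting angle, since
      \<open>1 / q\<close> is periodic.\<close>
    have "((\<lambda>x. \<tau> (x + 2 * pi) - \<tau> x) has_real_derivative 0) (at x)" for x
    proof -
      have "((\<lambda>x. \<tau> (x + 2 * pi)) has_real_derivative 1 / q (x + 2 * pi) * 1) (at x)"
        by (rule DERIV_chain2[OF \<tau>]) (auto intro!: derivative_eq_intros)
      from DERIV_diff[OF this \<tau>] show ?thesis by (simp add: q(2))
    qed
    from DERIV_isconst_all[OF allI[OF this], of "\<psi> t" 0]
    have "\<tau> (\<psi> t + 2 * pi) = t + \<tau> (2 * pi)" by (simp add: \<psi>2 \<tau>0)
    then show ?thesis using \<psi>1 by metis
  qed
  moreover have "0 < \<tau> (2 * pi)" using \<tau>_strict[of 0 "2 * pi"] by (simp add: \<tau>0)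
  moreover have "surj \<psi>" using \<psi>1 by (metis surjI)
  ultimately show ?thesis by blast
qed

context bifurcating_orbit begin

lemma ang_speed: "3 / 4 \<le> (\<omega> + angular Q \<phi> * \<rho> \<phi>) / \<omega>"
proof -
  have "\<bar>angular Q \<phi> * \<rho> \<phi> / \<omega>\<bar> \<le> 1 / 4"
    using small_coeff(2)[OF bounds(2)[of \<phi>], of "\<rho> \<phi>"] rho_bounds[of \<phi>] omega
    by (simp add: abs_divide pos_divide_le_eq)
  moreover have "(\<omega> + angular Q \<phi> * \<rho> \<phi>) / \<omega> = 1 + angular Q \<phi> * \<rho> \<phi> / \<omega>"
    using omega by (simp add: add_divide_distrib)
  ultimately show ?thesis by linarith
qed

lemma orbit_solution:
  "\<exists>x T. solves_on F x UNIV \<and> 0 < T \<and> (\<forall>t. x (t + T) = x t) \<and> (\<exists>t. x t \<noteq> x 0) \<and> orbit = range x"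
proof -
  \<comment> \<open>Division by \<omega> makes the speed positive for both directions of rotation;
    the solution is recovered at the rescaled time \<open>\<omega> * t\<close>.\<close>
  let ?q = "\<lambda>\<phi>. (\<omega> + angular Q \<phi> * \<rho> \<phi>) / \<omega>"
  have "continuous_on UNIV ?q" using omega by (intro continuous_intros cont rho_cont) auto
  moreover have "?q (\<phi> + 2 * pi) = ?q \<phi>" for \<phi> by (simp add: per rho_per)
  moreover have "0 < ?q \<phi>" for \<phi> using ang_speed[of \<phi>] by linarith
  ultimately obtain \<psi> T where T: "0 < T" and \<psi>: "\<And>t. (\<psi> has_real_derivative ?q (\<psi> t)) (at t)"
    "\<And>t. \<psi> (t + T) = \<psi> t + 2 * pi" "surj \<psi>"
    using circle_flow[of ?q] by blast
  define x where "x t = polar (\<rho> (\<psi> (\<omega> * t))) (\<psi> (\<omega> * t))" for t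
  have polar_per: "polar (\<rho> (\<phi> + 2 * pi)) (\<phi> + 2 * pi) = polar (\<rho> \<phi>) \<phi>" for \<phi>
    by (simp add: rho_per polar_def)
  have "x (t + T / \<bar>\<omega>\<bar>) = x t" for t
  proof (cases "\<omega> > 0")
    case True
    then have "\<omega> * (t + T / \<bar>\<omega>\<bar>) = \<omega> * t + T" by (simp add: field_simps)
    then show ?thesis unfolding x_def by (simp only: \<psi>(2) polar_per)
  next
    case False
    then have "\<omega> * (t + T / \<bar>\<omega>\<bar>) + T = \<omega> * t" using omega by (simp add: field_simps)
    from this[symmetric] show ?thesis unfolding x_def by (simp only: \<psi>(2) polar_per)
  qed
  moreover have "solves_on F x UNIV"
    unfolding solves_on_def
  proof
    fix t
    define \<phi> where "\<phi> = \<psi> (\<omega> * t)"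
    let ?w = "\<omega> + angular Q \<phi> * \<rho> \<phi>" and ?A = "\<mu> * \<rho> \<phi> + radial Q \<phi> * (\<rho> \<phi>)\<^sup>2"
    have w: "?w \<noteq> 0"
    proof
      assume "?w = 0"
      then have "?w / \<omega> = 0" by (simp only: div_0)
      then show False using ang_speed[of \<phi>] by linarith
    qed
    have p: "((\<lambda>t. \<psi> (\<omega> * t)) has_real_derivative ?w) (at t)"
      using DERIV_chain2[OF \<psi>(1), of "\<lambda>t. \<omega> * t" \<omega> t] omega
      by (auto intro!: derivative_eq_intros simp: \<phi>_def)
    have r: "((\<lambda>t. \<rho> (\<psi> (\<omega> * t))) has_real_derivative ?A) (at t)"
      using DERIV_chain2[OF rho_deriv p[folded \<phi>_def], folded \<phi>_def] w by (simp add: \<phi>_def)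
    have "((\<lambda>t. \<rho> (\<psi> (\<omega> * t)) * cos (\<psi> (\<omega> * t))) has_real_derivative ?A * cos \<phi> - \<rho> \<phi> * ?w * sin \<phi>) (at t)"
      by (rule DERIV_mult[OF r DERIV_chain2[OF DERIV_cos p], THEN DERIV_cong]) (simp add: \<phi>_def)
    moreover have "((\<lambda>t. \<rho> (\<psi> (\<omega> * t)) * sin (\<psi> (\<omega> * t))) has_real_derivative ?A * sin \<phi> + \<rho> \<phi> * ?w * cos \<phi>) (at t)"
      by (rule DERIV_mult[OF r DERIV_chain2[OF DERIV_sin p], THEN DERIV_cong]) (simp add: \<phi>_def)
    moreover have "F (x t) = (?A * cos \<phi> - \<rho> \<phi> * ?w * sin \<phi>, ?A * sin \<phi> + \<rho> \<phi> * ?w * cos \<phi>)"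
      using hfield_polar[of "\<rho> \<phi>" \<mu> \<phi>] rho_bounds(3)[of \<phi>] by (simp add: x_def \<phi>_def)
    ultimately show "(x has_vector_derivative F (x t)) (at t)"
      unfolding x_def[abs_def] polar_def has_real_derivative_iff_has_vector_derivative
      by (simp add: has_vector_derivative_Pair)
  qed
  moreover have range: "orbit = range x"
  proof -
    have "\<exists>t. \<psi> (\<omega> * t) = \<phi>" for \<phi>
    proof -
      obtain u where "\<psi> u = \<phi>" using \<psi>(3) by (metis surjD)
      then show ?thesis using omega by (intro exI[of _ "u / \<omega>"]) simp
    qed
    then show ?thesis unfolding orbit_def x_def by (auto simp: image_def) metis
  qed
  moreover have "\<exists>t. x t \<noteq> x 0"
  proof (rule ccontr)
    assume "\<not> (\<exists>t. x t \<noteq> x 0)"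
    then have "orbit = {x 0}" unfolding range by auto
    \<comment> \<open>Points of positive radius at opposite angles are different, so the solution is
      not constant.\<close>
    moreover have "polar (\<rho> 0) 0 \<in> orbit" "polar (\<rho> pi) pi \<in> orbit" unfolding orbit_def by (rule rangeI)+
    ultimately have "polar (\<rho> 0) 0 = polar (\<rho> pi) pi" by simp
    from polar_eqD(2)[OF this] rho_bounds(3) show False by (simp add: less_imp_le)
  qed
  moreover have "0 < T / \<bar>\<omega>\<bar>" using T omega by simp
  ultimately show ?thesis by blast
qed

lemma orbit_periodic: "periodic_orbit F orbit"
  using orbit_solution unfolding periodic_orbit_def by blast

lemma norm_orbit: "x \<in> orbit \<Longrightarrow> 2 / 3 * m \<le> norm x \<and> norm x \<le> 2 * m"
  unfolding orbit_def using rho_bounds by (auto simp: less_imp_le abs_of_pos)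

text \<open>Over one period the gauge shrinks by a factor below 1 and yet returns to its value, so
  it is 0. The solution thus meets the orbit, and uniqueness for the differential equation
  identifies the two ranges.\<close>

lemma orbit_unique:
  assumes po: "periodic_orbit F \<Gamma>" and \<Gamma>: "\<Gamma> \<subseteq> ball 0 R"
  shows "\<Gamma> = orbit"
proof -
  obtain x T where sol: "solves_on F x UNIV" and T: "T > 0" "\<And>t. x (t + T) = x t"
    and nc: "\<exists>t. x t \<noteq> x 0" and \<Gamma>x: "\<Gamma> = range x"
    using po unfolding periodic_orbit_def by blast
  have xR: "norm (x t) < R" for t using \<Gamma> \<Gamma>x by (metis mem_ball_0 rangeI subsetD)
  have x1: "norm (x t) \<le> 1" for t using xR[of t] R by linarith
  have nz: "x t \<noteq> 0" for t using nc periodic_orbit_avoids_0[OF sol x1] by blast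
  have solT: "solves_on F x {0..T}" by (rule solves_on_subset[OF sol]) simp
  \<comment> \<open>The least radius over a period is positive; it may be arbitrarily small, because
    any strict contraction suffices.\<close>
  have "\<exists>t0\<in>{0..T}. \<forall>t\<in>{0..T}. norm (x t0) \<le> norm (x t)"
    by (rule continuous_attains_inf)
      (use T solves_on_imp_continuous_on[OF solT] in \<open>auto intro!: continuous_intros\<close>)
  then obtain t0 where t0: "\<And>t. t \<in> {0..T} \<Longrightarrow> norm (x t0) \<le> norm (x t)" by blast
  define a where "a = norm (x t0)"
  have a: "0 < a" using nz by (simp add: a_def)
  have "gauge (x T) \<le> exp (- (- s * a / 4) * T) * gauge (x 0)"
    by (rule gauge_decay[OF less_imp_le[OF T(1)] solT a]) (use t0 xR in \<open>auto simp: a_def less_imp_le\<close>)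
  moreover have "x T = x 0" using T(2)[of 0] by simp
  moreover have "exp (- (- s * a / 4) * T) < 1"
    using mult_neg_pos[OF s a] T(1) by (simp add: mult_neg_pos)
  moreover have "0 \<le> gauge (x 0)" by (simp add: gauge_def)
  ultimately have g0: "gauge (x 0) = 0"
  proof -
    assume *: "gauge (x T) \<le> exp (- (- s * a / 4) * T) * gauge (x 0)" "x T = x 0"
      "exp (- (- s * a / 4) * T) < 1" "0 \<le> gauge (x 0)"
    show ?thesis
    proof (rule ccontr)
      assume "gauge (x 0) \<noteq> 0"
      then have "exp (- (- s * a / 4) * T) * gauge (x 0) < 1 * gauge (x 0)"
        using *(3,4) by (intro mult_strict_right_mono) auto
      then show False using *(1,2) by simp
    qed
  qed
  obtain \<theta> where x0: "x 0 = polar (norm (x 0)) \<theta>" using polar_exists by metis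
  have "Z \<theta> (norm (x 0)) = 0"
    using gauge_polar[of "norm (x 0)" \<theta>] x0 g0 nz[of 0] by simp
  moreover have "1 + h \<theta> * norm (x 0) > 0"
    using one_plus_hr(1)[of "norm (x 0)" \<theta>] xR[of 0] by simp
  ultimately have n0: "norm (x 0) = \<rho> \<theta>"
    using Z_eq[of "norm (x 0)" \<theta>] nz[of 0] xR[of 0] rho_bounds(3)[of \<theta>] by auto
  have "x 0 = polar (\<rho> \<theta>) \<theta>" by (subst x0) (simp only: n0)
  then have "x 0 \<in> orbit" by (simp add: orbit_def)
  moreover obtain y where y: "solves_on F y UNIV" "orbit = range y" using orbit_solution by blast
  ultimately obtain t1 where t1: "x 0 = y t1" by auto
  have y1: "norm (y t) \<le> 1" for t
  proof -
    have "y t \<in> orbit" by (simp add: y(2))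
    from norm_orbit[OF this] show ?thesis using m_pos R by linarith
  qed
  have xy: "(\<lambda>t. y (t + t1)) = x"
  proof (rule ode_unique[where f = "\<lambda>_. F" and S = "cball 0 1" and ?t0.0 = 0])
    fix t
    show "((\<lambda>t. y (t + t1)) has_vector_derivative F (y (t + t1))) (at t)"
      using y(1) by (intro has_vector_derivative_shift) (simp add: solves_on_def)
  qed (use sol x1 y1 t1 hfield_lipschitz in \<open>auto simp: solves_on_def\<close>)
  have "range x = range (\<lambda>t. y (t + t1))" by (simp only: xy)
  also have "\<dots> = y ` range (\<lambda>t. t + t1)" by (simp only: image_image)
  also have "range (\<lambda>t. t + t1) = UNIV" by (metis surj_plus_right)
  finally show ?thesis using \<Gamma>x y(2) by simp
qed

section \<open>Leading-order radius and stability of the orbit\<close>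

lemma orbit_compact: "compact orbit"
proof -
  have "polar (\<rho> \<phi>) \<phi> \<in> (\<lambda>\<phi>. polar (\<rho> \<phi>) \<phi>) ` {0..2 * pi}" for \<phi>
  proof -
    obtain t where t: "0 \<le> t" "t < 2 * pi" "cos \<phi> = cos t" "sin \<phi> = sin t"
      using sincos_total_2pi[of "cos \<phi>" "sin \<phi>"] by auto
    then have "\<rho> \<phi> = \<rho> t" using periodic_cong_angle[of \<rho>, OF rho_per] by blast
    then show ?thesis using t by (intro image_eqI[of _ _ t]) (auto simp: polar_def)
  qed
  then have "orbit = (\<lambda>\<phi>. polar (\<rho> \<phi>) \<phi>) ` {0..2 * pi}" by (auto simp: orbit_def)
  then show ?thesis unfolding polar_def
    by (auto intro!: compact_continuous_image continuous_intros rho_cont)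
qed

lemma orbit_nonempty: "orbit \<noteq> {}"
  by (simp add: orbit_def)

lemma polar_mem_orbit:
  assumes "0 \<le> r" "polar r \<theta> \<in> orbit"
  shows "r = \<rho> \<theta>"
proof -
  obtain \<phi> where p: "polar (\<rho> \<phi>) \<phi> = polar r \<theta>" using assms by (auto simp: orbit_def)
  note e = polar_eqD[OF this rho_bounds(3) assms(1)]
  then have "\<rho> \<phi> = \<rho> \<theta>" using periodic_cong_angle[of \<rho>, OF rho_per] by blast
  with e show ?thesis by simp
qed

lemma orbit_polar_radius: "polar_radius orbit \<phi> (\<rho> \<phi>)"
  using polar_mem_orbit rho_bounds(3)[of \<phi>]
  by (auto simp: polar_radius_def polar_def[symmetric] orbit_def)

text \<open>\<open>1 / \<rho> = 1 / m + y\<close> with \<open>\<bar>y\<bar> \<le> K + C\<close>, a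
  bound independent of \<mu>. Hence the error in \<open>\<rho>\<close> is of order
  \<open>m\<^sup>2\<close>, which is the quadratic error term of the theorem.\<close>

lemma rho_asymp: "\<bar>\<rho> \<phi> - m\<bar> \<le> 2 * (K + C) * m\<^sup>2"
proof -
  define y where "y = z \<phi> - h \<phi>"
  have y: "\<bar>y\<bar> \<le> K + C" using z(1)[of \<phi>] bounds(3)[of \<phi>] by (simp add: y_def)
  have my: "\<bar>m * y\<bar> \<le> 1 / 2"
  proof -
    have "\<bar>m * y\<bar> \<le> m * (K + C)" unfolding abs_mult using y m_pos(1) by (intro mult_mono) auto
    then show ?thesis using m_pos(4) by linarith
  qed
  have "den \<phi> (z \<phi>) = (1 + m * y) / m"
    unfolding den_def m_pos(3) y_def using m_pos(1) by (simp add: field_simps)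
  then have "\<rho> \<phi> = m / (1 + m * y)" by (simp add: \<rho>_def)
  moreover have "1 + m * y \<noteq> 0" using my by linarith
  ultimately have "\<rho> \<phi> - m = - (m\<^sup>2 * y) / (1 + m * y)"
    by (simp add: divide_simps) (simp add: algebra_simps power2_eq_square)
  moreover have "\<bar>1 + m * y\<bar> = 1 + m * y" using my by linarith
  ultimately have "\<bar>\<rho> \<phi> - m\<bar> = m\<^sup>2 * \<bar>y\<bar> / (1 + m * y)" by (simp add: abs_mult)
  also have "\<dots> \<le> m\<^sup>2 * (K + C) / (1 / 2)" using y my by (intro frac_le mult_left_mono) auto
  finally show ?thesis by (simp add: algebra_simps)
qed

lemma gauge_eq:
  assumes "x = polar (norm x) \<theta>" "0 < norm x" "norm x \<le> R"
  shows "gauge x = \<bar>norm x - \<rho> \<theta>\<bar> / (\<rho> \<theta> * (1 + h \<theta> * norm x))"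
  using gauge_polar[of "norm x" \<theta>] Z_eq[of "norm x" \<theta>] assms rho_bounds(3)[of \<theta>] one_plus_hr(1)[of "norm x" \<theta>]
  by (simp add: abs_mult)

lemma radius_deviation:
  assumes x: "x = polar (norm x) \<theta>" "0 < norm x" "norm x \<le> R"
  shows "\<bar>norm x - \<rho> \<theta>\<bar> \<le> 5 / 4 * \<rho> \<theta> * gauge x"
proof -
  define P where "P = 1 + h \<theta> * norm x"
  have P: "0 < P" "P \<le> 5 / 4" using one_plus_hr[of "norm x" \<theta>] x by (auto simp: P_def)
  have "\<bar>norm x - \<rho> \<theta>\<bar> = P * (\<rho> \<theta> * gauge x)"
    unfolding gauge_eq[OF x] P_def[symmetric] using rho_bounds(3)[of \<theta>] P by simp
  also have "\<dots> \<le> 5 / 4 * (\<rho> \<theta> * gauge x)"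
    using P rho_bounds(3)[of \<theta>] by (intro mult_right_mono) (auto simp: gauge_def)
  finally show ?thesis by simp
qed

text \<open>The constants fit together as follows: a gauge of at most 1/8 means a radial deviation
  of at most \<open>5/32 * \<rho>\<close>, and since \<open>\<rho>\<close> lies between
  \<open>2/3 * m\<close> and \<open>2 * m\<close>, the radius lies between \<open>m / 2\<close> and
  \<open>5/2 * m\<close>. In the larger open annulus the radius exceeds \<open>m / 4\<close>, which
  gives the decay rate.\<close>

lemma orbit_stable: "asymptotically_stable F orbit"
proof (rule asymptotically_stableI[OF hfield_lipschitz, where V = "{x. m / 4 < norm x \<and> norm x < 3 * m}"
      and K = "{x. m / 2 \<le> norm x \<and> norm x \<le> 5 / 2 * m}" and N = gauge and \<gamma> = "- s * (m / 4) / 4"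
      and \<eta> = "1 / 8" and C = "5 / 2 * m"])
  show "open {x::plane. m / 4 < norm x \<and> norm x < 3 * m}"
    by (intro open_Collect_conj open_Collect_less continuous_intros)
  show "closed {x::plane. m / 2 \<le> norm x \<and> norm x \<le> 5 / 2 * m}"
    by (intro closed_Collect_conj closed_Collect_le continuous_intros)
  show "{x::plane. m / 4 < norm x \<and> norm x < 3 * m} \<subseteq> cball 0 1" using m_pos(2) R(2) by auto
  show "{x. m / 2 \<le> norm x \<and> norm x \<le> 5 / 2 * m} \<subseteq> {x::plane. m / 4 < norm x \<and> norm x < 3 * m}"
    using m_pos(1) by auto
  show "0 < - s * (m / 4) / 4" using s m_pos(1) by (simp add: mult_neg_pos)
  show "0 \<le> gauge x" for x by (simp add: gauge_def)
  fix x :: "real \<Rightarrow> plane" and T :: real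
  assume T: "0 \<le> T" and sol: "solves_on F x {0..T}"
    and V: "x ` {0..T} \<subseteq> {x. m / 4 < norm x \<and> norm x < 3 * m}" and x0: "gauge (x 0) \<le> 1 / 8"
  have *: "m / 4 < norm (x t) \<and> norm (x t) < 3 * m" if "t \<in> {0..T}" for t using V that by blast
  have g: "gauge (x T) \<le> exp (- (- s * (m / 4) / 4) * T) * gauge (x 0)"
    by (rule gauge_decay[OF T sol]) (use * m_pos in \<open>auto simp: less_imp_le intro: order_trans[OF less_imp_le]\<close>)
  also have "\<dots> \<le> 1 * (1 / 8)"
    using x0 s m_pos(1) T by (intro mult_mono) (auto simp: gauge_def mult_le_0_iff)
  finally have g8: "gauge (x T) \<le> 1 / 8" by simp
  obtain \<theta> where \<theta>: "x T = polar (norm (x T)) \<theta>" using polar_exists by metis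
  have xT: "0 < norm (x T)" "norm (x T) \<le> R" using *[of T] T m_pos by auto
  have "\<bar>norm (x T) - \<rho> \<theta>\<bar> \<le> 5 / 4 * \<rho> \<theta> * (1 / 8)"
    using radius_deviation[OF \<theta> xT] mult_left_mono[OF g8, of "5 / 4 * \<rho> \<theta>"] rho_bounds(3)[of \<theta>] by linarith
  then have "m / 2 \<le> norm (x T)" "norm (x T) \<le> 5 / 2 * m"
    using rho_bounds[of \<theta>] m_pos(1) by linarith+
  with g show "x T \<in> {x. m / 2 \<le> norm x \<and> norm x \<le> 5 / 2 * m} \<and>
      gauge (x T) \<le> exp (- (- s * (m / 4) / 4) * T) * gauge (x 0)" by simp
next
  fix x :: plane assume x: "x \<in> {x. m / 2 \<le> norm x \<and> norm x \<le> 5 / 2 * m}"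
  obtain \<theta> where \<theta>: "x = polar (norm x) \<theta>" using polar_exists by metis
  have "x - polar (\<rho> \<theta>) \<theta> = polar (norm x - \<rho> \<theta>) \<theta>"
    by (subst \<theta>) (simp add: polar_def algebra_simps)
  then have "infdist x orbit \<le> \<bar>norm x - \<rho> \<theta>\<bar>"
    using infdist_le[of "polar (\<rho> \<theta>) \<theta>" orbit x] by (simp add: orbit_def dist_norm)
  also have "\<dots> \<le> 5 / 4 * \<rho> \<theta> * gauge x" by (rule radius_deviation[OF \<theta>]) (use x m_pos in auto)
  also have "\<dots> \<le> 5 / 4 * (2 * m) * gauge x"
    using rho_bounds[of \<theta>] by (intro mult_right_mono) (auto simp: gauge_def)
  finally show "infdist x orbit \<le> 5 / 2 * m * gauge x" by simp
next
  fix e :: real assume e: "0 < e"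
  \<comment> \<open>The first entry keeps the radius inside the closed annulus. The second gives a
    gauge of at most \<open>e\<close>, because the denominator in \<open>gauge_eq\<close> is at
    least \<open>m / 2\<close>.\<close>
  define c where "c = min (m / 8) (e * m / 2)"
  have c: "0 < c" "c \<le> m / 8" "c \<le> e * m / 2" using e m_pos(1) by (auto simp: c_def)
  \<comment> \<open>In the plane these pairs give a compact set disjoint from the orbit. Its
    positive distance converts closeness to the orbit as a set into closeness along the ray.\<close>
  define A where "A = {0..R} \<times> {0..2 * pi} \<inter> {p. c \<le> \<bar>fst p - \<rho> (snd p)\<bar>}"
  have "closed {p. c \<le> \<bar>fst p - \<rho> (snd p)\<bar>}"
    by (intro closed_Collect_le continuous_intros continuous_on_compose2[OF rho_cont[of UNIV]]) auto
  then have "compact A" unfolding A_def by (intro compact_Int_closed compact_Times) auto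
  then have "compact ((\<lambda>p. polar (fst p) (snd p)) ` A)"
    unfolding polar_def by (intro compact_continuous_image continuous_intros)
  moreover have "(\<lambda>p. polar (fst p) (snd p)) ` A \<inter> orbit = {}"
    using polar_mem_orbit c(1) by (fastforce simp: A_def)
  ultimately obtain d where d: "d > 0" "\<And>x y. x \<in> (\<lambda>p. polar (fst p) (snd p)) ` A \<Longrightarrow> y \<in> orbit \<Longrightarrow> d \<le> dist x y"
    using separate_compact_closed compact_imp_closed[OF orbit_compact] by metis
  have "x \<in> {x. m / 2 \<le> norm x \<and> norm x \<le> 5 / 2 * m} \<and> gauge x \<le> e" if x: "infdist x orbit < min d (m / 8)" for x
  proof -
    obtain y where y: "y \<in> orbit" "infdist x orbit = dist x y"
      using infdist_attains_inf[OF compact_imp_closed[OF orbit_compact] orbit_nonempty] by metis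
    have "norm x \<le> norm y + dist x y" by (metis add.commute dist_norm norm_triangle_sub)
    then have xR: "norm x \<le> R" using norm_orbit[OF y(1)] x y(2) m_pos by linarith
    obtain \<theta> where \<theta>: "0 \<le> \<theta>" "\<theta> < 2 * pi" "x = polar (norm x) \<theta>" using polar_exists by metis
    have xA: "x \<notin> (\<lambda>p. polar (fst p) (snd p)) ` A" using d(2)[OF _ y(1)] x y(2) by fastforce
    have dx: "\<bar>norm x - \<rho> \<theta>\<bar> < c"
    proof (rule ccontr)
      assume "\<not> \<bar>norm x - \<rho> \<theta>\<bar> < c"
      then have "(norm x, \<theta>) \<in> A" using \<theta> xR by (simp add: A_def)
      then have "polar (norm x) \<theta> \<in> (\<lambda>p. polar (fst p) (snd p)) ` A" by (rule rev_image_eqI) simp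
      then show False using xA \<theta>(3) by simp
    qed
    have b: "m / 2 \<le> norm x" "norm x \<le> 5 / 2 * m"
      using dx c(2) rho_bounds[of \<theta>] m_pos(1) by linarith+
    then have x0: "0 < norm x" using m_pos(1) by linarith
    have P: "3 / 4 \<le> 1 + h \<theta> * norm x" using one_plus_hr(1)[of "norm x" \<theta>] xR by simp
    have "2 / 3 * m * (3 / 4) \<le> \<rho> \<theta> * (1 + h \<theta> * norm x)"
      using rho_bounds[of \<theta>] P m_pos(1) by (intro mult_mono) auto
    then have "gauge x \<le> (e * m / 2) / (2 / 3 * m * (3 / 4))"
      unfolding gauge_eq[OF \<theta>(3) x0 xR] using dx c m_pos(1) by (intro frac_le) auto
    also have "\<dots> = e" using m_pos(1) by simp
    finally show ?thesis using b by simp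
  qed
  then show "\<exists>d>0. \<forall>x. infdist x orbit < d \<longrightarrow> x \<in> {x. m / 2 \<le> norm x \<and> norm x \<le> 5 / 2 * m} \<and> gauge x \<le> e"
    using d(1) m_pos(1) by (intro exI[of _ "min d (m / 8)"]) auto
qed (use m_pos in auto)

end

section \<open>The bifurcation\<close>

context homogeneous_field begin

lemma Q_circle_continuous: "continuous_on UNIV (\<lambda>\<phi>. Q (polar 1 \<phi>))"
proof (rule continuous_on_compose2[OF lipschitz_on_continuous_on[OF lip]])
  show "continuous_on UNIV (polar 1)" unfolding polar_def by (intro continuous_intros)
qed auto

lemma radial_continuous: "continuous_on UNIV (radial Q)"
  unfolding radial_def using Q_circle_continuous by (intro continuous_intros)

lemma angular_continuous: "continuous_on UNIV (angular Q)"
  unfolding angular_def using Q_circle_continuous by (intro continuous_intros)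

lemma radial_angular_periodic:
  "radial Q (\<phi> + 2 * pi) = radial Q \<phi>" "angular Q (\<phi> + 2 * pi) = angular Q \<phi>"
  by (simp_all add: radial_def angular_def polar_def)

text \<open>Subtracting the mean makes the integral of \<open>radial Q - s\<close> over a full turn
  vanish, and this is what makes the antiderivative \<open>h\<close> periodic.\<close>

lemma averaged_polar_exists:
  assumes s: "s < 0" and mean: "(radial Q has_integral 2 * pi * s) {0..2 * pi}"
  shows "\<exists>C h. averaged_polar \<omega> s C (radial Q) (angular Q) h"
proof -
  have "continuous_on UNIV (\<lambda>\<phi>. (radial Q \<phi> - s) / \<omega>)"
    using omega by (intro continuous_intros radial_continuous) auto
  from antiderivative_exists[OF this] obtain h where h0: "h 0 = 0"
    and h: "\<And>\<phi>. (h has_real_derivative (radial Q \<phi> - s) / \<omega>) (at \<phi>)"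
    by (auto simp: has_real_derivative_iff_has_vector_derivative)
  have "((\<lambda>\<phi>. (radial Q \<phi> - s) / \<omega>) has_integral h (2 * pi) - h 0) {0..2 * pi}"
    using h by (intro fundamental_theorem_of_calculus)
      (auto simp: has_real_derivative_iff_has_vector_derivative intro: has_vector_derivative_at_within)
  moreover have "((\<lambda>\<phi>. (radial Q \<phi> - s) / \<omega>) has_integral (2 * pi * s - (2 * pi - 0) * s) / \<omega>) {0..2 * pi}"
    by (intro has_integral_divide has_integral_diff mean)
      (use has_integral_const_real[of s 0 "2 * pi"] in simp)
  ultimately have "h (2 * pi) - h 0 = (2 * pi * s - (2 * pi - 0) * s) / \<omega>"
    by (rule has_integral_unique)
  then have h2pi: "h (2 * pi) = h 0" by simp
  have h_per: "h (\<phi> + 2 * pi) = h \<phi>" for \<phi>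
  proof -
    have "((\<lambda>x. h (x + 2 * pi) - h x) has_real_derivative 0) (at x)" for x
    proof -
      have "((\<lambda>x. h (x + 2 * pi)) has_real_derivative (radial Q (x + 2 * pi) - s) / \<omega> * 1) (at x)"
        by (rule DERIV_chain2[OF h]) (auto intro!: derivative_eq_intros)
      from DERIV_diff[OF this h] show ?thesis by (simp add: radial_angular_periodic)
    qed
    from DERIV_isconst_all[OF allI[OF this], of \<phi> 0] h2pi show ?thesis by simp
  qed
  have h_cont: "continuous_on UNIV h"
    using h by (meson DERIV_isCont continuous_at_imp_continuous_on)
  define k where "k \<phi> = (radial Q \<phi> - s) * angular Q \<phi> / \<omega>" for \<phi>
  have k: "continuous_on UNIV k" "\<And>\<phi>. k (\<phi> + 2 * pi) = k \<phi>"
    unfolding k_def using omega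
    by (auto simp: radial_angular_periodic intro!: continuous_intros radial_continuous angular_continuous)
  obtain B1 where B1: "\<And>\<phi>. \<bar>radial Q \<phi>\<bar> \<le> B1"
    using periodic_bounded[OF radial_continuous radial_angular_periodic(1)] by blast
  obtain B2 where B2: "\<And>\<phi>. \<bar>angular Q \<phi>\<bar> \<le> B2"
    using periodic_bounded[OF angular_continuous radial_angular_periodic(2)] by blast
  obtain B3 where B3: "\<And>\<phi>. \<bar>h \<phi>\<bar> \<le> B3" using periodic_bounded[OF h_cont h_per] by blast
  obtain B4 where B4: "\<And>\<phi>. \<bar>k \<phi>\<bar> \<le> B4" using periodic_bounded[OF k] by blast
  define C where "C = Max {1, B1, B2, B3, B4}"
  have "1 \<le> C" "B1 \<le> C" "B2 \<le> C" "B3 \<le> C" "B4 \<le> C" by (auto simp: C_def)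
  then have bd: "1 \<le> C" "\<bar>radial Q \<phi>\<bar> \<le> C" "\<bar>angular Q \<phi>\<bar> \<le> C" "\<bar>h \<phi>\<bar> \<le> C" "\<bar>k \<phi>\<bar> \<le> C" for \<phi>
    using B1[of \<phi>] B2[of \<phi>] B3[of \<phi>] B4[of \<phi>] by linarith+
  have "averaged_polar \<omega> s C (radial Q) (angular Q) h"
    by unfold_locales
      (fact omega s bd bd[unfolded k_def] radial_continuous angular_continuous radial_angular_periodic h_per h)+
  then show ?thesis by blast
qed

text \<open>The quantifier order matters: \<open>R\<close> and \<open>A\<close> are fixed before
  \<mu>, so the neighborhood of uniqueness and the error constant are uniform along the
  branch.\<close>

lemma Hopf_branch:
  assumes s: "s < 0" and mean: "(radial Q has_integral 2 * pi * s) {0..2 * pi}"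
  shows "\<exists>R \<mu>0 A. 0 < R \<and> 0 < \<mu>0 \<and>
    (\<forall>\<mu>\<le>0. \<forall>\<Gamma>\<subseteq>ball 0 R. \<not> periodic_orbit (hfield \<omega> Q \<mu>) \<Gamma>) \<and>
    (\<forall>\<mu>. 0 < \<mu> \<longrightarrow> \<mu> < \<mu>0 \<longrightarrow> (\<exists>\<Gamma> r. (\<forall>\<Gamma>'. periodic_orbit (hfield \<omega> Q \<mu>) \<Gamma>' \<and> \<Gamma>' \<subseteq> ball 0 R \<longleftrightarrow> \<Gamma>' = \<Gamma>) \<and>
      0 < r \<and> polar_radius \<Gamma> 0 r \<and> \<bar>r + \<mu> / s\<bar> \<le> A * \<mu>\<^sup>2 \<and> \<Gamma> \<subseteq> cball 0 (A * \<mu>) \<and>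
      compact \<Gamma> \<and> asymptotically_stable (hfield \<omega> Q \<mu>) \<Gamma>))"
proof -
  obtain C h where ap: "averaged_polar \<omega> s C (radial Q) (angular Q) h"
    using averaged_polar_exists[OF assms] by blast
  interpret averaged_polar \<omega> s C "radial Q" "angular Q" h by (rule ap)
  define w where "w = \<bar>\<omega>\<bar>"
  have w: "0 < w" using omega by (simp add: w_def)
  define E where "E = C * (w + 1) + 2 * (C * w + C\<^sup>2) + (C\<^sup>2 * (w + 1) - s * C\<^sup>2)"
  have E: "0 < E"
  proof -
    have pos: "0 < C * (w + 1)" "0 < C * w" "0 \<le> C\<^sup>2" "0 \<le> C\<^sup>2 * (w + 1)" "s * C\<^sup>2 \<le> 0"
      using C w s by (simp_all add: mult_nonpos_nonneg)
    have "0 < x + 2 * (y + z) + (u - v)" if "0 < x" "0 < y" "0 \<le> z" "0 \<le> u" "v \<le> 0" for x y z u v :: real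
      using that by (intro add_pos_nonneg) auto
    from this[OF pos] show ?thesis by (simp only: E_def)
  qed
  \<comment> \<open>The entries are the conditions of \<open>averaged_field\<close> solved for
    \<open>R\<close>.\<close>
  define R where "R = Min {1, 1 / (4 * C), w / (4 * C), - s / (2 * C), - s * w / (2 * E)}"
  have "0 < R" using C w s E by (auto simp: R_def divide_neg_pos mult_neg_pos)
  moreover have R': "R \<le> 1" "R \<le> 1 / (4 * C)" "R \<le> w / (4 * C)" "R \<le> - s / (2 * C)" "R \<le> - s * w / (2 * E)"
    unfolding R_def by (rule Min_le; simp)+
  have le_div: "x * b \<le> a" if "x \<le> a / b" "0 < b" for x a b :: real
    using that by (simp add: pos_le_divide_eq)
  have "4 * C * R \<le> 1" "4 * C * R \<le> w" "2 * C * R \<le> - s" "2 * R * E \<le> - s * w"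
    using le_div[OF R'(2)] le_div[OF R'(3)] le_div[OF R'(4)] le_div[OF R'(5)] C E by (simp_all add: mult_ac)
  ultimately have af: "averaged_field \<omega> L Q s C h R"
    unfolding averaged_field_def averaged_field_axioms_def
    using ap homogeneous_field_axioms R'(1) by (simp add: w_def E_def)
  interpret averaged_field \<omega> L Q s C h R by (rule af)
  \<comment> \<open>The first two entries place the orbit well inside the disc already chosen; the
    other two are the conditions of \<open>periodic_amplitude\<close> solved for \<mu>.\<close>
  define \<mu>0 where "\<mu>0 = Min {R, R * - s / 3, - s / (2 * (K + C)), w * - s / (8 * C)}"
  have KC: "0 < K + C" using K_ge C by linarith
  have mu0: "0 < \<mu>0" using \<open>0 < R\<close> s KC w C
    by (auto simp: \<mu>0_def divide_neg_pos mult_pos_neg)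
  have mu0': "\<mu>0 \<le> R" "\<mu>0 \<le> R * - s / 3" "\<mu>0 \<le> - s / (2 * (K + C))" "\<mu>0 \<le> w * - s / (8 * C)"
    unfolding \<mu>0_def by (rule Min_le; simp)+
  \<comment> \<open>The first entry is the constant of \<open>rho_asymp\<close> with
    \<open>m\<^sup>2 = \<mu>\<^sup>2 / s\<^sup>2\<close>, the second bounds the size
    \<open>2 * m\<close> of the orbit.\<close>
  define A where "A = max (2 * (K + C) / s\<^sup>2) (- 2 / s)"
  have branch: "\<exists>\<Gamma> r. (\<forall>\<Gamma>'. periodic_orbit (hfield \<omega> Q \<mu>) \<Gamma>' \<and> \<Gamma>' \<subseteq> ball 0 R \<longleftrightarrow> \<Gamma>' = \<Gamma>) \<and>
      0 < r \<and> polar_radius \<Gamma> 0 r \<and> \<bar>r + \<mu> / s\<bar> \<le> A * \<mu>\<^sup>2 \<and> \<Gamma> \<subseteq> cball 0 (A * \<mu>) \<and>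
      compact \<Gamma> \<and> asymptotically_stable (hfield \<omega> Q \<mu>) \<Gamma>"
    if mu: "0 < \<mu>" "\<mu> < \<mu>0" for \<mu>
  proof -
    have cond: "2 * \<mu> * (K + C) \<le> - s" "8 * C * \<mu> \<le> w * - s" "3 * \<mu> \<le> R * - s"
    proof -
      have "\<mu> \<le> - s / (2 * (K + C))" using mu mu0' by linarith
      from le_div[OF this] show "2 * \<mu> * (K + C) \<le> - s" using KC by (simp add: mult_ac)
      have "\<mu> \<le> w * - s / (8 * C)" using mu mu0' by linarith
      from le_div[OF this] show "8 * C * \<mu> \<le> w * - s" using C by (simp add: mult_ac)
      show "3 * \<mu> \<le> R * - s" using mu mu0' by linarith
    qed
    have pa: "periodic_amplitude \<omega> s C (radial Q) (angular Q) h \<mu>"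
      unfolding periodic_amplitude_def periodic_amplitude_axioms_def using ap mu cond(1,2) by (simp add: w_def)
    have "3 * \<mu> / - s \<le> R" by (rule iffD2[OF pos_divide_le_eq cond(3)]) (use s in simp)
    then have mR: "3 * (- \<mu> / s) \<le> R" by simp
    interpret periodic_amplitude \<omega> s C "radial Q" "angular Q" h \<mu> by (rule pa)
    obtain z where z: "\<And>\<phi>. \<bar>z \<phi>\<bar> \<le> K" "\<And>\<phi>. z (\<phi> + 2 * pi) = z \<phi>"
      "\<And>\<phi>. (z has_real_derivative (- \<mu> * z \<phi> + \<mu> * h \<phi> + k \<phi> / den \<phi> (z \<phi>)) /
        (\<omega> + angular Q \<phi> / den \<phi> (z \<phi>))) (at \<phi>)"
      using periodic_amplitude by blast
    have "\<mu> \<le> R" using \<open>\<mu> < \<mu>0\<close> mu0'(1) by linarith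
    interpret bifurcating_orbit \<omega> L Q s C h R \<mu> z
      by unfold_locales (fact z mR \<open>\<mu> \<le> R\<close>)+
    have sub: "orbit \<subseteq> ball 0 R"
      using norm_orbit m_pos by fastforce
    have m2: "m\<^sup>2 = \<mu>\<^sup>2 / s\<^sup>2" by (simp add: m_def power_divide)
    show ?thesis
    proof (intro exI[of _ orbit] exI[of _ "\<rho> 0"] conjI allI)
      fix \<Gamma>' show "periodic_orbit (hfield \<omega> Q \<mu>) \<Gamma>' \<and> \<Gamma>' \<subseteq> ball 0 R \<longleftrightarrow> \<Gamma>' = orbit"
        using orbit_unique orbit_periodic sub by blast
    next
      have "\<bar>\<rho> 0 + \<mu> / s\<bar> \<le> 2 * (K + C) / s\<^sup>2 * \<mu>\<^sup>2"
        using rho_asymp[of 0] unfolding m2 by (simp add: m_def)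
      also have "\<dots> \<le> A * \<mu>\<^sup>2" by (intro mult_right_mono) (auto simp: A_def)
      finally show "\<bar>\<rho> 0 + \<mu> / s\<bar> \<le> A * \<mu>\<^sup>2" .
      have "2 * m \<le> A * \<mu>"
      proof -
        have "2 * m = - 2 / s * \<mu>" by (simp add: m_def)
        also have "\<dots> \<le> A * \<mu>" using mu by (intro mult_right_mono) (auto simp: A_def)
        finally show ?thesis .
      qed
      then show "orbit \<subseteq> cball 0 (A * \<mu>)" using norm_orbit by force
    qed (rule rho_bounds orbit_polar_radius orbit_compact orbit_stable)+
  qed
  show ?thesis
  proof (rule exI[of _ R], rule exI[of _ \<mu>0], rule exI[of _ A], intro conjI allI impI)
    show "0 < R" "0 < \<mu>0" by fact+
    show "\<not> periodic_orbit (hfield \<omega> Q \<mu>) \<Gamma>" if "\<mu> \<le> 0" "\<Gamma> \<subseteq> ball 0 R" for \<mu> \<Gamma>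
      using no_periodic_orbit that by blast
  qed (rule branch)
qed

end

lemma homogeneous_field_reverse:
  assumes "homogeneous_field \<omega> L Q"
  shows "homogeneous_field (- \<omega>) L (\<lambda>x. - Q x)"
  using assms by (simp add: homogeneous_field_def)

lemma hfield_reverse: "hfield (- \<omega>) (\<lambda>x. - Q x) (- \<mu>) = (\<lambda>p. - hfield \<omega> Q \<mu> p)"
  by (rule ext) (simp add: hfield_def)

lemma radial_reverse: "radial (\<lambda>x. - Q x) = (\<lambda>\<phi>. - radial Q \<phi>)"
  by (rule ext) (simp add: radial_def)

text \<open>For \<open>s > 0\<close> the field \<open>- F (- \<mu>)\<close> has the same orbits traversed backwards and its
  averaged coefficient is \<open>- s\<close>; both signs are treated at once through \<open>d = - sgn s\<close>.\<close>

theorem homogeneous_Hopf: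
  assumes hf: "homogeneous_field \<omega> L Q" and s: "s \<noteq> 0"
    and mean: "(radial Q has_integral 2 * pi * s) {0..2 * pi}"
  defines "F \<equiv> hfield \<omega> Q"
  shows "\<exists>I U r0. open I \<and> is_interval I \<and> 0 \<in> I \<and> open U \<and> 0 \<in> U \<and>
    degenerate_Hopf F I U r0 (- 1 / s) \<and>
    (s > 0 \<longrightarrow> subcritical F I U) \<and>
    (s < 0 \<longrightarrow> supercritical F I U) \<and>
    (\<forall>\<mu>\<in>I. \<forall>\<Gamma>. local_periodic_orbit F U \<mu> \<Gamma> \<longrightarrow>
       (\<mu> > 0 \<longrightarrow> asymptotically_stable (F \<mu>) \<Gamma>) \<and>
       (\<mu> < 0 \<longrightarrow> unstable (F \<mu>) \<Gamma>)) \<and>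
    (\<forall>\<mu>\<in>I. (\<mu> > 0 \<longrightarrow> unstable (F \<mu>) {0}) \<and>
       (\<mu> < 0 \<longrightarrow> asymptotically_stable (F \<mu>) {0}))"
proof -
  define d where "d = - sgn s"
  have d: "d = 1 \<and> s < 0 \<or> d = - 1 \<and> s > 0" using s by (auto simp: d_def sgn_if)
  then have dd: "d * d = 1" "\<bar>d\<bar> = 1" by auto
  \<comment> \<open>For \<open>d = - 1\<close> both time and parameter are reversed, so the linear
    part keeps the coefficient \<mu> while the mean becomes \<open>- \<bar>s\<bar>\<close>.\<close>
  define G where "G \<mu> = (\<lambda>p. d *\<^sub>R F (d * \<mu>) p)" for \<mu>
  obtain \<omega>' Q' where hf': "homogeneous_field \<omega>' L Q'" and G: "G = hfield \<omega>' Q'"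
    and mean': "(radial Q' has_integral 2 * pi * - \<bar>s\<bar>) {0..2 * pi}"
  proof (cases "s < 0")
    case True
    then have "G = hfield \<omega> Q" using d by (auto simp: G_def F_def)
    then show ?thesis using that[of \<omega> Q] hf mean True by simp
  next
    case False
    then have "d = - 1" using d by auto
    then have "G = hfield (- \<omega>) (\<lambda>x. - Q x)"
      using hfield_reverse[of \<omega> Q "- \<mu>" for \<mu>] by (auto simp: G_def F_def fun_eq_iff)
    moreover have "(radial (\<lambda>x. - Q x) has_integral 2 * pi * - \<bar>s\<bar>) {0..2 * pi}"
      unfolding radial_reverse using has_integral_neg[OF mean] False s by simp
    ultimately show ?thesis using that homogeneous_field_reverse[OF hf] by blast
  qed
  have "- \<bar>s\<bar> < 0" using s by simp
  from homogeneous_field.Hopf_branch[OF hf' this mean']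
  obtain R \<mu>0 A where R: "0 < R" and mu0: "0 < \<mu>0"
    and none: "\<And>\<mu> \<Gamma>. \<mu> \<le> 0 \<Longrightarrow> \<Gamma> \<subseteq> ball 0 R \<Longrightarrow> \<not> periodic_orbit (G \<mu>) \<Gamma>"
    and branch: "\<And>\<mu>. 0 < \<mu> \<Longrightarrow> \<mu> < \<mu>0 \<Longrightarrow> \<exists>\<Gamma> r. (\<forall>\<Gamma>'. periodic_orbit (G \<mu>) \<Gamma>' \<and> \<Gamma>' \<subseteq> ball 0 R \<longleftrightarrow> \<Gamma>' = \<Gamma>) \<and>
      0 < r \<and> polar_radius \<Gamma> 0 r \<and> \<bar>r + \<mu> / - \<bar>s\<bar>\<bar> \<le> A * \<mu>\<^sup>2 \<and> \<Gamma> \<subseteq> cball 0 (A * \<mu>) \<and>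
      compact \<Gamma> \<and> asymptotically_stable (G \<mu>) \<Gamma>"
    unfolding G[symmetric] by metis
  from branch obtain \<Gamma>b rb where b: "\<And>\<mu> \<Gamma>'. 0 < \<mu> \<Longrightarrow> \<mu> < \<mu>0 \<Longrightarrow> periodic_orbit (G \<mu>) \<Gamma>' \<and> \<Gamma>' \<subseteq> ball 0 R \<longleftrightarrow> \<Gamma>' = \<Gamma>b \<mu>"
    and b2: "\<And>\<mu>. 0 < \<mu> \<Longrightarrow> \<mu> < \<mu>0 \<Longrightarrow> 0 < rb \<mu> \<and> polar_radius (\<Gamma>b \<mu>) 0 (rb \<mu>) \<and> \<bar>rb \<mu> + \<mu> / - \<bar>s\<bar>\<bar> \<le> A * \<mu>\<^sup>2 \<and>
      \<Gamma>b \<mu> \<subseteq> cball 0 (A * \<mu>) \<and> compact (\<Gamma>b \<mu>) \<and> asymptotically_stable (G \<mu>) (\<Gamma>b \<mu>)"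
    by metis
  have G_F: "periodic_orbit (G (d * \<mu>)) \<Gamma> \<longleftrightarrow> periodic_orbit (F \<mu>) \<Gamma>" for \<mu> \<Gamma>
    using d periodic_orbit_reverse[of "F \<mu>" \<Gamma>] periodic_orbit_reverse[of "\<lambda>p. - F \<mu> p" \<Gamma>]
    by (auto simp: G_def)
  define I where "I = {- \<mu>0<..<\<mu>0}"
  define U where "U = ball (0::plane) R"
  define c where "c = - 1 / s"
  define r0 where "r0 \<mu> = rb (d * \<mu>)" for \<mu>
  have c: "c = d / \<bar>s\<bar>" using d by (auto simp: c_def)
  have c_pos: "c * \<mu> > 0 \<longleftrightarrow> d * \<mu> > 0" for \<mu> using s by (simp add: c zero_less_divide_iff)
  have dI: "d * \<mu> < \<mu>0" if "\<mu> \<in> I" for \<mu> using that d by (auto simp: I_def)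
  \<comment> \<open>Existence, uniqueness and the side of the bifurcation are all read off from this
    description of the orbits of \<open>F\<close> in \<open>U\<close>.\<close>
  have lpo: "local_periodic_orbit F U \<mu> \<Gamma> \<longleftrightarrow> d * \<mu> > 0 \<and> \<Gamma> = \<Gamma>b (d * \<mu>)" if "\<mu> \<in> I" for \<mu> \<Gamma>
  proof (cases "d * \<mu> > 0")
    case True
    then show ?thesis using b[OF True dI[OF that], of \<Gamma>] G_F by (simp add: local_periodic_orbit_def U_def)
  next
    case False
    then show ?thesis using none[of "d * \<mu>" \<Gamma>] G_F by (auto simp: local_periodic_orbit_def U_def)
  qed
  note bI = b2[OF _ dI]
  have A: "0 \<le> A"
  proof -
    have "0 \<le> A * (\<mu>0 / 2)\<^sup>2" using b2[of "\<mu>0 / 2"] mu0 by force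
    then show ?thesis using mu0 by (simp add: zero_le_mult_iff)
  qed
  have F0: "F \<mu> 0 = 0" for \<mu> unfolding F_def by (rule homogeneous_field.hfield_0[OF hf])
  have est: "\<bar>r0 \<mu> - c * \<mu>\<bar> \<le> A * \<mu>\<^sup>2" if "\<mu> \<in> I" "c * \<mu> > 0" for \<mu>
  proof -
    have "d * \<mu> > 0" using that c_pos by simp
    from bI[OF this that(1)] have "\<bar>rb (d * \<mu>) + d * \<mu> / - \<bar>s\<bar>\<bar> \<le> A * (d * \<mu>)\<^sup>2" by blast
    moreover have "(d * \<mu>)\<^sup>2 = \<mu>\<^sup>2" using dd by (simp add: power_mult_distrib power2_eq_square)
    ultimately show ?thesis by (simp add: r0_def c)
  qed
  have "degenerate_Hopf F I U r0 c"
    unfolding degenerate_Hopf_def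
  proof (intro conjI ballI allI impI)
    show "c \<noteq> 0" using s by (simp add: c_def)
    show "F \<mu> 0 = 0" for \<mu> by (rule F0)
    show "\<exists>!\<Gamma>. local_periodic_orbit F U \<mu> \<Gamma>" if "\<mu> \<in> I" "c * \<mu> > 0" for \<mu>
      using lpo[OF that(1)] that(2) c_pos by simp
    show "\<not> (\<exists>\<Gamma>. local_periodic_orbit F U \<mu> \<Gamma>)" if "\<mu> \<in> I" "c * \<mu> \<le> 0" for \<mu>
      using lpo[OF that(1)] that(2) c_pos[of \<mu>] by simp
    show "0 < r0 \<mu>" "polar_radius \<Gamma> 0 (r0 \<mu>)" if "\<mu> \<in> I" "local_periodic_orbit F U \<mu> \<Gamma>" for \<mu> \<Gamma>
      using lpo[OF that(1)] that bI[of \<mu>] by (auto simp: r0_def)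
    fix \<epsilon> :: real assume \<epsilon>: "0 < \<epsilon>"
    show "\<exists>\<delta>>0. \<forall>\<mu>\<in>I. \<bar>\<mu>\<bar> < \<delta> \<longrightarrow> (\<forall>\<Gamma>. local_periodic_orbit F U \<mu> \<Gamma> \<longrightarrow> \<Gamma> \<subseteq> ball 0 \<epsilon>)"
    proof (intro exI[of _ "\<epsilon> / (A + 1)"] conjI ballI allI impI)
      fix \<mu> \<Gamma> assume mu: "\<mu> \<in> I" "\<bar>\<mu>\<bar> < \<epsilon> / (A + 1)" and \<Gamma>: "local_periodic_orbit F U \<mu> \<Gamma>"
      from lpo[OF mu(1)] \<Gamma> have dm: "d * \<mu> > 0" "\<Gamma> = \<Gamma>b (d * \<mu>)" by auto
      have "d * \<mu> = \<bar>\<mu>\<bar>" using dm(1) d by auto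
      have "A * (d * \<mu>) \<le> (A + 1) * \<bar>\<mu>\<bar>" using A \<open>d * \<mu> = \<bar>\<mu>\<bar>\<close> by (intro mult_mono) auto
      also have "\<dots> < \<epsilon>" using mu(2) A by (simp add: pos_less_divide_eq mult.commute)
      finally show "\<Gamma> \<subseteq> ball 0 \<epsilon>" using bI[OF dm(1) mu(1)] dm(2) by force
    qed (use A \<epsilon> in auto)
  next
    show "(\<lambda>\<mu>. r0 \<mu> - c * \<mu>) \<in> O[at 0 within {\<mu> \<in> I. c * \<mu> > 0}](\<lambda>\<mu>. \<mu>\<^sup>2)"
      by (rule bigoI[of _ A]) (use est in \<open>auto simp: eventually_at_filter\<close>)
  qed
  moreover have stab0: "asymptotically_stable (F \<mu>) {0}" if "\<mu> < 0" for \<mu>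
    unfolding F_def by (rule homogeneous_field.origin_stable[OF hf that])
  moreover have unst0: "unstable (F \<mu>) {0}" if "\<mu> > 0" for \<mu>
  proof (rule unstable_of_asymptotically_stable_reverse)
    show "asymptotically_stable (\<lambda>p. - F \<mu> p) {0}"
      using homogeneous_field.origin_stable[OF homogeneous_field_reverse[OF hf], of "- \<mu>"] that
      by (simp add: hfield_reverse F_def)
  qed auto
  moreover have "asymptotically_stable (F \<mu>) \<Gamma>" if "\<mu> \<in> I" "local_periodic_orbit F U \<mu> \<Gamma>" "\<mu> > 0" for \<mu> \<Gamma>
  proof -
    have dm: "d * \<mu> > 0" "\<Gamma> = \<Gamma>b (d * \<mu>)" using lpo that by auto
    then have "d = 1" using d that(3) by auto
    then have "G (d * \<mu>) = F \<mu>" by (simp add: G_def)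
    with bI[OF dm(1) that(1)] dm(2) show ?thesis by simp
  qed
  moreover have "unstable (F \<mu>) \<Gamma>" if "\<mu> \<in> I" "local_periodic_orbit F U \<mu> \<Gamma>" "\<mu> < 0" for \<mu> \<Gamma>
  proof -
    have dm: "d * \<mu> > 0" "\<Gamma> = \<Gamma>b (d * \<mu>)" using lpo that by auto
    then have "d = - 1" using d that(3) by auto
    then have "G (d * \<mu>) = (\<lambda>p. - F \<mu> p)" by (simp add: G_def)
    moreover have "\<Gamma> \<noteq> {}" using that(2) by (auto simp: local_periodic_orbit_def periodic_orbit_def)
    ultimately show ?thesis
      using bI[OF dm(1) that(1)] dm(2) by (intro unstable_of_asymptotically_stable_reverse) auto
  qed
  moreover have "subcritical F I U" if "s > 0"
    using that d lpo stab0 by (auto simp: subcritical_def)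
  moreover have "supercritical F I U" if "s < 0"
    using that d lpo unst0 by (auto simp: supercritical_def)
  moreover have "open I" "is_interval I" "0 \<in> I" "open U" "0 \<in> U"
    using mu0 R by (auto simp: I_def U_def is_interval_oo)
  ultimately show ?thesis unfolding c_def by (intro exI[of _ I] exI[of _ U] exI[of _ r0] conjI) blast+
qed

section \<open>The piecewise quadratic system\<close>

text \<open>Hiding the constant makes the property closed under sums and products, so it can be
  derived along the syntax of \<open>quad\<close>. On a disc the factors are bounded, which products
  need.\<close>

definition Lipschitz_on_disc :: "(plane \<Rightarrow> real) \<Rightarrow> bool" where
  "Lipschitz_on_disc f \<longleftrightarrow> (\<exists>L. L-lipschitz_on (cball 0 1) f)"

lemma Lipschitz_on_disc_add:
  "Lipschitz_on_disc f \<Longrightarrow> Lipschitz_on_disc g \<Longrightarrow> Lipschitz_on_disc (\<lambda>x. f x + g x)"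
  unfolding Lipschitz_on_disc_def by (blast intro: lipschitz_on_add)

lemma Lipschitz_on_disc_const: "Lipschitz_on_disc (\<lambda>_. c)"
  unfolding Lipschitz_on_disc_def by (blast intro: lipschitz_on_constant)

lemma Lipschitz_on_disc_mult:
  assumes "Lipschitz_on_disc f" "Lipschitz_on_disc g"
  shows "Lipschitz_on_disc (\<lambda>x. f x * g x)"
proof -
  obtain A B where A: "A-lipschitz_on (cball 0 1) f" and B: "B-lipschitz_on (cball 0 1) g"
    using assms unfolding Lipschitz_on_disc_def by blast
  have bd: "\<exists>a\<ge>0. \<forall>x\<in>cball 0 1. \<bar>q x\<bar> \<le> a" if "L-lipschitz_on (cball 0 1) q" for q :: "plane \<Rightarrow> real" and L
  proof -
    have "compact (q ` cball 0 1)"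
      by (rule compact_continuous_image[OF lipschitz_on_continuous_on[OF that]]) simp
    then obtain a where "\<forall>y\<in>q ` cball 0 1. norm y \<le> a" using compact_imp_bounded bounded_iff by metis
    then show ?thesis by (intro exI[of _ "max a 0"]) auto
  qed
  obtain a b where a: "0 \<le> a" "\<And>x. x \<in> cball 0 1 \<Longrightarrow> \<bar>f x\<bar> \<le> a"
    and b: "0 \<le> b" "\<And>x. x \<in> cball 0 1 \<Longrightarrow> \<bar>g x\<bar> \<le> b"
    using bd[OF A] bd[OF B] by blast
  have "(a * B + b * A)-lipschitz_on (cball 0 1) (\<lambda>x. f x * g x)"
  proof (rule lipschitz_onI)
    show "0 \<le> a * B + b * A" using a b lipschitz_on_nonneg[OF A] lipschitz_on_nonneg[OF B] by simp
    fix x y :: plane assume xy: "x \<in> cball 0 1" "y \<in> cball 0 1"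
    have "f x * g x - f y * g y = f x * (g x - g y) + g y * (f x - f y)" by (simp add: algebra_simps)
    then have "\<bar>f x * g x - f y * g y\<bar> \<le> \<bar>f x\<bar> * \<bar>g x - g y\<bar> + \<bar>g y\<bar> * \<bar>f x - f y\<bar>"
      by (metis abs_mult abs_triangle_ineq)
    also have "\<dots> \<le> a * (B * dist x y) + b * (A * dist x y)"
      using a b xy lipschitz_onD[OF A xy] lipschitz_onD[OF B xy]
      by (intro add_mono mult_mono) (auto simp: dist_real_def)
    finally show "dist (f x * g x) (f y * g y) \<le> (a * B + b * A) * dist x y"
      by (simp add: dist_real_def algebra_simps)
  qed
  then show ?thesis unfolding Lipschitz_on_disc_def by blast
qed

text \<open>A piecewise linear function with one kink is a combination of the identity and the
  absolute value.\<close>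

lemma Lipschitz_on_disc_pl:
  assumes "Lipschitz_on_disc f"
  shows "Lipschitz_on_disc (\<lambda>x. pl p q (f x))"
proof -
  obtain L where L: "L-lipschitz_on (cball 0 1) f" using assms unfolding Lipschitz_on_disc_def by blast
  have "1-lipschitz_on (f ` cball 0 1) (\<lambda>u. \<bar>u\<bar>)" by (rule lipschitz_onI) (auto simp: dist_real_def)
  from lipschitz_on_compose2[OF L this] have "Lipschitz_on_disc (\<lambda>x. \<bar>f x\<bar>)"
    unfolding Lipschitz_on_disc_def by blast
  then have "Lipschitz_on_disc (\<lambda>x. (p + q) / 2 * f x + (p - q) / 2 * \<bar>f x\<bar>)"
    by (intro Lipschitz_on_disc_add Lipschitz_on_disc_mult Lipschitz_on_disc_const assms)
  moreover have "pl p q u = (p + q) / 2 * u + (p - q) / 2 * \<bar>u\<bar>" for u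
    by (simp add: pl_def field_simps)
  ultimately show ?thesis by simp
qed

lemma Lipschitz_on_disc_fst: "Lipschitz_on_disc fst"
  and Lipschitz_on_disc_snd: "Lipschitz_on_disc snd"
  unfolding Lipschitz_on_disc_def
  by (intro exI[of _ 1] lipschitz_onI; simp add: dist_fst_le dist_snd_le)+

lemma Lipschitz_on_disc_quad: "Lipschitz_on_disc (\<lambda>x. quad k p q (fst x) (snd x))"
  unfolding quad_def
  by (intro Lipschitz_on_disc_add Lipschitz_on_disc_mult Lipschitz_on_disc_const
      Lipschitz_on_disc_pl Lipschitz_on_disc_fst Lipschitz_on_disc_snd)

lemma pl_scale: "0 \<le> c \<Longrightarrow> pl p q (c * u) = c * pl p q u"
  by (cases "c = 0") (simp_all add: pl_def zero_le_mult_iff)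

lemma quad_scale: "0 \<le> c \<Longrightarrow> quad k p q (c * v) (c * w) = c\<^sup>2 * quad k p q v w"
  by (simp add: quad_def pl_scale algebra_simps power2_eq_square)

definition quad_field ::
    "(nat \<Rightarrow> nat \<Rightarrow> real) \<Rightarrow> (nat \<Rightarrow> real) \<Rightarrow> (nat \<Rightarrow> real) \<Rightarrow>
     (nat \<Rightarrow> nat \<Rightarrow> real) \<Rightarrow> (nat \<Rightarrow> real) \<Rightarrow> (nat \<Rightarrow> real) \<Rightarrow> plane \<Rightarrow> plane" where
  "quad_field a \<alpha>p \<alpha>m b \<beta>p \<beta>m x =
     (quad a \<alpha>p \<alpha>m (fst x) (snd x), quad b \<beta>p \<beta>m (fst x) (snd x))"

lemma planar_field_eq: "planar_field \<omega> a \<alpha>p \<alpha>m b \<beta>p \<beta>m = hfield \<omega> (quad_field a \<alpha>p \<alpha>m b \<beta>p \<beta>m)"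
  by (intro ext) (auto simp: planar_field_def hfield_def quad_field_def)

lemma homogeneous_quad_field:
  assumes "\<omega> \<noteq> 0"
  shows "\<exists>L. homogeneous_field \<omega> L (quad_field a \<alpha>p \<alpha>m b \<beta>p \<beta>m)"
proof -
  obtain A B where "A-lipschitz_on (cball 0 1) (\<lambda>x. quad a \<alpha>p \<alpha>m (fst x) (snd x))"
    "B-lipschitz_on (cball 0 1) (\<lambda>x. quad b \<beta>p \<beta>m (fst x) (snd x))"
    using Lipschitz_on_disc_quad unfolding Lipschitz_on_disc_def by metis
  from lipschitz_on_Pair[OF this] have "homogeneous_field \<omega> (sqrt (A\<^sup>2 + B\<^sup>2)) (quad_field a \<alpha>p \<alpha>m b \<beta>p \<beta>m)"
    using assms by unfold_locales (simp_all add: quad_field_def[abs_def] quad_scale)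
  then show ?thesis by blast
qed

section \<open>The mean of the radial coefficient\<close>

lemma cubic_has_integral:
  fixes x y A B C D :: real
  assumes "x \<le> y"
  shows "((\<lambda>t. A * cos t ^ 3 + B * (cos t)\<^sup>2 * sin t + C * cos t * (sin t)\<^sup>2 + D * sin t ^ 3) has_integral
    (A * (sin y - sin y ^ 3 / 3) - B * cos y ^ 3 / 3 + C * sin y ^ 3 / 3 + D * (cos y ^ 3 / 3 - cos y)) -
    (A * (sin x - sin x ^ 3 / 3) - B * cos x ^ 3 / 3 + C * sin x ^ 3 / 3 + D * (cos x ^ 3 / 3 - cos x))) {x..y}"
proof (rule fundamental_theorem_of_calculus[OF assms])
  fix t :: real
  have c: "cos t ^ 3 = cos t * (1 - (sin t)\<^sup>2)" and s: "sin t ^ 3 = sin t * (1 - (cos t)\<^sup>2)"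
    unfolding cos_squared_eq[symmetric] sin_squared_eq[symmetric]
    by (simp_all add: power3_eq_cube power2_eq_square)
  have "((\<lambda>t. A * (sin t - sin t ^ 3 / 3) - B * cos t ^ 3 / 3 + C * sin t ^ 3 / 3 + D * (cos t ^ 3 / 3 - cos t))
      has_real_derivative A * (cos t * (1 - (sin t)\<^sup>2)) + B * (cos t)\<^sup>2 * sin t + C * cos t * (sin t)\<^sup>2 +
        D * (sin t * (1 - (cos t)\<^sup>2))) (at t within {x..y})"
    by (auto intro!: derivative_eq_intros simp: algebra_simps power2_eq_square)
  then show "((\<lambda>t. A * (sin t - sin t ^ 3 / 3) - B * cos t ^ 3 / 3 + C * sin t ^ 3 / 3 + D * (cos t ^ 3 / 3 - cos t))
      has_vector_derivative A * cos t ^ 3 + B * (cos t)\<^sup>2 * sin t + C * cos t * (sin t)\<^sup>2 + D * sin t ^ 3) (at t within {x..y})"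
    unfolding has_real_derivative_iff_has_vector_derivative c s .
qed

text \<open>\<open>P\<close> and \<open>S\<close> record the signs of cosine and sine, so one cubic
  form in them covers all four quadrants.\<close>

lemma radial_quad_cubic:
  assumes "\<And>p q. pl p q (cos t) = (if P then p else q) * cos t"
    and "\<And>p q. pl p q (sin t) = (if S then p else q) * sin t"
  shows "radial (quad_field a \<alpha>p \<alpha>m b \<beta>p \<beta>m) t =
    (a 1 1 * (if P then \<alpha>p 1 else \<alpha>m 1)) * cos t ^ 3 +
    (a 1 2 * (if S then \<alpha>p 2 else \<alpha>m 2) + a 2 1 * (if P then \<alpha>p 3 else \<alpha>m 3) + b 1 1 * (if P then \<beta>p 1 else \<beta>m 1)) * (cos t)\<^sup>2 * sin t +
    (a 2 2 * (if S then \<alpha>p 4 else \<alpha>m 4) + b 1 2 * (if S then \<beta>p 2 else \<beta>m 2) + b 2 1 * (if P then \<beta>p 3 else \<beta>m 3)) * cos t * (sin t)\<^sup>2 +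
    (b 2 2 * (if S then \<beta>p 4 else \<beta>m 4)) * sin t ^ 3"
  unfolding radial_def quad_field_def polar_def
  by (simp add: quad_def assms algebra_simps power2_eq_square power3_eq_cube)

text \<open>The constant conditions give the shape demanded by \<open>radial_quad_cubic\<close>.
  Both facts include the argument 0, so closed quadrants can be used.\<close>

lemma pl_nonneg: "0 \<le> u \<Longrightarrow> pl p q u = (if True then p else q) * u"
  and pl_nonpos: "u \<le> 0 \<Longrightarrow> pl p q u = (if False then p else q) * u"
  by (auto simp: pl_def)

text \<open>In the sum over the quadrants the terms with \<open>a 2 1\<close>, \<open>a 2 2\<close>,
  \<open>b 1 1\<close> and \<open>b 1 2\<close> cancel. The squares of the remaining ones contribute
  jumps with weight 4/3 for \<open>a 1 1\<close> and \<open>b 2 2\<close>, and 2/3 for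
  \<open>a 1 2\<close> and \<open>b 2 1\<close>; together this is
  \<open>4/3 * sigma_sharp\<close>.\<close>

lemma radial_quad_mean:
  "(radial (quad_field a \<alpha>p \<alpha>m b \<beta>p \<beta>m) has_integral
     2 * pi * (2 * sigma_sharp a \<alpha>p \<alpha>m b \<beta>p \<beta>m / (3 * pi))) {0..2 * pi}"
proof -
  let ?r = "radial (quad_field a \<alpha>p \<alpha>m b \<beta>p \<beta>m)"
  have cos_nonpos: "cos t \<le> 0" if "pi / 2 \<le> t" "t \<le> 3 * pi / 2" for t
    using cos_ge_zero[of "t - pi"] that by (simp add: cos_diff)
  have sin_nonpos: "sin t \<le> 0" if "pi \<le> t" "t \<le> 2 * pi" for t
    using sin_ge_zero[of "t - pi"] that by (simp add: sin_diff)
  have cos_nonneg: "0 \<le> cos t" if "3 * pi / 2 \<le> t" "t \<le> 2 * pi" for t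
    using cos_ge_zero[of "t - 2 * pi"] that by (simp add: cos_diff)
  have cos32: "cos (3 * pi / 2) = 0" "sin (3 * pi / 2) = - 1"
    using cos_3over2_pi sin_3over2_pi by (simp_all add: mult.commute)
  note I = has_integral_eq[OF _ cubic_has_integral]
  have 1: "(?r has_integral (2 * (a 1 1 * \<alpha>p 1) + (a 1 2 * \<alpha>p 2 + a 2 1 * \<alpha>p 3 + b 1 1 * \<beta>p 1) +
      (a 2 2 * \<alpha>p 4 + b 1 2 * \<beta>p 2 + b 2 1 * \<beta>p 3) + 2 * (b 2 2 * \<beta>p 4)) / 3) {0..pi / 2}"
    by (rule has_integral_eq_rhs, rule I, rule sym, rule radial_quad_cubic, rule pl_nonneg,
        simp add: cos_ge_zero, rule pl_nonneg, simp add: sin_ge_zero, simp, simp add: field_simps)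
  have 2: "(?r has_integral (- 2 * (a 1 1 * \<alpha>m 1) + (a 1 2 * \<alpha>p 2 + a 2 1 * \<alpha>m 3 + b 1 1 * \<beta>m 1) -
      (a 2 2 * \<alpha>p 4 + b 1 2 * \<beta>p 2 + b 2 1 * \<beta>m 3) + 2 * (b 2 2 * \<beta>p 4)) / 3) {pi / 2..pi}"
    by (rule has_integral_eq_rhs, rule I, rule sym, rule radial_quad_cubic, rule pl_nonpos,
        simp add: cos_nonpos, rule pl_nonneg, simp add: sin_ge_zero, simp, simp add: field_simps)
  have 3: "(?r has_integral (- 2 * (a 1 1 * \<alpha>m 1) - (a 1 2 * \<alpha>m 2 + a 2 1 * \<alpha>m 3 + b 1 1 * \<beta>m 1) -
      (a 2 2 * \<alpha>m 4 + b 1 2 * \<beta>m 2 + b 2 1 * \<beta>m 3) - 2 * (b 2 2 * \<beta>m 4)) / 3) {pi..3 * pi / 2}"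
    by (rule has_integral_eq_rhs, rule I, rule sym, rule radial_quad_cubic, rule pl_nonpos,
        simp add: cos_nonpos, rule pl_nonpos, simp add: sin_nonpos, simp, unfold cos32, simp add: field_simps)
  have 4: "(?r has_integral (2 * (a 1 1 * \<alpha>p 1) - (a 1 2 * \<alpha>m 2 + a 2 1 * \<alpha>p 3 + b 1 1 * \<beta>p 1) +
      (a 2 2 * \<alpha>m 4 + b 1 2 * \<beta>m 2 + b 2 1 * \<beta>p 3) - 2 * (b 2 2 * \<beta>m 4)) / 3) {3 * pi / 2..2 * pi}"
    by (rule has_integral_eq_rhs, rule I, rule sym, rule radial_quad_cubic, rule pl_nonneg,
        simp add: cos_nonneg, rule pl_nonpos, simp add: sin_nonpos, simp, unfold cos32, simp add: field_simps)
  have "pi / 2 \<le> pi" "pi \<le> 3 * pi / 2" "3 * pi / 2 \<le> 2 * pi" "0 \<le> pi / 2" "0 \<le> pi" "0 \<le> 3 * pi / 2" by simp_all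
  note le = this
  from has_integral_combine[OF le(6,3) has_integral_combine[OF le(5,2) has_integral_combine[OF le(4,1) 1 2] 3] 4]
  show ?thesis
    by (rule has_integral_eq_rhs) (simp add: sigma_sharp_def field_simps)
qed

theorem theorem4p1:
  fixes \<omega> :: real
    and a b :: "nat \<Rightarrow> nat \<Rightarrow> real"
    and \<alpha>p \<alpha>m \<beta>p \<beta>m :: "nat \<Rightarrow> real"
  defines "F \<equiv> planar_field \<omega> a \<alpha>p \<alpha>m b \<beta>p \<beta>m"
    and "\<sigma> \<equiv> sigma_sharp a \<alpha>p \<alpha>m b \<beta>p \<beta>m"
  assumes "\<omega> \<noteq> 0" and "\<sigma> \<noteq> 0"
  shows "\<exists>I U r0. open I \<and> is_interval I \<and> 0 \<in> I \<and> open U \<and> 0 \<in> U \<and>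
    degenerate_Hopf F I U r0 (- (3 * pi / (2 * \<sigma>))) \<and>
    (\<sigma> > 0 \<longrightarrow> subcritical F I U) \<and>
    (\<sigma> < 0 \<longrightarrow> supercritical F I U) \<and>
    (\<forall>\<mu>\<in>I. \<forall>\<Gamma>. local_periodic_orbit F U \<mu> \<Gamma> \<longrightarrow>
       (\<mu> > 0 \<longrightarrow> asymptotically_stable (F \<mu>) \<Gamma>) \<and>
       (\<mu> < 0 \<longrightarrow> unstable (F \<mu>) \<Gamma>)) \<and>
    (\<forall>\<mu>\<in>I. (\<mu> > 0 \<longrightarrow> unstable (F \<mu>) {0}) \<and>
       (\<mu> < 0 \<longrightarrow> asymptotically_stable (F \<mu>) {0}))"
proof -
  \<comment> \<open>The mean of the radial coefficient; the amplitude coefficient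
    \<open>- 1 / s\<close> then becomes the one in the statement.\<close>
  define s where "s = 2 * \<sigma> / (3 * pi)"
  have s: "s \<noteq> 0" "s > 0 \<longleftrightarrow> \<sigma> > 0" "s < 0 \<longleftrightarrow> \<sigma> < 0" "- 1 / s = - (3 * pi / (2 * \<sigma>))"
    using \<open>\<sigma> \<noteq> 0\<close> by (auto simp: s_def zero_less_divide_iff divide_less_0_iff)
  obtain L where hf: "homogeneous_field \<omega> L (quad_field a \<alpha>p \<alpha>m b \<beta>p \<beta>m)"
    using homogeneous_quad_field[OF \<open>\<omega> \<noteq> 0\<close>] by blast
  have "(radial (quad_field a \<alpha>p \<alpha>m b \<beta>p \<beta>m) has_integral 2 * pi * s) {0..2 * pi}"
    using radial_quad_mean[of a \<alpha>p \<alpha>m b \<beta>p \<beta>m] by (simp only: s_def \<sigma>_def)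
  from homogeneous_Hopf[OF hf s(1) this]
  show ?thesis unfolding F_def planar_field_eq s(2,3,4) .
qed

end
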